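(* Let $H$ be a graph and let $s$ be a positive integer. If $\mathcal{G}$ is a class of graphs such that no graph $G\in\mathcal{G}$ contains $K_s$, $K_{s,s}$, or any subdivision of $H$ as an induced subgraph, then $\mathcal{G}$ has bounded expansion.
   Context: Graphs are finite, simple, undirected, and have at least one vertex. A subdivision of a graph $H$ is a graph obtained from $H$ by subdividing each of its edges by some number (possibly zero, not necessarily the same for each edge) of new vertices. $K_s$ is the complete graph on $s$ vertices and $K_{s,s}$ is the complete bipartite graph with both parts of size $s$. For a non-negative integer $k$, a $(\le k)$-subdivision of a graph $F$ is a graph obtained from $F$ by subdividing each of its edges by at most $k$ vertices (not necessarily the same number on each edge). For a graph $G$, $\widetilde{\nabla}_k(G)$ denotes the maximum average degree of a graph $F$ such that some $(\le k)$-subdivision of $F$ appears as a (not necessarily induced) subgraph of $G$, i.e., the maximum of the average degrees $2|E(F)|/|V(F)|$ over all such $F$. A class of graphs $\mathcal{G}$ has bounded expansion if there exists a function $f:\mathbb{Z}_{\ge 0}\to\mathbb{Z}_{\ge 0}$ such that $\widetilde{\nabla}_k(G)\le f(k)$ for every $G\in\mathcal{G}$ and every non-negative integer $k$. *)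

theory Defs
  imports Complex_Main "Graph_Theory.Graph_Theory"
begin

text \<open>
  An undirected simple graph is a finite loop-free symmetric relation (\<^locale>\<open>pair_graph\<close>); each
  undirected edge is represented by two opposite arcs.
\<close>

definition simple_graph :: "'a pair_pre_digraph \<Rightarrow> bool" where
  "simple_graph G \<longleftrightarrow> pair_graph G \<and> pverts G \<noteq> {}"

text \<open>
  The library relation \<^term>\<open>subdivision_pair F S\<close> keeps the vertices of \<open>F\<close> as the branch vertices of
  \<open>S\<close>. A subdivision of a graph over another type is therefore a library subdivision of an
  isomorphic copy.
\<close>

definition is_subdivision_of :: "'a pair_pre_digraph \<Rightarrow> 'b pair_pre_digraph \<Rightarrow> bool" where
  "is_subdivision_of S H \<longleftrightarrow>
     (\<exists>H'. digraph_iso (with_proj H) (with_proj H') \<and> subdivision_pair H' S)"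

text \<open>
  In a subdivision \<open>S\<close> of a simple graph \<open>F\<close>, the path that replaces the edge \<open>uv\<close> is the only path
  of \<open>S\<close> from \<open>u\<close> to \<open>v\<close> without branch vertices in its interior.
\<close>

definition le_subdivision :: "nat \<Rightarrow> 'a pair_pre_digraph \<Rightarrow> 'a pair_pre_digraph \<Rightarrow> bool" where
  "le_subdivision k F S \<longleftrightarrow> subdivision_pair F S \<and>
     (\<forall>(u, v) \<in> parcs F. \<exists>p. pre_digraph.gen_iapath (with_proj S) (pverts F) u p v \<and>
        length (pre_digraph.inner_verts (with_proj S) p) \<le> k)"

text \<open>The number of arcs is already twice the number of undirected edges.\<close>

definition avg_degree :: "'a pair_pre_digraph \<Rightarrow> real" where
  "avg_degree F = real (card (parcs F)) / real (card (pverts F))"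

text \<open>
  Branch vertices of a subdivision inside \<open>G\<close> are vertices of \<open>G\<close>, so up to isomorphism it
  suffices to let \<open>F\<close> range over graphs on the vertex type of \<open>G\<close>.\<close>

definition top_grad :: "nat \<Rightarrow> 'a pair_pre_digraph \<Rightarrow> real" where
  "top_grad k G = Max {avg_degree F | F. simple_graph F \<and>
     (\<exists>S. subgraph (with_proj S) (with_proj G) \<and> le_subdivision k F S)}"

lemma le_subdivision_refl:
  assumes "simple_graph F"
  shows "le_subdivision k F F"
proof -
  interpret pair_graph F
    using assms by (simp add: simple_graph_def)
  have "\<exists>p. gen_iapath (pverts F) u p v \<and> length (inner_verts p) \<le> k"
    if "(u, v) \<in> parcs F" for u v
    using that wellformed'[OF that] no_loops'[OF that]
    by (intro exI[of _ "[(u, v)]"])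
       (auto simp: gen_iapath_def apath_def awalk_def inner_verts_def)
  moreover have "subdivision_pair F F"
    by (rule subdivision_pair_base) unfold_locales
  ultimately show ?thesis
    by (auto simp: le_subdivision_def)
qed

text \<open>The maximum in the definition of \<^const>\<open>top_grad\<close> is over a finite nonempty set.\<close>

lemma top_grad_finite_nonempty:
  fixes k :: nat
  assumes "simple_graph G"
  defines "A \<equiv> {F. simple_graph F \<and>
     (\<exists>S. subgraph (with_proj S) (with_proj G) \<and> le_subdivision k F S)}"
  shows "finite (avg_degree ` A)"
    and "avg_degree ` A \<noteq> {}"
proof -
  interpret pair_graph G
    using assms by (simp add: simple_graph_def)
  have "A \<subseteq> (\<lambda>(V, E). \<lparr>pverts = V, parcs = E\<rparr>) ` (Pow (pverts G) \<times> Pow (pverts G \<times> pverts G))"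
  proof
    fix F assume "F \<in> A"
    then obtain S where F: "pair_graph F" and S: "subgraph (with_proj S) (with_proj G)"
      and sd: "subdivision_pair F S"
      by (auto simp: A_def simple_graph_def le_subdivision_def)
    have "pverts F \<subseteq> pverts G"
      using subdivision_verts_subset[OF sd] S by (auto simp: subgraph_def)
    moreover have "parcs F \<subseteq> pverts F \<times> pverts F"
      using pair_wf_digraph.wellformed'[of F] F
      by (auto simp: pair_graph_def pair_digraph_def pair_fin_digraph_def)
    ultimately show "F \<in> (\<lambda>(V, E). \<lparr>pverts = V, parcs = E\<rparr>) `
        (Pow (pverts G) \<times> Pow (pverts G \<times> pverts G))"
      by (intro image_eqI[of _ _ "(pverts F, parcs F)"]) auto
  qed
  then have "finite A"
    using finite_subset pair_finite_verts by fastforce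
  then show "finite (avg_degree ` A)" by simp
  have "subgraph (with_proj G) (with_proj G)"
    by (simp add: subgraph_def compatible_def wf_digraph)
  then have "G \<in> A"
    using assms(1) le_subdivision_refl by (auto simp: A_def)
  then show "avg_degree ` A \<noteq> {}" by blast
qed

definition bounded_expansion :: "'a pair_pre_digraph set \<Rightarrow> bool" where
  "bounded_expansion \<G> \<longleftrightarrow> (\<exists>f :: nat \<Rightarrow> nat. \<forall>G\<in>\<G>. \<forall>k. top_grad k G \<le> real (f k))"

definition contains_induced :: "'a pair_pre_digraph \<Rightarrow> ('a pair_pre_digraph \<Rightarrow> bool) \<Rightarrow> bool" where
  "contains_induced G P \<longleftrightarrow> (\<exists>S. induced_subgraph (with_proj S) (with_proj G) \<and> P S)"

end

theory Submission
  imports Defs "HOL-Library.Ramsey"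
begin

text \<open>
  By Ramsey's theorem the graphs \<open>G\<close> of the class contain no \<open>K\<^sub>t\<^sub>,\<^sub>t\<close> as a subgraph, for some \<open>t\<close>. It suffices to find in \<open>G\<close>
  an induced subdivision, with every edge subdivided, of some graph of large average degree: the latter graph
  contains a subdivision of \<open>H\<close> by Mader's theorem, and its subgraphs correspond to induced subgraphs of \<open>G\<close>.

  First, every \<open>K\<^sub>t\<^sub>,\<^sub>t\<close>-free graph of large average degree contains such a subdivision (a theorem of Kuehn and Osthus).
  In an induced subgraph of maximal density \<open>d\<close>, split off the set \<open>L\<close> of vertices of degree more than \<open>K d\<close> for a
  large constant \<open>K\<close>. If the rest has many edges, it is almost regular, and random branch and subdivision vertices
  work after deletions, as \<open>K\<^sub>t\<^sub>,\<^sub>t\<close>-freeness makes triangles and 4-cycles rare. Otherwise many vertices send about \<open>d\<close>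
  edges to the much smaller set \<open>L\<close>; the pairs in \<open>L\<close> with a common neighbour then form a graph so dense that a
  random subset of \<open>L\<close> can serve as the set of branch vertices.

  Hence all induced subgraphs of \<open>G\<close> are sparse, with a uniform constant. Given a \<open>(\<le> k)\<close>-subdivision in \<open>G\<close> of a
  graph of huge average degree, a random choice of its branch vertices and paths, followed by deletions, then
  makes it induced at the cost of a factor depending only on \<open>k\<close> and that constant.
\<close>

section \<open>The deletion method\<close>

text \<open>Subdividing every edge is what makes deletions harmless: an edge of the subdivided graph
  disappears with its interior vertices, whereas an edge between two branch vertices could only be
  removed by giving up one of them. Hence every sample below has to end with independent branch
  vertices. The two stages are forced by the second one: a path of a (<= k)-subdivision can be
  expected to survive only if the other sampled vertices and paths touch it boundedly often. This
  fails in general K_{t,t}-free graphs, but holds on average once every vertex set spans only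
  linearly many edges, and the first stage supplies that bound with a constant independent of the
  graph. No probability space is used: an expectation is a polynomial of degree at most one in each
  sampling probability, so some 0/1 point does at least as well. All three random choices are
  instances of \<open>deletion_method\<close>; they differ in the weights and in the list of
  conflicts.\<close>

lemma exists_01_point_ge:
  fixes p :: "'u \<Rightarrow> real" and w :: "'k \<Rightarrow> real"
  assumes "finite U" "finite K" "\<And>k. k \<in> K \<Longrightarrow> finite (Q k)"
    and "\<And>u. u \<in> U \<Longrightarrow> 0 \<le> p u \<and> p u \<le> 1"
  shows "\<exists>x. (\<forall>u\<in>U. x u \<in> {0,1}) \<and> (\<forall>u. u \<notin> U \<longrightarrow> x u = p u) \<and>
    (\<Sum>k\<in>K. w k * (\<Prod>u\<in>Q k. p u)) \<le> (\<Sum>k\<in>K. w k * (\<Prod>u\<in>Q k. x u))" using assms(1,4)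
proof (induction U rule: finite_induct)
  case empty
  then show ?case by auto
next
  case (insert z U)
  then obtain x where x: "\<forall>u\<in>U. x u \<in> {0,1}" "\<forall>u. u \<notin> U \<longrightarrow> x u = p u"
    "(\<Sum>k\<in>K. w k * (\<Prod>u\<in>Q k. p u)) \<le> (\<Sum>k\<in>K. w k * (\<Prod>u\<in>Q k. x u))" by auto
  define f where "f y = (\<Sum>k\<in>K. w k * (\<Prod>u\<in>Q k. y u))" for y :: "'u \<Rightarrow> real"
  define a where "a = (\<Sum>k\<in>{k\<in>K. z \<in> Q k}. w k * (\<Prod>u\<in>Q k - {z}. x u))"
  define b where "b = (\<Sum>k\<in>{k\<in>K. z \<notin> Q k}. w k * (\<Prod>u\<in>Q k. x u))"
  \<comment> \<open>Each \<open>Q k\<close> is a set, so \<open>z\<close> occurs at most once in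
    every product and \<open>f\<close> is affine in that coordinate; one of the values at 0 and 1 is
    at least the value at \<open>p z\<close>.\<close>
  have f: "f (x(z := t)) = t * a + b" for t
  proof -
    have "f (x(z := t)) = (\<Sum>k\<in>K. if z \<in> Q k then w k * (t * (\<Prod>u\<in>Q k - {z}. x u)) else w k * (\<Prod>u\<in>Q k. x u))"
      unfolding f_def
    proof (rule sum.cong[OF refl])
      fix k assume "k \<in> K"
      then have "finite (Q k)" using assms by auto
      show "w k * (\<Prod>u\<in>Q k. (x(z := t)) u) = (if z \<in> Q k then w k * (t * (\<Prod>u\<in>Q k - {z}. x u)) else w k * (\<Prod>u\<in>Q k. x u))"
      proof (cases "z \<in> Q k")
        case True
        then have "(\<Prod>u\<in>Q k. (x(z := t)) u) = t * (\<Prod>u\<in>Q k - {z}. (x(z := t)) u)"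
          using \<open>finite (Q k)\<close> by (simp add: prod.remove)
        also have "(\<Prod>u\<in>Q k - {z}. (x(z := t)) u) = (\<Prod>u\<in>Q k - {z}. x u)" by (rule prod.cong) auto
        finally show ?thesis using True by simp
      next
        case False
        then have "(\<Prod>u\<in>Q k. (x(z := t)) u) = (\<Prod>u\<in>Q k. x u)" by (intro prod.cong) auto
        then show ?thesis using False by simp
      qed
    qed
    also have "\<dots> = t * a + b"
      unfolding a_def b_def using \<open>finite K\<close> by (simp add: sum.If_cases sum_distrib_left Int_def mult.left_commute)
    finally show ?thesis .
  qed
  have "x z = p z" using x insert by auto
  then have fx: "f x = p z * a + b" using f[of "p z"] by (simp add: fun_upd_idem)
  have pz: "0 \<le> p z" "p z \<le> 1" using insert by auto
  have "\<exists>t\<in>{0,1}. f x \<le> f (x(z := t))"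
  proof (cases "a \<ge> 0")
    case True
    then have "p z * a \<le> 1 * a" using pz by (intro mult_right_mono) auto
    then show ?thesis using fx f[of 1] by auto
  next
    case False
    then have "p z * a \<le> 0" using pz by (intro mult_nonneg_nonpos) auto
    then show ?thesis using fx f[of 0] by auto
  qed
  then obtain t where "t \<in> {0,1}" "f x \<le> f (x(z := t))" by blast
  then show ?case using x unfolding f_def by (intro exI[of _ "x(z := t)"]) auto
qed

text \<open>With every \<open>u\<close> put into \<open>S\<close> independently with probability
  \<open>p u\<close>, the left side is the expectation of the right side.\<close>

lemma exists_subset_ge:
  fixes p :: "'u \<Rightarrow> real" and w :: "'k \<Rightarrow> real"
  assumes "finite U" "finite K" "\<And>k. k \<in> K \<Longrightarrow> Q k \<subseteq> U"
    and "\<And>u. u \<in> U \<Longrightarrow> 0 \<le> p u \<and> p u \<le> 1"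
  shows "\<exists>S\<subseteq>U. (\<Sum>k\<in>K. w k * (\<Prod>u\<in>Q k. p u)) \<le> (\<Sum>k\<in>K. w k * of_bool (Q k \<subseteq> S))"
proof -
  have fin: "finite (Q k)" if "k \<in> K" for k using assms(1,3) that finite_subset by blast
  obtain x where x: "\<forall>u\<in>U. x u \<in> {0,1}"
    "(\<Sum>k\<in>K. w k * (\<Prod>u\<in>Q k. p u)) \<le> (\<Sum>k\<in>K. w k * (\<Prod>u\<in>Q k. x u))"
    using exists_01_point_ge[where Q=Q and p=p and w=w, OF assms(1,2) fin assms(4)] by blast
  define S where "S = {u\<in>U. x u = 1}"
  have "(\<Prod>u\<in>Q k. x u) = of_bool (Q k \<subseteq> S)" if kK: "k \<in> K" for k
  proof (cases "Q k \<subseteq> S")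
    case True
    then show ?thesis by (auto simp: S_def intro!: prod.neutral)
  next
    case False
    then obtain u where "u \<in> Q k" "x u \<noteq> 1" using assms(3)[OF kK] by (auto simp: S_def)
    then have "x u = 0" using x assms(3)[OF that] by auto
    then show ?thesis using False fin[OF that] \<open>u \<in> Q k\<close> by auto
  qed
  then have "(\<Sum>k\<in>K. w k * (\<Prod>u\<in>Q k. x u)) = (\<Sum>k\<in>K. w k * of_bool (Q k \<subseteq> S))" by (intro sum.cong) auto
  then show ?thesis using x by (intro exI[of _ S]) (auto simp: S_def)
qed

text \<open>A union bound: an index with \<open>R i\<close> sampled is spoilt by any sampled
  conflict \<open>Z\<close> in \<open>C i\<close>, and disjointness from \<open>R i\<close> makes
  the probabilities multiply. The size of \<open>S \<inter> A\<close> enters the same sum, so that a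
  single \<open>S\<close> balances surviving indices against elements of \<open>A\<close>.\<close>

lemma deletion_method:
  fixes p :: "'u \<Rightarrow> real" and c :: real and I :: "'i set"
  assumes U: "finite U" and I: "finite I" and A: "A \<subseteq> U"
    and R: "\<And>i. i \<in> I \<Longrightarrow> R i \<subseteq> U"
    and C: "\<And>i. i \<in> I \<Longrightarrow> finite (C i)" "\<And>i Z. i \<in> I \<Longrightarrow> Z \<in> C i \<Longrightarrow> Z \<subseteq> U \<and> Z \<inter> R i = {}"
    and p: "\<And>u. u \<in> U \<Longrightarrow> 0 \<le> p u \<and> p u \<le> 1"
    and gt: "(\<Sum>i\<in>I. (\<Prod>u\<in>R i. p u) * (\<Sum>Z\<in>C i. \<Prod>u\<in>Z. p u)) + c * (\<Sum>u\<in>A. p u) < (\<Sum>i\<in>I. \<Prod>u\<in>R i. p u)"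
  shows "\<exists>S\<subseteq>U. c * card (S \<inter> A) < card {i\<in>I. R i \<subseteq> S \<and> (\<forall>Z\<in>C i. \<not> Z \<subseteq> S)}"
proof -
  \<comment> \<open>One index set for three kinds of monomials: index sampled (weight 1), index
    sampled together with a conflict (weight -1), element of \<open>A\<close> sampled (weight
    -c).\<close>
  define K where "K = I <+> ((SIGMA i:I. C i) <+> A)"
  define w :: "'i + ('i \<times> 'u set) + 'u \<Rightarrow> real" where "w = case_sum (\<lambda>i. 1) (case_sum (\<lambda>iz. -1) (\<lambda>u. -c))"
  define Q where "Q = case_sum R (case_sum (\<lambda>(i,Z). R i \<union> Z) (\<lambda>u. {u}))"
  have finA: "finite A" using A U finite_subset by blast
  have finR: "finite (R i)" if "i \<in> I" for i using R[OF that] U finite_subset by blast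
  have finZ: "finite Z" if "i \<in> I" "Z \<in> C i" for i Z using C(2)[OF that] U finite_subset by blast
  have finS: "finite (SIGMA i:I. C i)" using I C by auto
  have finK: "finite K" unfolding K_def using I finA finS by auto
  have Q: "Q k \<subseteq> U" if "k \<in> K" for k
  proof -
    consider (a) "k \<in> Inl ` I" | (b) "k \<in> Inr ` Inl ` (SIGMA i:I. C i)" | (c) "k \<in> Inr ` Inr ` A"
      using \<open>k \<in> K\<close> unfolding K_def Plus_def by blast
    then show ?thesis
    proof cases
      case a
      then obtain i where i: "i \<in> I" "k = Inl i" by blast
      show ?thesis using R[OF i(1)] by (simp add: Q_def i)
    next
      case b
      then obtain i Z where i: "i \<in> I" "Z \<in> C i" "k = Inr (Inl (i, Z))" by blast
      show ?thesis using R[OF i(1)] C(2)[OF i(1,2)] by (simp add: Q_def i)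
    next
      case c
      then obtain u where u: "u \<in> A" "k = Inr (Inr u)" by blast
      show ?thesis using A u(1) by (auto simp: Q_def u(2))
    qed
  qed
  obtain S where S: "S \<subseteq> U" "(\<Sum>k\<in>K. w k * (\<Prod>u\<in>Q k. p u)) \<le> (\<Sum>k\<in>K. w k * of_bool (Q k \<subseteq> S))"
    using exists_subset_ge[where U=U and K=K and Q=Q and p=p and w=w, OF U finK Q p] by blast
  have expand: "(\<Sum>k\<in>K. w k * h (Q k)) =
     (\<Sum>i\<in>I. h (R i)) - (\<Sum>i\<in>I. \<Sum>Z\<in>C i. h (R i \<union> Z)) - c * (\<Sum>u\<in>A. h {u})" for h :: "'u set \<Rightarrow> real"
  proof -
    have "(\<Sum>k\<in>K. w k * h (Q k)) = (\<Sum>i\<in>I. h (R i)) + ((\<Sum>(i,Z)\<in>(SIGMA i:I. C i). - h (R i \<union> Z)) + (\<Sum>u\<in>A. - c * h {u}))"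
      unfolding K_def using I finA finS by (simp add: sum.Plus w_def Q_def case_prod_beta)
    also have "(\<Sum>(i,Z)\<in>(SIGMA i:I. C i). - h (R i \<union> Z)) = - (\<Sum>i\<in>I. \<Sum>Z\<in>C i. h (R i \<union> Z))"
      using sum.Sigma[of I C "\<lambda>i Z. - h (R i \<union> Z)"] I C(1) by (simp add: sum_negf case_prod_beta)
    finally show ?thesis by (simp add: sum_negf sum_distrib_left)
  qed
  have "(\<Sum>i\<in>I. \<Sum>Z\<in>C i. \<Prod>u\<in>R i \<union> Z. p u) = (\<Sum>i\<in>I. (\<Prod>u\<in>R i. p u) * (\<Sum>Z\<in>C i. \<Prod>u\<in>Z. p u))"
    unfolding sum_distrib_left
  proof (intro sum.cong refl)
    fix i Z assume "i \<in> I" "Z \<in> C i"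
    then show "(\<Prod>u\<in>R i \<union> Z. p u) = (\<Prod>u\<in>R i. p u) * (\<Prod>u\<in>Z. p u)"
      using C(2)[of i Z] finR finZ by (intro prod.union_disjoint) auto
  qed
  then have "0 < (\<Sum>k\<in>K. w k * (\<Prod>u\<in>Q k. p u))" using gt expand[of "\<lambda>X. \<Prod>u\<in>X. p u"] by simp
  also have "\<dots> \<le> (\<Sum>k\<in>K. w k * of_bool (Q k \<subseteq> S))" by fact
  also have "\<dots> = (\<Sum>i\<in>I. of_bool (R i \<subseteq> S) - (\<Sum>Z\<in>C i. of_bool (R i \<union> Z \<subseteq> S))) - c * (\<Sum>u\<in>A. of_bool (u \<in> S))"
    using expand[of "\<lambda>X. of_bool (X \<subseteq> S)"] by (simp add: sum_subtractf)
  also have "(\<Sum>u\<in>A. of_bool (u \<in> S)) = real (card (S \<inter> A))" using finA by (simp add: Int_commute Int_def)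
  \<comment> \<open>An index spoilt by several conflicts is subtracted several times, which only
    makes its contribution negative.\<close>
  also have "(\<Sum>i\<in>I. of_bool (R i \<subseteq> S) - (\<Sum>Z\<in>C i. of_bool (R i \<union> Z \<subseteq> S)))
     \<le> (\<Sum>i\<in>I. of_bool (R i \<subseteq> S \<and> (\<forall>Z\<in>C i. \<not> Z \<subseteq> S)) :: real)"
  proof (rule sum_mono)
    fix i assume i: "i \<in> I"
    have nn: "0 \<le> (\<Sum>Z\<in>C i. of_bool (R i \<union> Z \<subseteq> S) :: real)" by (intro sum_nonneg) auto
    have "1 \<le> (\<Sum>Z\<in>C i. of_bool (R i \<union> Z \<subseteq> S) :: real)" if "R i \<subseteq> S" "Z \<in> C i" "Z \<subseteq> S" for Z
    proof -
      have "of_bool (R i \<union> Z \<subseteq> S) \<le> (\<Sum>Z\<in>C i. of_bool (R i \<union> Z \<subseteq> S) :: real)"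
        by (rule member_le_sum) (use that C i in auto)
      then show ?thesis using that by simp
    qed
    then show "of_bool (R i \<subseteq> S) - (\<Sum>Z\<in>C i. of_bool (R i \<union> Z \<subseteq> S)) \<le> (of_bool (R i \<subseteq> S \<and> (\<forall>Z\<in>C i. \<not> Z \<subseteq> S)) :: real)"
      using nn by (cases "R i \<subseteq> S"; cases "\<forall>Z\<in>C i. \<not> Z \<subseteq> S") auto
  qed
  also have "(\<Sum>i\<in>I. of_bool (R i \<subseteq> S \<and> (\<forall>Z\<in>C i. \<not> Z \<subseteq> S)) :: real) = card {i\<in>I. R i \<subseteq> S \<and> (\<forall>Z\<in>C i. \<not> Z \<subseteq> S)}"
    using I by (simp add: Int_def)
  finally show ?thesis using S(1) by (intro exI[of _ S]) auto
qed

abbreviation deg :: "('a \<times> 'a) set \<Rightarrow> 'a set \<Rightarrow> 'a \<Rightarrow> nat" where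
  "deg E X v \<equiv> card (E `` {v} \<inter> X)"

section \<open>Degenerate graphs and graphs without complete bipartite subgraphs\<close>

definition degenerate :: "('a \<times> 'a) set \<Rightarrow> real \<Rightarrow> 'a set \<Rightarrow> bool" where
  "degenerate E D V \<longleftrightarrow> (\<forall>X\<subseteq>V. X \<noteq> {} \<longrightarrow> (\<exists>v\<in>X. real (deg E X v) \<le> D))"

lemma degenerate_mono: "degenerate E D V \<Longrightarrow> V' \<subseteq> V \<Longrightarrow> degenerate E D V'"
  unfolding degenerate_def by blast

lemma card_arcs_sum_deg:
  assumes "finite X" "finite Y"
  shows "card (E \<inter> X \<times> Y) = (\<Sum>v\<in>X. deg E Y v)"
proof -
  have "E \<inter> X \<times> Y = (SIGMA v:X. E `` {v} \<inter> Y)" by auto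
  then show ?thesis using assms by (simp add: card_SigmaI)
qed

text \<open>\<open>Restr E X\<close> holds both arcs of every edge, so the hypothesis bounds the
  average degree inside \<open>X\<close>, and some vertex does not exceed the average.\<close>

lemma sparse_imp_degenerate:
  fixes D :: real
  assumes "finite V" and sp: "\<And>X. X \<subseteq> V \<Longrightarrow> card (Restr E X) \<le> D * card X"
  shows "degenerate E D V"
  unfolding degenerate_def
proof (intro allI impI)
  fix X assume X: "X \<subseteq> V" "X \<noteq> {}"
  then have fin: "finite X" using assms finite_subset by blast
  show "\<exists>v\<in>X. deg E X v \<le> D"
  proof (rule ccontr)
    assume "\<not> ?thesis"
    then have "(\<Sum>v\<in>X. D) < (\<Sum>v\<in>X. real (deg E X v))" using fin X by (intro sum_strict_mono) auto
    then show False using sp[OF X(1)] card_arcs_sum_deg[OF fin fin, of E] by (simp add: mult.commute)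
  qed
qed

text \<open>Vertices of degree at most \<open>D\<close> are removed one by one and point to the
  neighbours that remain. Degrees in a sparse graph may be unbounded, out-degrees are not; adjacency
  among sampled branch vertices can thus be charged to few conflicts.\<close>

lemma degenerate_orientation:
  fixes D :: real
  assumes "finite V" "degenerate E D V" "sym E" "irrefl E"
  shows "\<exists>out. (\<forall>v\<in>V. out v \<subseteq> E `` {v} \<inter> V \<and> card (out v) \<le> D) \<and>
    (\<forall>u\<in>V. \<forall>v\<in>V. (u,v) \<in> E \<longrightarrow> v \<in> out u \<or> u \<in> out v)" using assms(1,2)
proof (induction V rule: finite_psubset_induct)
  case (psubset V)
  show ?case
  proof (cases "V = {}")
    case False
    then obtain v where v: "v \<in> V" "deg E V v \<le> D" using psubset.prems unfolding degenerate_def by blast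
    have psub: "V - {v} \<subset> V" using v by blast
    obtain out where out: "\<forall>w\<in>V-{v}. out w \<subseteq> E `` {w} \<inter> (V-{v}) \<and> card (out w) \<le> D"
      "\<forall>u\<in>V-{v}. \<forall>w\<in>V-{v}. (u,w) \<in> E \<longrightarrow> w \<in> out u \<or> u \<in> out w"
      using psubset.IH[OF psub degenerate_mono[OF psubset.prems Diff_subset]] by blast
    define out' where "out' = out(v := E `` {v} \<inter> V)"
    have "out' u \<subseteq> E `` {u} \<inter> V \<and> card (out' u) \<le> D" if "u \<in> V" for u
      using out(1) v that by (cases "u = v") (auto simp: out'_def)
    moreover have "w \<in> out' u \<or> u \<in> out' w" if "u \<in> V" "w \<in> V" "(u,w) \<in> E" for u w
    proof -
      have "(w,u) \<in> E" using that assms(3) by (blast dest: symD)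
      then show ?thesis using out(2) that by (cases "u = v"; cases "w = v") (auto simp: out'_def)
    qed
    ultimately show ?thesis by blast
  qed auto
qed

text \<open>Greedy: a vertex of degree at most \<open>D\<close> joins \<open>B\<close> and takes at
  most \<open>D + 1\<close> vertices out of play.\<close>

lemma degenerate_independent_set:
  fixes D :: real
  assumes "finite V" "degenerate E D V" "sym E" "irrefl E" "D \<ge> 0"
  shows "\<exists>B\<subseteq>V. Restr E B = {} \<and> card V \<le> (D + 1) * card B" using assms(1,2)
proof (induction V rule: finite_psubset_induct)
  case (psubset V)
  show ?case
  proof (cases "V = {}")
    case False
    then obtain v where v: "v \<in> V" "deg E V v \<le> D" using psubset.prems unfolding degenerate_def by blast
    define W where "W = V - insert v (E `` {v} \<inter> V)"
    have psub: "W \<subset> V" using v by (auto simp: W_def)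
    obtain B where B: "B \<subseteq> W" "Restr E B = {}" "card W \<le> (D + 1) * card B"
      using psubset.IH[OF psub degenerate_mono[OF psubset.prems psubset_imp_subset[OF psub]]] by blast
    have finB: "finite B" using B psubset.hyps finite_subset[of B V] by (auto simp: W_def)
    have "v \<notin> B" using B by (auto simp: W_def)
    have "card V = card W + card (insert v (E `` {v} \<inter> V))"
      using psubset.hyps v by (subst card_Un_disjoint[symmetric]) (auto simp: W_def intro!: arg_cong[of _ _ card])
    also have "card (insert v (E `` {v} \<inter> V)) = Suc (deg E V v)"
      using psubset.hyps assms by (subst card_insert_disjoint) (auto simp: irrefl_def)
    finally have "card V \<le> (D+1) * card (insert v B)" using B v \<open>v \<notin> B\<close> finB by (simp add: algebra_simps)
    moreover have "E \<inter> insert v B \<times> insert v B = {}"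
    proof -
      have "(v,b) \<notin> E" if "b \<in> B" for b using that B(1) by (auto simp: W_def)
      moreover have "(b,v) \<notin> E" if "b \<in> B" for b using calculation[OF that] assms(3) by (blast dest: symD)
      moreover have "(v,v) \<notin> E" using assms(4) by (simp add: irrefl_def)
      ultimately show ?thesis using B(2) by blast
    qed
    moreover have "insert v B \<subseteq> V" using B v by (auto simp: W_def)
    ultimately show ?thesis by blast
  qed auto
qed

text \<open>Cliques through a vertex of degree at most \<open>D\<close> are determined by
  \<open>t - 1\<close> of its neighbours, so removing that vertex destroys at most
  \<open>D ^ (t - 1)\<close> of them.\<close>

lemma card_cliques_degenerate:
  fixes D :: real
  assumes "finite V" "degenerate P D V" "t \<ge> 1" "D \<ge> 0"
  shows "card {Q. Q \<subseteq> V \<and> card Q = t \<and> (\<forall>x\<in>Q. \<forall>y\<in>Q. x \<noteq> y \<longrightarrow> (x,y) \<in> P)} \<le> card V * D ^ (t - 1)" using assms(1,2)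
proof (induction V rule: finite_psubset_induct)
  case (psubset V)
  let ?C = "\<lambda>V. {Q. Q \<subseteq> V \<and> card Q = t \<and> (\<forall>x\<in>Q. \<forall>y\<in>Q. x \<noteq> y \<longrightarrow> (x,y) \<in> P)}"
  show ?case
  proof (cases "V = {}")
    case True
    then have "?C V = {}" using assms(3) by auto
    then have "card (?C V) = 0" by (simp only: card.empty)
    then show ?thesis using True by simp
  next
    case False
    then obtain v where v: "v \<in> V" "deg P V v \<le> D" using psubset.prems unfolding degenerate_def by blast
    define N where "N = P `` {v} \<inter> V"
    have finN: "finite N" using psubset.hyps by (simp add: N_def)
    let ?T = "{Q. Q \<subseteq> N \<and> card Q = t - 1}"
    have "?C V \<subseteq> ?C (V - {v}) \<union> insert v ` ?T"
    proof
      fix Q assume Q: "Q \<in> ?C V"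
      show "Q \<in> ?C (V - {v}) \<union> insert v ` ?T"
      proof (cases "v \<in> Q")
        case True
        have "Q = insert v (Q - {v})" using True by auto
        moreover have "Q - {v} \<in> ?T" using Q True psubset.hyps finite_subset[of Q V] by (auto simp: N_def)
        ultimately show ?thesis by blast
      next
        case False then show ?thesis using Q by auto
      qed
    qed
    then have "card (?C V) \<le> card (?C (V - {v}) \<union> insert v ` ?T)" using psubset.hyps finN by (intro card_mono) auto
    also have "\<dots> \<le> card (?C (V - {v})) + card ?T"
      using finN by (intro order.trans[OF card_Un_le] add_mono card_image_le) auto
    finally have 1: "card (?C V) \<le> card (?C (V - {v})) + (card N choose (t - 1))" using n_subsets[OF finN] by simp
    have 2: "card (?C (V - {v})) \<le> card (V - {v}) * D ^ (t - 1)"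
      by (rule psubset.IH[OF _ degenerate_mono[OF psubset.prems Diff_subset]]) (use v in blast)
    have 3: "real (card N choose (t - 1)) \<le> D ^ (t - 1)"
    proof (cases "t - 1 \<le> card N")
      case True
      then have "card N choose (t - 1) \<le> card N ^ (t - 1)" by (rule binomial_le_pow)
      then have "real (card N choose (t - 1)) \<le> real (card N) ^ (t - 1)" by (metis of_nat_le_iff of_nat_power)
      also have "\<dots> \<le> D ^ (t - 1)" using v by (intro power_mono) (auto simp: N_def)
      finally show ?thesis .
    qed (use assms in \<open>auto simp: binomial_eq_0\<close>)
    have "real (card V) = card (V - {v}) + 1" using v psubset.hyps card_Suc_Diff1 by fastforce
    then show ?thesis using 1 2 3 by (simp add: algebra_simps)
  qed
qed

text \<open>For irreflexive \<open>E\<close> the inclusion \<open>X \<times> Y \<subseteq> E\<close>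
  forces \<open>X\<close> and \<open>Y\<close> to be disjoint, so this is the absence of K_{t,t} as
  a subgraph, induced or not.\<close>

definition biclique_free :: "nat \<Rightarrow> ('a \<times> 'a) set \<Rightarrow> bool" where
  "biclique_free t E \<longleftrightarrow> \<not> (\<exists>X Y. finite X \<and> finite Y \<and> card X = t \<and> card Y = t \<and> X \<times> Y \<subseteq> E)"

text \<open>Double counting as in the Kovari-Sos-Turan theorem: a \<open>t\<close>-set
  \<open>Q\<close> contained in the neighbourhoods of more than \<open>t\<close> vertices of
  \<open>B\<close> would give a K_{t,t}.\<close>

lemma biclique_free_subset_count:
  assumes "biclique_free t E" "finite B" "finite L" "t \<ge> 1"
  shows "(\<Sum>b\<in>B. deg E L b choose t) \<le> t * card {Q. Q \<subseteq> L \<and> card Q = t \<and> (\<exists>b\<in>B. Q \<subseteq> E `` {b})}"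
proof -
  define C where "C = {Q. Q \<subseteq> L \<and> card Q = t \<and> (\<exists>b\<in>B. Q \<subseteq> E `` {b})}"
  have finC: "finite C" using assms by (auto simp: C_def)
  have "(\<Sum>b\<in>B. deg E L b choose t) = (\<Sum>b\<in>B. \<Sum>Q\<in>C. of_bool (Q \<subseteq> E `` {b}))"
  proof (rule sum.cong[OF refl])
    fix b assume b: "b \<in> B"
    have "deg E L b choose t = card {Q. Q \<subseteq> E `` {b} \<inter> L \<and> card Q = t}" using assms by (intro n_subsets[symmetric]) auto
    also have "{Q. Q \<subseteq> E `` {b} \<inter> L \<and> card Q = t} = C \<inter> {Q. Q \<subseteq> E `` {b}}" using b unfolding C_def by blast
    finally show "deg E L b choose t = (\<Sum>Q\<in>C. of_bool (Q \<subseteq> E `` {b}))" using finC by simp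
  qed
  also have "\<dots> = (\<Sum>Q\<in>C. \<Sum>b\<in>B. of_bool (Q \<subseteq> E `` {b}))" by (rule sum.swap)
  also have "\<dots> = (\<Sum>Q\<in>C. card (B \<inter> {b. Q \<subseteq> E `` {b}}))" using assms(2) by simp
  also have "\<dots> \<le> (\<Sum>Q\<in>C. t)"
  proof (rule sum_mono)
    fix Q assume Q: "Q \<in> C"
    show "card (B \<inter> {b. Q \<subseteq> E `` {b}}) \<le> t"
    proof (rule ccontr)
      assume "\<not> ?thesis"
      then obtain X where "X \<subseteq> B \<inter> {b. Q \<subseteq> E `` {b}}" "card X = t" "finite X"
        by (metis nat_le_linear obtain_subset_with_card_n)
      then have "X \<times> Q \<subseteq> E" by auto
      moreover have "finite Q" "card Q = t" using Q finite_subset[OF _ assms(3)] by (auto simp: C_def)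
      ultimately show False using assms(1) \<open>card X = t\<close> \<open>finite X\<close> unfolding biclique_free_def by blast
    qed
  qed
  finally show ?thesis by (simp add: mult.commute C_def)
qed

text \<open>If the bound failed, linearly many vertices of \<open>X\<close> would have linear
  degree, hence altogether order D^(t+1) \<open>t\<close>-subsets of \<open>Y\<close> with
  multiplicity, against at most t D^t. Applied to neighbourhoods, it makes triangles and 4-cycles
  rare in almost regular graphs.\<close>

lemma biclique_free_sparse:
  fixes \<eta> :: real
  assumes "\<eta> > 0" "t \<ge> 1"
  shows "\<exists>D0::real. D0 \<ge> 1 \<and> (\<forall>D \<ge> D0. \<forall>E::('a\<times>'a) set. \<forall>X Y. biclique_free t E \<longrightarrow> finite X \<longrightarrow> finite Y \<longrightarrow>
    real (card X) \<le> D \<longrightarrow> real (card Y) \<le> D \<longrightarrow> card (E \<inter> X \<times> Y) \<le> \<eta> * D\<^sup>2)"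
proof -
  \<comment> \<open>\<open>c * D * D ^ t\<close> will be the lower count: more than
    \<open>\<eta> * D / 2\<close> vertices, each with at least
    \<open>(\<eta> * D / (2 * t)) ^ t\<close> subsets of size \<open>t\<close>.\<close>
  define c where "c = (\<eta>/2) * (\<eta> / (2 * real t)) ^ t"
  have c: "c > 0" using assms by (simp add: c_def)
  \<comment> \<open>The second entry makes the degrees in \<open>Z\<close> at least
    \<open>t\<close>, the third makes \<open>c * D\<close> exceed \<open>t\<close>.\<close>
  define D0 where "D0 = Max {1, 2 * real t / \<eta>, t / c + 1}"
  have D0: "D0 \<ge> 1" "D0 \<ge> 2 * real t / \<eta>" "D0 > t / c" by (auto simp: D0_def)
  have "card (E \<inter> X \<times> Y) \<le> \<eta> * D\<^sup>2" if D: "D \<ge> D0" and E: "biclique_free t E" and fin: "finite X" "finite Y"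
    and le: "real (card X) \<le> D" "real (card Y) \<le> D" for E :: "('a\<times>'a) set" and X Y D
  proof (rule ccontr)
    assume "\<not> ?thesis"
    then have big: "\<eta> * D\<^sup>2 < (\<Sum>x\<in>X. real (deg E Y x))" by (simp add: card_arcs_sum_deg[OF fin])
    define Z where "Z = {x\<in>X. deg E Y x \<ge> \<eta> * D / 2}"
    have Dpos: "D > 0" "D \<ge> 1" using D D0 by auto
    have "(\<Sum>x\<in>X. real (deg E Y x)) = (\<Sum>x\<in>Z. real (deg E Y x)) + (\<Sum>x\<in>X-Z. real (deg E Y x))"
      using fin by (subst add.commute, intro sum.subset_diff) (auto simp: Z_def)
    also have "\<dots> \<le> (\<Sum>x\<in>Z. D) + (\<Sum>x\<in>X-Z. \<eta> * D / 2)"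
    proof (intro add_mono sum_mono)
      fix x
      have "deg E Y x \<le> card Y" using fin by (intro card_mono) auto
      then show "real (deg E Y x) \<le> D" using le by linarith
    qed (auto simp: Z_def)
    also have "\<dots> \<le> card Z * D + D * (\<eta> * D / 2)"
    proof -
      have "card (X - Z) \<le> card X" using fin by (intro card_mono) auto
      then have "real (card (X - Z)) \<le> D" using le by linarith
      then show ?thesis using assms Dpos by (auto intro!: mult_right_mono)
    qed
    finally have up: "(\<Sum>x\<in>X. real (deg E Y x)) \<le> card Z * D + D * (\<eta> * D / 2)" .
    have "\<eta> * D\<^sup>2 < card Z * D + \<eta> * D\<^sup>2 / 2" 
    proof -
      have "D * (\<eta> * D / 2) = \<eta> * D\<^sup>2 / 2" by (simp add: power2_eq_square)
      then show ?thesis using big up by linarith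
    qed
    then have "D * (\<eta> * D / 2) < D * card Z" by (simp add: power2_eq_square algebra_simps)
    then have Z: "\<eta> * D / 2 < card Z" using Dpos by simp
    have finZ: "finite Z" using fin by (auto simp: Z_def)
    have etD: "\<eta> * D / 2 \<ge> t"
    proof -
      have "2 * real t / \<eta> \<le> D" using D D0 by linarith
      then show ?thesis using assms by (simp add: field_simps)
    qed
    have "(\<eta> * D / 2) * (\<eta> * D / (2 * t)) ^ t \<le> card Z * (\<eta> * D / (2 * t)) ^ t"
      using Z assms Dpos by (intro mult_right_mono) auto
    also have "\<dots> = (\<Sum>x\<in>Z. (\<eta> * D / (2 * t)) ^ t)" by simp
    also have "\<dots> \<le> (\<Sum>x\<in>Z. real (deg E Y x choose t))"
    proof (rule sum_mono)
      fix x assume "x \<in> Z"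
      then have x: "deg E Y x \<ge> \<eta> * D / 2" by (simp add: Z_def)
      then have "t \<le> deg E Y x" using etD by linarith
      then have "(real (deg E Y x) / t) ^ t \<le> real (deg E Y x choose t)" by (rule binomial_ge_n_over_k_pow_k)
      moreover have "(\<eta> * D / (2 * t)) ^ t \<le> (real (deg E Y x) / t) ^ t"
      proof (rule power_mono)
        show "\<eta> * D / (2 * t) \<le> deg E Y x / t" using divide_right_mono[OF x, of "real t"] by simp
      qed (use assms Dpos in simp)
      ultimately show "(\<eta> * D / (2 * t)) ^ t \<le> real (deg E Y x choose t)" by linarith
    qed
    also have "\<dots> = real (\<Sum>x\<in>Z. (deg E Y x choose t))" by simp
    also have "\<dots> \<le> t * card {Q. Q \<subseteq> Y \<and> card Q = t \<and> (\<exists>b\<in>Z. Q \<subseteq> E `` {b})}"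
      using of_nat_mono[OF biclique_free_subset_count[OF E finZ fin(2) assms(2)], where 'a=real]
      by (simp only: of_nat_mult)
    also have "\<dots> \<le> t * card {Q. Q \<subseteq> Y \<and> card Q = t}"
    proof -
      have "card {Q. Q \<subseteq> Y \<and> card Q = t \<and> (\<exists>b\<in>Z. Q \<subseteq> E `` {b})} \<le> card {Q. Q \<subseteq> Y \<and> card Q = t}"
        using fin by (intro card_mono) auto
      then show ?thesis by (simp add: mult_left_mono)
    qed
    also have "\<dots> = t * (card Y choose t)" using fin by (simp add: n_subsets)
    also have "\<dots> \<le> t * D ^ t"
    proof (cases "t \<le> card Y")
      case True
      then have "card Y choose t \<le> card Y ^ t" by (rule binomial_le_pow)
      then have "real (card Y choose t) \<le> real (card Y) ^ t" by (metis of_nat_le_iff of_nat_power)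
      also have "\<dots> \<le> D ^ t" using le by (intro power_mono) auto
      finally show ?thesis by (simp add: mult_left_mono)
    qed (use Dpos in \<open>auto simp: binomial_eq_0\<close>)
    also have "(\<eta> * D / 2) * (\<eta> * D / (2 * t)) ^ t = c * D * D ^ t"
    proof -
      have "(\<eta> * D / (2 * t)) ^ t = (\<eta> / (2 * t)) ^ t * D ^ t" by (simp flip: power_mult_distrib)
      then show ?thesis by (simp add: c_def)
    qed
    finally have "c * D * D ^ t \<le> t * D ^ t" .
    then have "c * D \<le> t" using Dpos by simp
    moreover have "c * D0 \<le> c * D" using D c by (intro mult_left_mono) auto
    moreover have "t < c * D0" using D0(3) c by (simp add: pos_divide_less_eq mult.commute)
    ultimately show False by linarith
  qed
  then show ?thesis using D0(1) by (intro exI[of _ D0]) auto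
qed

lemma card_sym_arcs:
  assumes "finite R" "sym R" "irrefl R"
  shows "card R = 2 * card ((\<lambda>(x,y). {x,y}) ` R)"
proof -
  let ?F = "(\<lambda>(x,y). {x,y}) ` R"
  have "card R = (\<Sum>f\<in>?F. card {e\<in>R. (\<lambda>(x,y). {x,y}) e = f})"
    using sum.image_gen[OF assms(1), of "\<lambda>_. 1::nat" "\<lambda>(x,y). {x,y}"] by simp
  also have "\<dots> = (\<Sum>f\<in>?F. 2)"
  proof (rule sum.cong[OF refl])
    fix f assume "f \<in> ?F"
    then obtain x y where xy: "(x,y) \<in> R" "f = {x,y}" by auto
    then have "{e\<in>R. (\<lambda>(x,y). {x,y}) e = f} = {(x,y),(y,x)}" "x \<noteq> y"
      using assms by (auto simp: doubleton_eq_iff irrefl_def dest: symD)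
    then show "card {e\<in>R. (\<lambda>(x,y). {x,y}) e = f} = 2" by simp
  qed
  finally show ?thesis by simp
qed

section \<open>Topological minors\<close>

text \<open>For \<open>u \<noteq> v\<close> both vertices have to lie in \<open>X\<close>; for
  \<open>u = v\<close> the relation holds even outside \<open>X\<close>.\<close>

definition linked :: "('a \<times> 'a) set \<Rightarrow> 'a set \<Rightarrow> 'a \<Rightarrow> 'a \<Rightarrow> bool" where
  "linked E X u v \<longleftrightarrow> (u, v) \<in> (Restr E X)\<^sup>*"

lemma linked_mono: "linked E X u v \<Longrightarrow> X \<subseteq> Y \<Longrightarrow> linked E Y u v"
  unfolding linked_def by (rule rtrancl_mono[THEN subsetD, rotated]) auto

lemma linked_refl: "linked E X u u"
  by (simp add: linked_def)

lemma linked_trans: "linked E X u v \<Longrightarrow> linked E X v w \<Longrightarrow> linked E X u w"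
  unfolding linked_def by (rule rtrancl_trans)

lemma linked_arc: "(u, v) \<in> E \<Longrightarrow> u \<in> X \<Longrightarrow> v \<in> X \<Longrightarrow> linked E X u v"
  unfolding linked_def by blast

lemma linked_sym: "sym E \<Longrightarrow> linked E X u v \<Longrightarrow> linked E X v u"
  unfolding linked_def by (rule sym_rtrancl[THEN symD]) (auto simp: sym_def)

lemma card_arcs_remove_vertex:
  assumes "finite X" "v \<in> X" "sym E" "irrefl E"
  shows "card (Restr E X) = card (Restr E (X - {v})) + 2 * deg E X v"
proof -
  let ?O = "Pair v ` (E `` {v} \<inter> X)" and ?I = "(\<lambda>u. (u, v)) ` (E `` {v} \<inter> X)"
  let ?R = "Restr E (X - {v})"
  have vv: "(v, v) \<notin> E" using assms(4) by (simp add: irrefl_def)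
  have "Restr E X = ?R \<union> (?O \<union> ?I)" using assms(2,3) by (auto simp: image_iff dest: symD)
  moreover have "?R \<inter> (?O \<union> ?I) = {}" by auto
  moreover have "?O \<inter> ?I = {}" using vv by auto
  ultimately have "card (Restr E X) = card ?R + (card ?O + card ?I)" using assms(1) by (simp add: card_Un_disjoint)
  moreover have "card ?O = deg E X v" "card ?I = deg E X v" by (auto intro!: card_image inj_onI)
  ultimately show ?thesis by simp
qed

text \<open>A topological minor whose paths are known only as connecting sets. \<open>J e\<close>
  may be empty, when the images of the ends are adjacent, and different sets \<open>J e\<close> may
  be adjacent to each other.\<close>

abbreviation topological_embedding where
  "topological_embedding W T E A \<phi> J \<equiv> inj_on \<phi> W \<and> \<phi> ` W \<subseteq> A \<and> (\<forall>e\<in>T. J e \<subseteq> A - \<phi> ` W) \<and>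
      (\<forall>e\<in>T. \<forall>e'\<in>T. e \<noteq> e' \<longrightarrow> J e \<inter> J e' = {}) \<and>
      (\<forall>(x, y)\<in>T. linked E (J (x, y) \<union> {\<phi> x, \<phi> y}) (\<phi> x) (\<phi> y))"

text \<open>
  Mader's argument: contract a maximal connected set \<open>U\<close> that keeps the density. Its neighbourhood is
  then dense, and \<open>U\<close> itself provides one more path between any two vertices of the neighbourhood.
\<close>

lemma topological_minor:
  fixes W :: "'b set" and T :: "('b \<times> 'b) set"
  assumes "finite W" "finite T" "T \<subseteq> W \<times> W"
  shows "\<exists>c::nat. \<forall>(E :: ('a \<times> 'a) set) A. finite A \<longrightarrow> A \<noteq> {} \<longrightarrow> sym E \<longrightarrow> irrefl E \<longrightarrow>
    c * card A \<le> card (Restr E A) \<longrightarrow> (\<exists>\<phi> J. topological_embedding W T E A \<phi> J)" using assms(2,3)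
proof (induction T rule: finite_induct)
  case empty
  show ?case
  \<comment> \<open>Without edges to embed only vertices are needed, and average degree at least
    \<open>card W\<close> forces that many.\<close>
  proof (intro exI[of _ "card W"] allI impI)
    fix E :: "('a \<times> 'a) set" and A
    assume A: "finite A" "A \<noteq> {}" and "card W * card A \<le> card (Restr E A)"
    moreover have "card (Restr E A) \<le> card A * card A"
      using card_mono[of "A \<times> A" "Restr E A"] A by (simp add: card_cartesian_product)
    ultimately have "card W * card A \<le> card A * card A" by linarith
    then have "card W \<le> card A" using A by (simp add: card_gt_0_iff)
    then obtain \<phi> where "\<phi> ` W \<subseteq> A" "inj_on \<phi> W" using card_le_inj[OF assms(1) A(1)] by blast
    then show "\<exists>\<phi> J. topological_embedding W {} E A \<phi> J" by blast
  qed
next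
  case (insert e0 T)
  obtain c' :: nat where c': "\<And>(E :: ('a \<times> 'a) set) A. finite A \<Longrightarrow> A \<noteq> {} \<Longrightarrow> sym E \<Longrightarrow> irrefl E \<Longrightarrow>
    c' * card A \<le> card (Restr E A) \<Longrightarrow> \<exists>\<phi> J. topological_embedding W T E A \<phi> J" using insert.IH insert.prems by auto
  define c where "c = 2 * c' + 2"
  have "\<exists>\<phi> J. topological_embedding W (insert e0 T) E A \<phi> J"
    if A: "finite A" "A \<noteq> {}" and E: "sym E" "irrefl E" and dense: "c * card A \<le> card (Restr E A)"
    for E :: "('a \<times> 'a) set" and A
  proof -
    \<comment> \<open>Minimality of the dense set keeps \<open>N U\<close> nonempty below: otherwise
      \<open>X - U\<close>, if nonempty, would be a smaller dense set.\<close>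
    define DX where "DX = {X. X \<subseteq> A \<and> X \<noteq> {} \<and> c * card X \<le> card (Restr E X)}"
    have "finite DX" "DX \<noteq> {}" using A dense by (auto simp: DX_def)
    then obtain X where "X \<in> DX" and Xmin': "\<forall>Y\<in>DX. Y \<subseteq> X \<longrightarrow> X = Y" using finite_has_minimal[of DX] by blast
    then have X: "X \<subseteq> A" "X \<noteq> {}" "c * card X \<le> card (Restr E X)" by (auto simp: DX_def)
    have Xmin: "card (Restr E Y) < c * card Y" if "Y \<subset> X" "Y \<noteq> {}" for Y
    proof (rule ccontr)
      assume "\<not> ?thesis"
      then have "Y \<in> DX" using that X by (auto simp: DX_def)
      then show False using Xmin' that by blast
    qed
    have finX: "finite X" using X A finite_subset by blast
    define N where "N U = {v\<in>X - U. \<exists>u\<in>U. (u, v) \<in> E}" for U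
    have finN: "finite (N U)" for U using finX by (simp add: N_def)
    \<comment> \<open>The inequality says that contracting \<open>U\<close> to one vertex leaves
      average degree at least \<open>c\<close>; the new vertex has \<open>card (N U)\<close>
      neighbours.\<close>
    define G where "G = {U. U \<subseteq> X \<and> U \<noteq> {} \<and> (\<forall>u\<in>U. \<forall>v\<in>U. linked E U u v) \<and>
      c * (card (X - U) + 1) \<le> card (Restr E (X - U)) + 2 * card (N U)}"
    obtain v where v: "v \<in> X" using X by blast
    have "{v} \<in> G"
    proof -
      have "N {v} = E `` {v} \<inter> X" using E v by (auto simp: N_def irrefl_def)
      moreover have "card (X - {v}) + 1 = card X" using v finX by (metis Suc_eq_plus1 card_Suc_Diff1)
      ultimately have "c * (card (X - {v}) + 1) \<le> card (Restr E (X - {v})) + 2 * card (N {v})"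
        using X(3) card_arcs_remove_vertex[OF finX v E] by (simp only:)
      then show ?thesis using v by (simp only: G_def) (simp add: linked_refl)
    qed
    moreover have "finite G" using finX by (auto simp: G_def)
    ultimately obtain U where "U \<in> G" and Umax: "\<forall>Y\<in>G. U \<subseteq> Y \<longrightarrow> U = Y" using finite_has_maximal[of G] by blast
    then have U: "U \<subseteq> X" "U \<noteq> {}" "\<And>u v. u \<in> U \<Longrightarrow> v \<in> U \<Longrightarrow> linked E U u v"
      "c * (card (X - U) + 1) \<le> card (Restr E (X - U)) + 2 * card (N U)" by (auto simp: G_def)
    have "N U \<noteq> {}"
    proof
      assume N: "N U = {}"
      show False
      proof (cases "X - U = {}")
        case True
        show False using U(4) N unfolding True by (simp add: c_def)
      next
        case False
        then have "card (Restr E (X - U)) < c * card (X - U)" using U by (intro Xmin) auto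
        then show False using U(4) N by simp
      qed
    qed
    \<comment> \<open>Contracting one more edge, from \<open>U\<close> to \<open>w\<close>, loses
      two arcs for that edge and two for every common neighbour, i.e. every neighbour of
      \<open>w\<close> in \<open>N U\<close>. By maximality of \<open>U\<close> the loss exceeds
      \<open>c\<close>; this is the origin of \<open>c = 2 * c' + 2\<close>.\<close>
    have deg: "c' \<le> deg E (N U) w" if w: "w \<in> N U" for w
    proof -
      let ?U = "insert w U"
      have wX: "w \<in> X - U" using w by (simp add: N_def)
      obtain u where u: "u \<in> U" "(u, w) \<in> E" using w by (auto simp: N_def)
      have "?U \<notin> G" using Umax wX by blast
      moreover have "linked E ?U a b" if "a \<in> ?U" "b \<in> ?U" for a b
      proof -
        have wu: "linked E ?U u w" using u by (auto intro: linked_arc)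
        have l: "linked E ?U u a" if "a \<in> ?U" for a using that wu linked_mono[OF U(3)[OF u(1)], of a ?U] by auto
        show ?thesis using linked_trans[OF linked_sym[OF E(1) l[OF that(1)]] l[OF that(2)]] .
      qed
      ultimately have "card (Restr E (X - ?U)) + 2 * card (N ?U) < c * (card (X - ?U) + 1)"
        using U wX by (auto simp: G_def)
      moreover have "X - ?U = X - U - {w}" by auto
      moreover have "card (X - U - {w}) + 1 = card (X - U)"
        using wX finX by (metis Suc_eq_plus1 card_Suc_Diff1 finite_Diff)
      ultimately have 1: "card (Restr E (X - U - {w})) + 2 * card (N ?U) < c * card (X - U)" by (simp only:)
      have 2: "card (Restr E (X - U)) =
          card (Restr E (X - U - {w})) + 2 * deg E (X - U) w" using card_arcs_remove_vertex[OF _ wX E] finX by simp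
      have sub: "N U \<union> (E `` {w} \<inter> (X - U)) \<subseteq> insert w (N ?U)" using E by (auto simp: N_def)
      then have "card (N U \<union> (E `` {w} \<inter> (X - U))) \<le> card (N ?U) + 1"
        using card_mono[OF _ sub] finN by (simp add: card_insert_if split: if_splits)
      moreover have "card (N U \<union> (E `` {w} \<inter> (X - U))) + card (N U \<inter> (E `` {w} \<inter> (X - U)))
          = card (N U) + deg E (X - U) w" using card_Un_Int[OF finN[of U], of "E `` {w} \<inter> (X - U)"] finX by simp
      moreover have "N U \<inter> (E `` {w} \<inter> (X - U)) = E `` {w} \<inter> N U" by (auto simp: N_def)
      ultimately have "card (N U) + deg E (X - U) w \<le> card (N ?U) + 1 + deg E (N U) w" by simp
      then have "c < 2 + 2 * deg E (N U) w" using 1 2 U(4) by simp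
      then show ?thesis by (simp add: c_def)
    qed
    have "c' * card (N U) = (\<Sum>w\<in>N U. c')" by simp
    also have "\<dots> \<le> (\<Sum>w\<in>N U. deg E (N U) w)" by (rule sum_mono) (rule deg)
    also have "\<dots> = card (Restr E (N U))" using card_arcs_sum_deg[OF finN finN] by simp
    finally obtain \<phi> J where P: "topological_embedding W T E (N U) \<phi> J" using c'[OF finN \<open>N U \<noteq> {}\<close> E] by blast
    have NA: "N U \<subseteq> A - U" "U \<subseteq> A" using X U by (auto simp: N_def)
    have disj: "U \<inter> J e = {}" if "e \<in> T" for e using P that NA by blast
    have "topological_embedding W (insert e0 T) E A \<phi> (J(e0 := U))"
    proof (intro conjI)
      show "inj_on \<phi> W" using P by blast
      show "\<phi> ` W \<subseteq> A" using P NA by blast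
      have "U \<subseteq> A - \<phi> ` W" using P NA by blast
      moreover have "J e \<subseteq> A - \<phi> ` W" if "e \<in> T" for e using P NA that by blast
      ultimately show "\<forall>e\<in>insert e0 T. (J(e0 := U)) e \<subseteq> A - \<phi> ` W" by simp
      show "\<forall>e\<in>insert e0 T. \<forall>e'\<in>insert e0 T. e \<noteq> e' \<longrightarrow> (J(e0 := U)) e \<inter> (J(e0 := U)) e' = {}"
      proof (intro ballI impI)
        fix e e' assume e: "e \<in> insert e0 T" "e' \<in> insert e0 T" "e \<noteq> e'"
        have d: "J e \<inter> J e' = {}" if "e \<in> T" "e' \<in> T" using P that e(3) by blast
        show "(J(e0 := U)) e \<inter> (J(e0 := U)) e' = {}"
        proof (cases "e = e0")
          case True
          then show ?thesis using e disj[of e'] by auto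
        next
          case False
          then show ?thesis using e disj[of e] d by (cases "e' = e0") auto
        qed
      qed
      show "\<forall>(x, y)\<in>insert e0 T. linked E ((J(e0 := U)) (x, y) \<union> {\<phi> x, \<phi> y}) (\<phi> x) (\<phi> y)"
      proof (rule ballI)
        fix e assume e: "e \<in> insert e0 T"
        obtain x y where xy: "e = (x, y)" by (cases e)
        let ?L = "\<lambda>V. linked E (V \<union> {\<phi> x, \<phi> y}) (\<phi> x) (\<phi> y)"
        have "?L ((J(e0 := U)) e)"
        proof (cases "e = e0")
          case True
          have "x \<in> W" "y \<in> W" using insert.prems xy True by auto
          then have "\<phi> x \<in> N U" "\<phi> y \<in> N U" using P by blast+
          then obtain a b where ab: "a \<in> U" "(a, \<phi> x) \<in> E" "b \<in> U" "(b, \<phi> y) \<in> E" by (auto simp: N_def)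
          let ?V = "U \<union> {\<phi> x, \<phi> y}"
          have "linked E ?V a (\<phi> x)" "linked E ?V b (\<phi> y)" using ab by (auto intro: linked_arc)
          moreover have "linked E ?V a b" using linked_mono[OF U(3)[OF ab(1,3)]] by blast
          ultimately have "?L U" using linked_trans linked_sym[OF E(1)] by metis
          then show ?thesis using True by simp
        next
          case False
          then have "(x, y) \<in> T" using e xy by simp
          then have "?L (J (x, y))" using P by blast
          then show ?thesis using False xy by simp
        qed
        then show "case e of (x, y) \<Rightarrow> linked E ((J(e0 := U)) (x, y) \<union> {\<phi> x, \<phi> y}) (\<phi> x) (\<phi> y)" by (simp add: xy)
      qed
    qed
    then show ?thesis by blast
  qed
  then show ?case by (intro exI[of _ c]) simp
qed

section \<open>Induced subdivisions in graphs without complete bipartite subgraphs\<close>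

text \<open>
  \<open>induced_sub E A F I\<close>: the sets \<open>I f\<close> are the interiors of an induced subdivision, every edge subdivided, of
  the graph with vertex set \<open>A\<close> and edge set \<open>F\<close>. Interiors are kept as mere connecting sets; they can be
  thinned out to paths at any time.
\<close>

definition induced_sub :: "('a \<times> 'a) set \<Rightarrow> 'a set \<Rightarrow> 'a set set \<Rightarrow> ('a set \<Rightarrow> 'a set) \<Rightarrow> bool" where
  "induced_sub E A F I \<longleftrightarrow> finite A \<and> Restr E A = {} \<and>
    (\<forall>f\<in>F. f \<subseteq> A \<and> card f = 2 \<and> finite (I f) \<and> I f \<inter> A = {}) \<and>
    (\<forall>f\<in>F. \<forall>u\<in>f. \<forall>v\<in>f. linked E (I f \<union> f) u v) \<and>
    (\<forall>f\<in>F. \<forall>g\<in>F. f \<noteq> g \<longrightarrow> I f \<inter> I g = {} \<and> E \<inter> I f \<times> I g = {}) \<and>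
    (\<forall>f\<in>F. \<forall>a\<in>A - f. E \<inter> {a} \<times> I f = {})"

text \<open>The dense case produces only subdivisions with one new vertex per edge. For them linking
  and non-adjacency come down to the neighbourhoods of the vertices \<open>w f\<close>, and
  \<open>w\<close> is injective because \<open>w f\<close> sees exactly \<open>f\<close> in
  \<open>A\<close>.\<close>

lemma induced_sub_singletons:
  assumes E: "sym E" "irrefl E" and A: "finite A" "Restr E A = {}"
    and F: "\<And>f. f \<in> F \<Longrightarrow> card f = 2 \<and> w f \<notin> A \<and> E `` {w f} \<inter> A = f"
    and w: "\<And>f g. f \<in> F \<Longrightarrow> g \<in> F \<Longrightarrow> f \<noteq> g \<Longrightarrow> (w f, w g) \<notin> E"
  shows "induced_sub E A F (\<lambda>f. {w f})"
  unfolding induced_sub_def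
proof (intro conjI ballI impI A)
  fix f assume f: "f \<in> F"
  show "f \<subseteq> A" "card f = 2" "{w f} \<inter> A = {}" using F[OF f] by auto
  show "linked E ({w f} \<union> f) u v" if "u \<in> f" "v \<in> f" for u v
  proof -
    have "(w f, u) \<in> E" "(w f, v) \<in> E" using F[OF f] that by blast+
    then have "linked E ({w f} \<union> f) u (w f)" "linked E ({w f} \<union> f) (w f) v"
      using that symD[OF E(1)] by (auto intro!: linked_arc)
    then show ?thesis by (rule linked_trans)
  qed
  show "E \<inter> {a} \<times> {w f} = {}" if "a \<in> A - f" for a using F[OF f] that symD[OF E(1), of a "w f"] by blast
next
  fix f g assume fg: "f \<in> F" "g \<in> F" "f \<noteq> g"
  show "{w f} \<inter> {w g} = {}" using F[OF fg(1)] F[OF fg(2)] fg(3) by auto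
  show "E \<inter> {w f} \<times> {w g} = {}" using w[OF fg] by blast
qed simp

abbreviation has_induced_sub :: "real \<Rightarrow> ('a \<times> 'a) set \<Rightarrow> 'a set \<Rightarrow> bool" where
  "has_induced_sub c E V \<equiv> \<exists>A F I. induced_sub E A F I \<and> A \<subseteq> V \<and> c * card A < card F"

text \<open>
  Let \<open>P\<close> be the graph of pairs with a common neighbour in \<open>B\<close>. All \<open>t\<close>-subsets of a neighbourhood are cliques of \<open>P\<close>,
  and each of them occurs in fewer than \<open>t\<close> neighbourhoods. So \<open>P\<close> has too many \<open>t\<close>-cliques to be \<open>M d\<close>-degenerate.
\<close>

lemma unbalanced_induced_sub:
  fixes d M c :: real and E :: "('a \<times> 'a) set"
  assumes fin: "finite L" "finite B" and E: "sym E" "irrefl E" and LB: "L \<inter> B = {}"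
    and sparse: "\<And>X. X \<subseteq> L \<Longrightarrow> card (Restr E X) \<le> d * card X"
    and ind: "Restr E B = {}" and t: "t \<ge> 1" "biclique_free t E"
    and deg: "\<And>b. b \<in> B \<Longrightarrow> d / 8 \<le> deg E L b" "\<And>b. b \<in> B \<Longrightarrow> deg E L b \<le> 8 * d"
    and d: "d \<ge> 8 * real t" and M: "M > 80 * c + 1" "c \<ge> 0"
    and big: "real t * card L * (M * d) ^ (t - 1) < card B * (d / (8 * real t)) ^ t"
  shows "has_induced_sub c E L"
proof -
  define N where "N b = E `` {b} \<inter> L" for b
  have finN: "finite (N b)" for b using fin by (simp add: N_def)
  have dpos: "d > 0" "d \<ge> 1" using d t by auto
  define P where "P = {(x, y). x \<noteq> y \<and> (\<exists>b\<in>B. x \<in> N b \<and> y \<in> N b)}"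
  have "\<not> degenerate P (M * d) L"
  proof
    assume deg': "degenerate P (M * d) L"
    let ?Q = "{Q. Q \<subseteq> L \<and> card Q = t \<and> (\<exists>b\<in>B. Q \<subseteq> E `` {b})}"
    let ?C = "{Q. Q \<subseteq> L \<and> card Q = t \<and> (\<forall>x\<in>Q. \<forall>y\<in>Q. x \<noteq> y \<longrightarrow> (x,y) \<in> P)}"
    have "?Q \<subseteq> ?C" unfolding P_def N_def by blast
    then have "card ?Q \<le> card ?C" using fin by (intro card_mono) auto
    then have "real (card ?Q) \<le> card ?C" by simp
    also have "\<dots> \<le> card L * (M * d) ^ (t - 1)"
      by (rule card_cliques_degenerate[OF fin(1) deg' t(1)]) (use M dpos in auto)
    finally have Q: "real (card ?Q) \<le> card L * (M * d) ^ (t - 1)" .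
    have "card B * (d / (8 * t)) ^ t = (\<Sum>b\<in>B. (d / (8 * t)) ^ t)" by simp
    also have "\<dots> \<le> (\<Sum>b\<in>B. real (deg E L b choose t))"
    proof (rule sum_mono)
      fix b assume b: "b \<in> B"
      have "t \<le> deg E L b" using deg(1)[OF b] d by linarith
      then have "(real (deg E L b) / t) ^ t \<le> real (deg E L b choose t)" by (rule binomial_ge_n_over_k_pow_k)
      moreover have "(d / (8 * t)) ^ t \<le> (real (deg E L b) / t) ^ t"
      proof (rule power_mono)
        show "d / (8 * t) \<le> deg E L b / t" using divide_right_mono[OF deg(1)[OF b], of "real t"] by simp
      qed (use dpos in simp)
      ultimately show "(d / (8 * t)) ^ t \<le> real (deg E L b choose t)" by linarith
    qed
    also have "\<dots> = real (\<Sum>b\<in>B. (deg E L b choose t))" by simp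
    also have "\<dots> \<le> t * card ?Q"
      using of_nat_mono[OF biclique_free_subset_count[OF t(2) fin(2) fin(1) t(1)], where 'a=real]
      by (simp only: of_nat_mult)
    also have "\<dots> \<le> t * (card L * (M * d) ^ (t - 1))"
      unfolding of_nat_mult using Q by (intro mult_left_mono) auto
    finally show False using big by simp
  qed
  then obtain X where X: "X \<subseteq> L" "X \<noteq> {}" and Xdeg: "\<And>v. v \<in> X \<Longrightarrow> M * d < deg P X v"
    unfolding degenerate_def by (auto simp: not_le)
  have finX: "finite X" using X fin finite_subset by blast
  \<comment> \<open>Adjacent pairs are given up, as branch vertices have to be independent;
    \<open>sparse\<close> bounds how many there are.\<close>
  define R where "R = Restr P X - E"
  have finR: "finite R" using finX by (simp add: R_def)
  have symR: "sym R" unfolding R_def P_def using E(1) by (auto simp: sym_def)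
  have irrR: "irrefl R" unfolding R_def P_def by (auto simp: irrefl_def)
  define F0 where "F0 = (\<lambda>(x,y). {x,y}) ` R"
  have finF0: "finite F0" using finR by (simp add: F0_def)
  have "(M * d) * card X \<le> (\<Sum>v\<in>X. real (deg P X v))"
    using sum_mono[of X "\<lambda>_. M * d" "\<lambda>v. real (deg P X v)"] Xdeg by (simp add: less_imp_le mult.commute)
  also have "\<dots> = card (Restr P X)" using card_arcs_sum_deg[OF finX finX, of P] by simp
  also have "\<dots> \<le> card R + card (Restr E X)"
  proof -
    have "card (Restr P X) \<le> card (R \<union> (Restr E X))" using finX finR by (intro card_mono) (auto simp: R_def)
    also have "\<dots> \<le> card R + card (Restr E X)" by (rule card_Un_le)
    finally show ?thesis by simp
  qed
  also have "\<dots> \<le> card R + d * card X" using sparse[OF X(1)] by simp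
  also have "real (card R) = 2 * card F0" using card_sym_arcs[OF finR symR irrR] by (simp add: F0_def)
  finally have F0: "(M - 1) * d * card X \<le> 2 * card F0" by (simp add: algebra_simps)
  have "\<forall>f\<in>F0. \<exists>b\<in>B. f \<subseteq> N b" by (auto simp: F0_def R_def P_def)
  then obtain w where w: "\<And>f. f \<in> F0 \<Longrightarrow> w f \<in> B \<and> f \<subseteq> N (w f)" by metis
  have f2: "card f = 2 \<and> f \<subseteq> X \<and> Restr E f = {}" if "f \<in> F0" for f
  proof -
    obtain x y where "(x,y) \<in> R" "f = {x,y}" using \<open>f \<in> F0\<close> by (auto simp: F0_def)
    moreover have "(x,y) \<notin> E" "x \<noteq> y" "x \<in> X" "y \<in> X" using \<open>(x,y) \<in> R\<close> by (auto simp: R_def P_def)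
    moreover have "(y,x) \<notin> E" using symD[OF E(1), of y x] \<open>(x,y) \<notin> E\<close> by blast
    moreover have "(x,x) \<notin> E" "(y,y) \<notin> E" using E(2) by (simp_all add: irrefl_def)
    ultimately show ?thesis by auto
  qed
  have degX: "degenerate E d X" by (rule sparse_imp_degenerate[OF finX]) (use sparse X in blast)
  obtain out where out0: "\<forall>v\<in>X. out v \<subseteq> E `` {v} \<inter> X \<and> card (out v) \<le> d"
    "\<forall>u\<in>X. \<forall>v\<in>X. (u,v) \<in> E \<longrightarrow> v \<in> out u \<or> u \<in> out v" using degenerate_orientation[OF finX degX E] by (elim exE conjE)
  have out: "\<And>v. v \<in> X \<Longrightarrow> out v \<subseteq> E `` {v} \<inter> X" "\<And>v. v \<in> X \<Longrightarrow> card (out v) \<le> d"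
    "\<And>u v. u \<in> X \<Longrightarrow> v \<in> X \<Longrightarrow> (u,v) \<in> E \<Longrightarrow> v \<in> out u \<or> u \<in> out v" using out0 by simp_all
  \<comment> \<open>The conflicts of \<open>f\<close>: a third branch vertex next to
    \<open>w f\<close>, or an out-neighbour of an end of \<open>f\<close>. If \<open>f\<close>
    survives, \<open>w f\<close> has no sampled neighbour outside \<open>f\<close>, so distinct
    surviving pairs get distinct vertices. Charging only out-neighbours keeps the count at
    \<open>8 * d + 2 * d\<close>.\<close>
  define Bad where "Bad f = ((N (w f) \<inter> X) \<union> (\<Union>u\<in>f. out u)) - f" for f
  have Bad: "Bad f \<subseteq> X" "finite (Bad f)" "card (Bad f) \<le> 10 * d" if f: "f \<in> F0" for f
  proof -
    obtain x y where xy: "f = {x,y}" "x \<in> X" "y \<in> X" using f2[OF f] by (auto simp: card_2_iff)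
    show "Bad f \<subseteq> X" using out(1) xy unfolding Bad_def by blast
    then show "finite (Bad f)" using finX finite_subset by blast
    have fo: "finite (out x)" "finite (out y)" using out(1) xy finX finite_subset by blast+
    have "card (Bad f) \<le> card (N (w f) \<union> (out x \<union> out y))" using xy fo finN by (intro card_mono) (auto simp: Bad_def)
    also have "\<dots> \<le> card (N (w f)) + (card (out x) + card (out y))"
      by (intro order.trans[OF card_Un_le] add_mono card_Un_le) simp
    finally have "real (card (Bad f)) \<le> real (card (N (w f))) + (real (card (out x)) + real (card (out y)))" by linarith
    also have "\<dots> \<le> 8 * d + (d + d)" using deg(2)[of "w f"] w[OF f] out(2) xy by (intro add_mono) (auto simp: N_def)
    finally show "card (Bad f) \<le> 10 * d" by simp
  qed
  let ?C = "\<lambda>f. (\<lambda>a. {a}) ` Bad f"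
  \<comment> \<open>At most \<open>10 * d\<close> conflicts of probability \<open>p\<close> add up
    to 1/2, so a pair survives with at least half of its sampling probability.\<close>
  define p where "p = 1 / (20 * d)"
  have p: "0 < p" "p \<le> 1" "10 * d * p = 1 / 2" "d * p = 1 / 20" using dpos by (auto simp: p_def)
  have "\<exists>S\<subseteq>X. c * card (S \<inter> X) < card {f\<in>F0. f \<subseteq> S \<and> (\<forall>Z\<in>?C f. \<not> Z \<subseteq> S)}"
  proof (rule deletion_method[where p = "\<lambda>_. p"])
    fix f assume f: "f \<in> F0"
    show "f \<subseteq> X" using f2[OF f] by blast
    show "finite (?C f)" using Bad[OF f] by simp
    show "Z \<subseteq> X \<and> Z \<inter> f = {}" if "Z \<in> ?C f" for Z using that Bad[OF f] by (auto simp: Bad_def)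
  next
    have "(\<Sum>f\<in>F0. (\<Prod>u\<in>f. p) * (\<Sum>Z\<in>?C f. \<Prod>u\<in>Z. p)) \<le> (\<Sum>f\<in>F0. p\<^sup>2 * (1 / 2))"
    proof (rule sum_mono)
      fix f assume f: "f \<in> F0"
      have "(\<Sum>Z\<in>?C f. \<Prod>u\<in>Z. p) = card (Bad f) * p" by (subst sum.reindex) (auto simp: inj_on_def)
      also have "\<dots> \<le> 10 * d * p" using Bad[OF f] p by (intro mult_right_mono) auto
      finally have "(\<Sum>Z\<in>?C f. \<Prod>u\<in>Z. p) \<le> 1 / 2" using p by simp
      then have "p\<^sup>2 * (\<Sum>Z\<in>?C f. \<Prod>u\<in>Z. p) \<le> p\<^sup>2 * (1 / 2)" by (rule mult_left_mono) simp
      then show "(\<Prod>u\<in>f. p) * (\<Sum>Z\<in>?C f. \<Prod>u\<in>Z. p) \<le> p\<^sup>2 * (1 / 2)" using f2[OF f] by simp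
    qed
    also have "\<dots> = card F0 * p\<^sup>2 / 2" by simp
    finally have 1: "(\<Sum>f\<in>F0. (\<Prod>u\<in>f. p) * (\<Sum>Z\<in>?C f. \<Prod>u\<in>Z. p)) \<le> card F0 * p\<^sup>2 / 2" .
    have 2: "(\<Sum>f\<in>F0. \<Prod>u\<in>f. p) = card F0 * p\<^sup>2" using f2 by simp
    \<comment> \<open>The expected number of surviving pairs, at least
      \<open>card F0 * p\<^sup>2 / 2\<close>, is compared with \<open>card X * p\<close> expected
      branch vertices; the ratio \<open>(M - 1) / 80\<close> explains the hypothesis on
      \<open>M\<close>.\<close>
    have "(M - 1) * d * card X * (p\<^sup>2 / 4) \<le> 2 * card F0 * (p\<^sup>2 / 4)" using F0 by (intro mult_right_mono) auto
    moreover have "(M - 1) * d * card X * (p\<^sup>2 / 4) = (M - 1) / 80 * (card X * p)"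
    proof -
      have "(M - 1) * d * card X * (p\<^sup>2 / 4) = (M - 1) * (d * p) * (card X * p) / 4" by (simp add: power2_eq_square)
      then show ?thesis by (simp add: p)
    qed
    moreover have "c * (card X * p) < (M - 1) / 80 * (card X * p)"
      using M X finX p by (intro mult_strict_right_mono) (auto simp: card_gt_0_iff)
    moreover have "2 * card F0 * (p\<^sup>2 / 4) = card F0 * p\<^sup>2 / 2" by simp
    ultimately have "c * (card X * p) < card F0 * p\<^sup>2 / 2" by linarith
    then show "(\<Sum>f\<in>F0. (\<Prod>u\<in>f. p) * (\<Sum>Z\<in>?C f. \<Prod>u\<in>Z. p)) + c * (\<Sum>u\<in>X. p) < (\<Sum>f\<in>F0. \<Prod>u\<in>f. p)" using 1 2 by simp
  qed (use finX finF0 p in auto)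
  then obtain S where S: "S \<subseteq> X" "c * card (S \<inter> X) < card {f\<in>F0. f \<subseteq> S \<and> (\<forall>Z\<in>?C f. \<not> Z \<subseteq> S)}" by blast
  define F where "F = {f\<in>F0. f \<subseteq> S \<and> Bad f \<inter> S = {}}"
  have "{f\<in>F0. f \<subseteq> S \<and> (\<forall>Z\<in>?C f. \<not> Z \<subseteq> S)} = F" by (auto simp: F_def)
  moreover have "S \<inter> X = S" using S by blast
  ultimately have cF: "c * card S < card F" using S by simp
  \<comment> \<open>Vertices of \<open>S\<close> in no surviving pair may have neighbours in
    \<open>S\<close>, so they are discarded.\<close>
  define A where "A = \<Union>F"
  have AS: "A \<subseteq> S" by (auto simp: A_def F_def)
  have finS: "finite S" using S finX finite_subset by blast
  have "real (card A) \<le> card S" using AS finS card_mono by simp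
  then have "c * card A \<le> c * card S" using M by (intro mult_left_mono) auto
  then have cA: "c * card A < card F" using cF by linarith
  have AL: "A \<subseteq> X" using AS S by blast
  have indA: "Restr E A = {}"
  proof (rule ccontr)
    assume "\<not> ?thesis"
    then obtain a a' where a: "a \<in> A" "a' \<in> A" "(a, a') \<in> E" by blast
    have *: False if "a \<in> A" "a' \<in> A" "(a, a') \<in> E" "a' \<in> out a" for a a'
    proof -
      obtain f where f: "f \<in> F" "a \<in> f" using \<open>a \<in> A\<close> by (auto simp: A_def)
      have "a' \<notin> f" using f2[of f] f that by (auto simp: F_def)
      then have "a' \<in> Bad f" using f that by (auto simp: Bad_def)
      then show False using f \<open>a' \<in> A\<close> AS by (auto simp: F_def)
    qed
    show False using out(3)[of a a'] a AL *[of a a'] *[of a' a] symD[OF E(1) a(3)] by blast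
  qed
  have "induced_sub E A F (\<lambda>f. {w f})"
  proof (rule induced_sub_singletons[OF E _ indA])
    show "finite A" using AS finS finite_subset by blast
    show "card f = 2 \<and> w f \<notin> A \<and> E `` {w f} \<inter> A = f" if f: "f \<in> F" for f
    proof -
      have f0: "f \<in> F0" "f \<subseteq> A" using f by (auto simp: F_def A_def)
      have "E `` {w f} \<inter> S \<subseteq> f" using f S X by (auto simp: F_def Bad_def N_def)
      then have "E `` {w f} \<inter> A = f" using w[OF f0(1)] f0(2) AS by (auto simp: N_def)
      moreover have "w f \<notin> A" using w[OF f0(1)] AL X LB by blast
      ultimately show ?thesis using f2[OF f0(1)] by blast
    qed
    show "(w f, w g) \<notin> E" if "f \<in> F" "g \<in> F" "f \<noteq> g" for f g
    proof -
      have "w f \<in> B" "w g \<in> B" using that w by (auto simp: F_def)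
      then show ?thesis using ind by blast
    qed
  qed
  then show ?thesis using cA AL X by blast
qed

section \<open>Induced subdivisions in almost regular graphs\<close>

lemma sum_Un_le:
  fixes g :: "'a \<Rightarrow> real"
  assumes "finite A" "finite B" "\<And>x. 0 \<le> g x"
  shows "sum g (A \<union> B) \<le> sum g A + sum g B"
  using sum.union_inter[OF assms(1,2), of g] sum_nonneg[of "A \<inter> B" g] assms(3) by simp

lemma sum_image_le_nonneg:
  fixes g :: "'b \<Rightarrow> real"
  assumes "finite K" "\<And>x. 0 \<le> g x"
  shows "sum g (f ` K) \<le> (\<Sum>k\<in>K. g (f k))" using sum_image_le[OF assms(1), of g f] assms(2) by (simp add: o_def)

text \<open>
  Branch vertices are sampled with probability \<open>P = \<beta> / D\<close> and subdivision vertices with probability \<open>Q = \<alpha> / D\<close>. Each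
  sampled path \<open>x - b - y\<close> is an edge of the subdivided graph unless it is spoilt by another sampled branch vertex
  next to it (\<open>C1\<close>), by a second subdivision vertex for the same pair (\<open>C2\<close>), or by a sampled neighbour of \<open>b\<close> that has two
  sampled neighbours of its own, one of them among \<open>x\<close> and \<open>y\<close> (\<open>C3\<close>) or none (\<open>C5\<close>). The sets \<open>C2\<close> and \<open>C3\<close> are
  controlled by the numbers of 4-cycles and triangles.
\<close>

lemma almost_regular_induced_sub:
  fixes C c :: real
  assumes C: "C \<ge> 1" and c: "c \<ge> 0" and t: "t \<ge> 1"
  shows "\<exists>D0. \<forall>(D::real) (E :: ('a \<times> 'a) set) V. D0 \<le> D \<longrightarrow> finite V \<longrightarrow> V \<noteq> {} \<longrightarrow> sym E \<longrightarrow> irrefl E \<longrightarrow>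
    biclique_free t E \<longrightarrow> (\<forall>v\<in>V. deg E V v \<le> D) \<longrightarrow> D / C * card V \<le> card (Restr E V) \<longrightarrow>
    has_induced_sub c E V"
proof -
  \<comment> \<open>The order of choice matters. \<open>g = \<alpha> * \<beta>\<close>, up to a
    factor \<open>C\<^sup>2\<close> the number of sampled paths per sampled branch vertex, is
    dictated by \<open>c\<close>. Then \<open>\<beta>\<close> is small enough for \<open>C1\<close>
    and \<open>C5\<close>, which forces a possibly large \<open>\<alpha>\<close>. Last comes
    \<open>\<eta>\<close>, paying for \<open>C2\<close>, \<open>C3\<close> and the triangles, since
    making it small only costs a larger \<open>D0\<close>.\<close>
  define g where "g = 4 * C\<^sup>2 * (2 * c + 1)"
  define \<beta> where "\<beta> = 1 / (8 * C\<^sup>2 * (3 + g))"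
  define \<alpha> where "\<alpha> = g / \<beta>"
  define \<eta> where "\<eta> = 1 / (8 * C\<^sup>2 * (\<alpha> + 2 * g + 1))"
  have C2: "C\<^sup>2 > 0" using C by simp
  have g: "g > 0" using C2 c by (simp add: g_def)
  have \<beta>: "\<beta> > 0" using C2 g by (simp add: \<beta>_def)
  have \<alpha>: "\<alpha> > 0" "\<alpha> * \<beta> = g" using g \<beta> by (simp_all add: \<alpha>_def)
  have \<eta>: "\<eta> > 0" using C2 g \<alpha> by (simp add: \<eta>_def)
  have \<beta>g: "(3 + g) * \<beta> = 1 / (8 * C\<^sup>2)" using g by (simp add: \<beta>_def)
  have \<eta>g: "(\<alpha> + 2 * g + 1) * \<eta> = 1 / (8 * C\<^sup>2)" using g \<alpha> by (simp add: \<eta>_def)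
  have \<eta>1: "\<eta> \<le> 1 / (8 * C\<^sup>2)" "\<eta> * (\<alpha> + 2 * g) \<le> 1 / (8 * C\<^sup>2)"
  proof -
    have "0 \<le> (\<alpha> + 2 * g) * \<eta>" using \<alpha> g \<eta> by simp
    then show "\<eta> \<le> 1 / (8 * C\<^sup>2)" "\<eta> * (\<alpha> + 2 * g) \<le> 1 / (8 * C\<^sup>2)" using \<eta>g \<eta> by (simp_all add: algebra_simps)
  qed
  \<comment> \<open>Conflicts per walk, relative to n D^2 walks; up to grouping, the summands belong
    to \<open>C1\<close>, \<open>C2\<close>, the two sets \<open>C3\<close>, and
    \<open>C5\<close>.\<close>
  define \<kappa> where "\<kappa> = 3 * \<beta> + \<eta> * \<alpha> + 2 * \<eta> * g + g * \<beta>"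
  have \<kappa>: "\<kappa> \<le> 1 / (4 * C\<^sup>2)"
  proof -
    have "\<kappa> = (3 + g) * \<beta> + \<eta> * (\<alpha> + 2 * g)" by (simp add: \<kappa>_def algebra_simps)
    also have "\<dots> \<le> 1 / (8 * C\<^sup>2) + 1 / (8 * C\<^sup>2)" using \<beta>g \<eta>1 by simp
    finally show ?thesis by simp
  qed
  obtain D1 where D1: "D1 \<ge> 1" "\<And>(D::real) (E::('a\<times>'a) set) X Y. D \<ge> D1 \<Longrightarrow> biclique_free t E \<Longrightarrow> finite X \<Longrightarrow> finite Y \<Longrightarrow>
    real (card X) \<le> D \<Longrightarrow> real (card Y) \<le> D \<Longrightarrow> card (E \<inter> X \<times> Y) \<le> \<eta> * D\<^sup>2"
    using biclique_free_sparse[OF \<eta> t, where 'a='a] by blast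
  \<comment> \<open>\<open>8 * C\<^sup>2\<close> makes the walks with \<open>x = y\<close> few, and
    \<open>\<alpha>\<close> and \<open>\<beta>\<close> keep the sampling probabilities at most
    1.\<close>
  define D0 where "D0 = Max {D1, 8 * C\<^sup>2, \<alpha>, \<beta>}"
  have D0: "D0 \<ge> D1" "D0 \<ge> 8 * C\<^sup>2" "D0 \<ge> \<alpha>" "D0 \<ge> \<beta>" by (auto simp: D0_def)
  have "has_induced_sub c E V"
    if D: "D \<ge> D0" and V: "finite V" "V \<noteq> {}" and E: "sym E" "irrefl E" "biclique_free t E"
      and maxdeg: "\<And>v. v \<in> V \<Longrightarrow> deg E V v \<le> D" and dense: "D / C * card V \<le> card (Restr E V)"
    for D :: real and E :: "('a \<times> 'a) set" and V
  proof -
    define n where "n = real (card V)"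
    have n: "n > 0" using V by (simp add: n_def card_gt_0_iff)
    have Dpos: "D \<ge> 1" "D > 0" using D D0 D1 by auto
    define N where "N v = E `` {v} \<inter> V" for v
    have finN: "finite (N v)" for v using V by (simp add: N_def)
    have cN: "real (card (N v)) \<le> D" if "v \<in> V" for v using maxdeg[OF that] by (simp add: N_def)
    have NV: "N v \<subseteq> V" for v by (simp add: N_def)
    have Nsym: "x \<in> N y \<Longrightarrow> y \<in> V \<Longrightarrow> y \<in> N x" for x y using symD[OF E(1), of y x] by (simp add: N_def)
    have Nirr: "x \<notin> N x" for x using E(2) by (simp add: N_def irrefl_def)
    have sp: "card (E \<inter> N a \<times> N b) \<le> \<eta> * D\<^sup>2" if "a \<in> V" "b \<in> V" for a b using D D0 that by (intro D1(2) E finN cN) auto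
    define P where "P = \<beta> / D"
    define Q where "Q = \<alpha> / D"
    have PQ: "P > 0" "P \<le> 1" "Q > 0" "Q \<le> 1" using \<beta> \<alpha> D D0 Dpos by (auto simp: P_def Q_def field_simps)
    have PQD: "P * D = \<beta>" "Q * D = \<alpha>" using Dpos by (auto simp: P_def Q_def)
    \<comment> \<open>Two independent samples of \<open>V\<close>: \<open>Inl\<close> for branch
      vertices, \<open>Inr\<close> for subdivision vertices. A vertex may be in both, but as
      \<open>b\<close> lies in \<open>N x\<close>, the set \<open>C1 b x y\<close> forbids
      \<open>Inl b\<close> whenever \<open>b\<close> is used for a path.\<close>
    define U where "U = Inl ` V \<union> Inr ` V"
    define pr :: "'a + 'a \<Rightarrow> real" where "pr = case_sum (\<lambda>_. P) (\<lambda>_. Q)"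
    have [simp]: "pr (Inl v) = P" "pr (Inr v) = Q" for v by (auto simp: pr_def)
    have pr: "0 \<le> pr u" for u using PQ by (cases u) (auto simp: less_imp_le)
    \<comment> \<open>Ordered walks \<open>x - b - y\<close>: every path occurs twice, whence the
      factor 2 in \<open>2 * c\<close> below.\<close>
    define T where "T = (SIGMA b:V. N b \<times> N b)"
    define Ob where "Ob = {(b, x, y) \<in> T. x \<noteq> y \<and> (x, y) \<notin> E}"
    have finT: "finite T" using V finN by (auto simp: T_def)
    have ObT: "Ob \<subseteq> T" by (auto simp: Ob_def)
    have finOb: "finite Ob" using ObT finT finite_subset by blast
    define R :: "'a \<times> 'a \<times> 'a \<Rightarrow> ('a + 'a) set" where "R = (\<lambda>(b, x, y). {Inr b, Inl x, Inl y})"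
    define C1 where "C1 b x y = (\<lambda>a. {Inl a :: 'a + 'a}) ` (N b \<union> (N x \<union> N y) - {x, y})" for b x y
    define C2 where "C2 b x y = (\<lambda>b'. {Inr b' :: 'a + 'a}) ` (N x \<inter> N y - {b})" for b x y
    \<comment> \<open>A sampled neighbour \<open>b'\<close> of \<open>b\<close> cannot be forbidden
      outright, because \<open>Q * D = \<alpha>\<close> is large. It does harm only if it serves
      another pair, so two of its neighbours are sampled branch vertices: \<open>C3\<close> treats
      the case that exactly one of them is in \<open>{x, y}\<close>, paid for by the rarity of
      triangles, and \<open>C5\<close> the case of none, paid for by an extra factor
      \<open>P\<close>.\<close>
    define C3 where "C3 b x y z = (\<lambda>(b', a). {Inr b', Inl a :: 'a + 'a}) ` (SIGMA b':N b \<inter> N z. N b' - {x, y})" for b x y z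
    define K5 where "K5 b x y = {(b', a, a') \<in> (SIGMA b':N b. N b' \<times> N b'). a \<notin> {x, y} \<and> a' \<notin> {x, y} \<and> a \<noteq> a'}" for b x y
    define C5 where "C5 b x y = (\<lambda>(b', a, a'). {Inr b', Inl a, Inl a' :: 'a + 'a}) ` K5 b x y" for b x y
    define Cf where "Cf = (\<lambda>(b, x, y). C1 b x y \<union> (C2 b x y \<union> (C3 b x y x \<union> (C3 b x y y \<union> C5 b x y))))"
    define pp where "pp Z = (\<Prod>u\<in>Z. pr u)" for Z
    have pp: "0 \<le> pp Z" for Z unfolding pp_def by (intro prod_nonneg pr)
    have finT3: "finite (SIGMA b':N b. N b' \<times> N b')" for b using finN by auto
    have K5T: "K5 b x y \<subseteq> (SIGMA b':N b. N b' \<times> N b')" for b x y by (auto simp: K5_def)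
    have finK: "finite (K5 b x y)" for b x y by (rule finite_subset[OF K5T finT3])
    have fin1: "finite (C1 b x y)" "finite (C2 b x y)" "finite (C3 b x y z)" "finite (C5 b x y)" for b x y z
      using finN finK by (simp_all add: C1_def C2_def C3_def C5_def)
    define cst where "cst = (\<lambda>(b, x, y). 3 * D * P + card (N x \<inter> N y) * Q +
      (card (N b \<inter> N x) * D * (Q * P) + (card (N b \<inter> N y) * D * (Q * P) + D ^ 3 * (Q * P\<^sup>2))))"
    have cost: "(\<Sum>Z\<in>Cf (b, x, y). pp Z) \<le> cst (b, x, y)"
      if b: "b \<in> V" "x \<in> V" "y \<in> V" for b x y
    proof -
      have 1: "sum pp (C1 b x y) \<le> 3 * D * P"
      proof -
        have "sum pp (C1 b x y) \<le> (\<Sum>a\<in>N b \<union> (N x \<union> N y) - {x, y}. pp {Inl a})"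
          unfolding C1_def by (rule sum_image_le_nonneg) (use finN pp in auto)
        also have "\<dots> = card (N b \<union> (N x \<union> N y) - {x, y}) * P" by (simp add: pp_def)
        also have "\<dots> \<le> 3 * D * P"
        proof (rule mult_right_mono)
          have "card (N b \<union> (N x \<union> N y) - {x, y}) \<le> card (N b \<union> (N x \<union> N y))" using finN by (intro card_mono) auto
          also have "\<dots> \<le> card (N b) + (card (N x) + card (N y))"
            by (intro order.trans[OF card_Un_le] add_mono card_Un_le) simp
          finally show "real (card (N b \<union> (N x \<union> N y) - {x, y})) \<le> 3 * D"
            using cN[OF b(1)] cN[OF b(2)] cN[OF b(3)] by linarith
        qed (use PQ in simp)
        finally show ?thesis .
      qed
      have 2: "sum pp (C2 b x y) \<le> card (N x \<inter> N y) * Q"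
      proof -
        have "sum pp (C2 b x y) \<le> (\<Sum>b'\<in>N x \<inter> N y - {b}. pp {Inr b'})"
          unfolding C2_def by (rule sum_image_le_nonneg) (use finN pp in auto)
        also have "\<dots> = card (N x \<inter> N y - {b}) * Q" by (simp add: pp_def)
        also have "\<dots> \<le> card (N x \<inter> N y) * Q" using finN PQ by (intro mult_right_mono of_nat_mono card_mono) auto
        finally show ?thesis .
      qed
      have 3: "sum pp (C3 b x y z) \<le> card (N b \<inter> N z) * D * (Q * P)" for z
      proof -
        have "sum pp (C3 b x y z) \<le> (\<Sum>k\<in>(SIGMA b':N b \<inter> N z. N b' - {x, y}). pp ((\<lambda>(b', a). {Inr b', Inl a}) k))"
          unfolding C3_def by (rule sum_image_le_nonneg) (use finN pp in auto)
        also have "\<dots> = (\<Sum>k\<in>(SIGMA b':N b \<inter> N z. N b' - {x, y}). Q * P)" by (rule sum.cong) (auto simp: pp_def)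
        also have "\<dots> = real (\<Sum>b'\<in>N b \<inter> N z. card (N b' - {x, y})) * (Q * P)" using finN by (simp add: card_SigmaI)
        also have "\<dots> \<le> (\<Sum>b'\<in>N b \<inter> N z. D) * (Q * P)"
        proof (rule mult_right_mono)
          have "real (card (N b' - {x, y})) \<le> D" if "b' \<in> N b" for b'
            using cN[of b'] NV that card_mono[OF finN[of b'], of "N b' - {x, y}"] by fastforce
          then show "real (\<Sum>b'\<in>N b \<inter> N z. card (N b' - {x, y})) \<le> (\<Sum>b'\<in>N b \<inter> N z. D)"
            unfolding of_nat_sum by (intro sum_mono) auto
        qed (use PQ in simp)
        finally show ?thesis by simp
      qed
      have 5: "sum pp (C5 b x y) \<le> D ^ 3 * (Q * P\<^sup>2)"
      proof -
        let ?K = "K5 b x y"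
        have "sum pp (C5 b x y) \<le> (\<Sum>k\<in>?K. pp ((\<lambda>(b', a, a'). {Inr b', Inl a, Inl a'}) k))"
          unfolding C5_def by (rule sum_image_le_nonneg[OF finK pp])
        also have "\<dots> = (\<Sum>k\<in>?K. Q * P\<^sup>2)" by (rule sum.cong) (auto simp: pp_def power2_eq_square K5_def)
        also have "\<dots> = card ?K * (Q * P\<^sup>2)" by simp
        also have "\<dots> \<le> D ^ 3 * (Q * P\<^sup>2)"
        proof (rule mult_right_mono)
          have "card ?K \<le> card (SIGMA b':N b. N b' \<times> N b')" by (rule card_mono[OF finT3 K5T])
          also have "\<dots> = (\<Sum>b'\<in>N b. card (N b') * card (N b'))" using finN by (simp add: card_cartesian_product)
          finally have "real (card ?K) \<le> (\<Sum>b'\<in>N b. real (card (N b')) * real (card (N b')))"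
            by (metis (mono_tags, lifting) of_nat_le_iff of_nat_mult of_nat_sum sum.cong)
          also have "\<dots> \<le> (\<Sum>b'\<in>N b. D * D)" using cN NV Dpos by (intro sum_mono mult_mono) auto
          also have "\<dots> = card (N b) * (D * D)" by simp
          also have "\<dots> \<le> D * (D * D)" using cN[OF b(1)] Dpos by (intro mult_right_mono) auto
          finally show "real (card ?K) \<le> D ^ 3" by (simp add: power3_eq_cube mult.assoc)
        qed (use PQ in simp)
        finally show ?thesis .
      qed
      have "sum pp (Cf (b, x, y)) \<le> sum pp (C1 b x y) + (sum pp (C2 b x y) +
        (sum pp (C3 b x y x) + (sum pp (C3 b x y y) + sum pp (C5 b x y))))"
        unfolding Cf_def prod.case by (intro order.trans[OF sum_Un_le] add_mono order.refl sum_Un_le pp fin1 finite_UnI)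
      then show ?thesis unfolding cst_def prod.case using 1 2 3[of x] 3[of y] 5 by linarith
    qed
    have sumT: "(\<Sum>(b, x, y)\<in>T. h b x y) = (\<Sum>b\<in>V. \<Sum>x\<in>N b. \<Sum>y\<in>N b. h b x y)" for h :: "'a \<Rightarrow> 'a \<Rightarrow> 'a \<Rightarrow> real"
      unfolding T_def using V finN by (simp add: sum.Sigma sum.cartesian_product case_prod_beta)
    have cardT: "real (card T) \<le> n * D\<^sup>2"
    proof -
      have "real (card T) = (\<Sum>b\<in>V. \<Sum>x\<in>N b. \<Sum>y\<in>N b. 1)" using sumT[of "\<lambda>_ _ _. 1"] by (simp add: case_prod_beta)
      also have "\<dots> \<le> (\<Sum>b\<in>V. D * D)" using cN Dpos by (intro sum_mono) (auto intro!: mult_mono)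
      finally show ?thesis by (simp add: n_def power2_eq_square)
    qed
    have sum2: "(\<Sum>(b, x, y)\<in>T. real (card (N x \<inter> N y))) \<le> n * D * (\<eta> * D\<^sup>2)"
    proof -
      \<comment> \<open>For fixed \<open>b\<close> and \<open>x\<close> the codegrees sum to the
        number of arcs between \<open>N b\<close> and \<open>N x\<close>, where \<open>sp\<close>
        applies.\<close>
      have "(\<Sum>(b, x, y)\<in>T. real (card (N x \<inter> N y))) = (\<Sum>b\<in>V. \<Sum>x\<in>N b. real (card (E \<inter> N b \<times> N x)))"
        unfolding sumT
      proof (intro sum.cong refl)
        fix b x assume "b \<in> V" "x \<in> N b"
        have "N x \<inter> N y = E `` {y} \<inter> N x" for y by (auto simp: N_def)
        then show "(\<Sum>y\<in>N b. real (card (N x \<inter> N y))) = real (card (E \<inter> N b \<times> N x))"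
          using card_arcs_sum_deg[OF finN finN, of E b x] by simp
      qed
      also have "\<dots> \<le> (\<Sum>b\<in>V. \<Sum>x\<in>N b. \<eta> * D\<^sup>2)" using sp NV by (intro sum_mono) auto
      also have "\<dots> \<le> (\<Sum>b\<in>V. D * (\<eta> * D\<^sup>2))" using cN \<eta> by (intro sum_mono) (auto intro!: mult_right_mono)
      finally show ?thesis by (simp add: n_def)
    qed
    have tri: "(\<Sum>x\<in>N b. real (card (N b \<inter> N x))) \<le> \<eta> * D\<^sup>2" if "b \<in> V" for b
    proof -
      have "N b \<inter> N x = E `` {x} \<inter> N b" for x by (auto simp: N_def)
      then have "(\<Sum>x\<in>N b. real (card (N b \<inter> N x))) = real (card (Restr E (N b)))"
        using card_arcs_sum_deg[OF finN finN, of E b b] by simp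
      then show ?thesis using sp[OF that that] by simp
    qed
    have tri_sum: "(\<Sum>b\<in>V. card (N b) * (\<Sum>x\<in>N b. real (card (N b \<inter> N x)))) \<le> n * D * (\<eta> * D\<^sup>2)"
    proof -
      have "(\<Sum>b\<in>V. card (N b) * (\<Sum>x\<in>N b. real (card (N b \<inter> N x)))) \<le> (\<Sum>b\<in>V. D * (\<eta> * D\<^sup>2))"
        using cN tri Dpos by (intro sum_mono mult_mono) (auto intro!: sum_nonneg)
      then show ?thesis by (simp add: n_def)
    qed
    have sum3: "(\<Sum>(b, x, y)\<in>T. real (card (N b \<inter> N x))) \<le> n * D * (\<eta> * D\<^sup>2)"
      using tri_sum unfolding sumT by (simp add: sum_distrib_left)
    have sum4: "(\<Sum>(b, x, y)\<in>T. real (card (N b \<inter> N y))) \<le> n * D * (\<eta> * D\<^sup>2)" using tri_sum unfolding sumT by simp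
    have total: "(\<Sum>k\<in>T. cst k) \<le> n * D\<^sup>2 * \<kappa>"
    proof -
      have "(\<Sum>k\<in>T. cst k) = card T * (3 * D * P) + (\<Sum>(b, x, y)\<in>T. real (card (N x \<inter> N y))) * Q
        + (\<Sum>(b, x, y)\<in>T. real (card (N b \<inter> N x))) * (D * (Q * P))
        + (\<Sum>(b, x, y)\<in>T. real (card (N b \<inter> N y))) * (D * (Q * P)) + card T * (D ^ 3 * (Q * P\<^sup>2))"
        unfolding cst_def by (simp add: case_prod_beta sum.distrib sum_distrib_right mult.assoc)
      also have "\<dots> \<le> n * D\<^sup>2 * (3 * D * P) + n * D * (\<eta> * D\<^sup>2) * Q + n * D * (\<eta> * D\<^sup>2) * (D * (Q * P))
        + n * D * (\<eta> * D\<^sup>2) * (D * (Q * P)) + n * D\<^sup>2 * (D ^ 3 * (Q * P\<^sup>2))"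
        using cardT sum2 sum3 sum4 PQ Dpos by (intro add_mono mult_right_mono) auto
      also have "\<dots> = n * D\<^sup>2 * (3 * (P * D) + \<eta> * (Q * D) + 2 * \<eta> * ((Q * D) * (P * D)) + (Q * D) * (P * D) * (P * D))"
        by (simp add: algebra_simps power2_eq_square power3_eq_cube)
      also have "\<dots> = n * D\<^sup>2 * \<kappa>" unfolding PQD \<alpha>(2) \<kappa>_def by (simp add: algebra_simps)
      finally show ?thesis .
    qed
    have cardOb: "n * D\<^sup>2 * (3 / (4 * C\<^sup>2)) \<le> card Ob"
    proof -
      let ?B1 = "(\<lambda>(b, x). (b, x, x)) ` (SIGMA b:V. N b)"
      let ?B2 = "(SIGMA b:V. Restr E (N b))"
      have finB: "finite ?B1" "finite ?B2" using V finN by auto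
      have TB: "T \<subseteq> Ob \<union> (?B1 \<union> ?B2)"
      proof
        fix k assume k: "k \<in> T"
        obtain b x y where k': "k = (b, x, y)" by (cases k)
        have bxy: "b \<in> V" "x \<in> N b" "y \<in> N b" using k by (auto simp: k' T_def)
        show "k \<in> Ob \<union> (?B1 \<union> ?B2)"
        proof (cases "x = y")
          case True
          then have "k = (\<lambda>(b, x). (b, x, x)) (b, x)" "(b, x) \<in> (SIGMA b:V. N b)" using bxy by (auto simp: k')
          then have "k \<in> ?B1" by blast
          then show ?thesis by blast
        next
          case False
          then show ?thesis using k bxy by (cases "(x, y) \<in> E") (auto simp: k' Ob_def)
        qed
      qed
      have "card T \<le> card (Ob \<union> (?B1 \<union> ?B2))" using finOb finB by (intro card_mono TB finite_UnI)
      also have "\<dots> \<le> card Ob + card (?B1 \<union> ?B2)" by (rule card_Un_le)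
      also have "card (?B1 \<union> ?B2) \<le> card ?B1 + card ?B2" by (rule card_Un_le)
      finally have "card T \<le> card Ob + (card ?B1 + card ?B2)" by simp
      moreover have "real (card ?B1) \<le> n * D"
      proof -
        have "card ?B1 \<le> card (SIGMA b:V. N b)" using V finN by (intro card_image_le) auto
        also have "\<dots> = (\<Sum>b\<in>V. card (N b))" using V finN by simp
        finally have "real (card ?B1) \<le> (\<Sum>b\<in>V. real (card (N b)))" by (simp flip: of_nat_sum)
        also have "\<dots> \<le> (\<Sum>b\<in>V. D)" using cN by (intro sum_mono) auto
        finally show ?thesis by (simp add: n_def)
      qed
      moreover have "real (card ?B2) \<le> n * (\<eta> * D\<^sup>2)"
      proof -
        have "card ?B2 = (\<Sum>b\<in>V. card (Restr E (N b)))" using V finN by (intro card_SigmaI) auto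
        then have "real (card ?B2) = (\<Sum>b\<in>V. real (card (Restr E (N b))))" by simp
        also have "\<dots> \<le> (\<Sum>b\<in>V. \<eta> * D\<^sup>2)" using sp by (intro sum_mono) auto
        finally show ?thesis by (simp add: n_def)
      qed
      \<comment> \<open>Convexity of the square, in the form
        \<open>2 * a * b - b\<^sup>2 \<le> a\<^sup>2\<close> with \<open>b = D / C\<close>.\<close>
      moreover have "n * (D / C)\<^sup>2 \<le> real (card T)"
      proof -
        have "2 * (D / C) * (D / C * n) \<le> 2 * (D / C) * card (Restr E V)"
          using dense C Dpos by (intro mult_left_mono) (auto simp: n_def)
        then have "n * (D / C)\<^sup>2 \<le> 2 * (D / C) * card (Restr E V) - n * (D / C)\<^sup>2"
          by (simp add: power2_eq_square algebra_simps)
        also have "\<dots> = (\<Sum>b\<in>V. 2 * (D / C) * card (N b) - (D / C)\<^sup>2)" using card_arcs_sum_deg[OF V(1) V(1), of E]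
          by (simp add: N_def n_def sum_subtractf sum_distrib_left)
        also have "\<dots> \<le> (\<Sum>b\<in>V. real (card (N b)) * real (card (N b)))"
        proof (rule sum_mono)
          fix b
          have "0 \<le> (real (card (N b)) - D / C)\<^sup>2" by simp
          then show "2 * (D / C) * card (N b) - (D / C)\<^sup>2 \<le> real (card (N b)) * real (card (N b))"
            by (simp add: power2_eq_square algebra_simps)
        qed
        also have "\<dots> = real (card T)" using sumT[of "\<lambda>_ _ _. 1"] by (simp add: case_prod_beta)
        finally show ?thesis .
      qed
      ultimately have 1: "n * (D / C)\<^sup>2 - n * D - n * (\<eta> * D\<^sup>2) \<le> card Ob" by linarith
      have "n * D \<le> n * D\<^sup>2 * (1 / (8 * C\<^sup>2))"
      proof -
        have "8 * C\<^sup>2 \<le> D" using D D0 by linarith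
        then have "1 \<le> D * (1 / (8 * C\<^sup>2))" using C2 by (simp add: field_simps)
        then have "n * D * 1 \<le> n * D * (D * (1 / (8 * C\<^sup>2)))" using n Dpos by (intro mult_left_mono) auto
        then show ?thesis by (simp add: power2_eq_square mult.assoc)
      qed
      moreover have "n * (\<eta> * D\<^sup>2) \<le> n * D\<^sup>2 * (1 / (8 * C\<^sup>2))"
      proof -
        have "n * D\<^sup>2 * \<eta> \<le> n * D\<^sup>2 * (1 / (8 * C\<^sup>2))" using \<eta>1 n by (intro mult_left_mono) auto
        then show ?thesis by (simp add: mult.commute mult.left_commute)
      qed
      moreover have "n * (D / C)\<^sup>2 = n * D\<^sup>2 * (1 / C\<^sup>2)" by (simp add: power_divide)
      moreover have aux: "a - b - d \<le> r \<Longrightarrow> b \<le> u \<Longrightarrow> d \<le> u \<Longrightarrow> a = v \<Longrightarrow> v - u - u \<le> r" for a b d r u v :: real by linarith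
      ultimately have "n * D\<^sup>2 * (1 / C\<^sup>2) - n * D\<^sup>2 * (1 / (8 * C\<^sup>2)) - n * D\<^sup>2 * (1 / (8 * C\<^sup>2)) \<le> card Ob"
        using 1 aux by blast
      moreover have "3 / (4 * C\<^sup>2) = 1 / C\<^sup>2 - 1 / (8 * C\<^sup>2) - 1 / (8 * C\<^sup>2)" using C by (simp add: field_simps)
      ultimately show ?thesis by (simp only: right_diff_distrib)
    qed
    have ppR: "pp (R k) = Q * P\<^sup>2" if "k \<in> Ob" for k using that by (auto simp: pp_def R_def Ob_def power2_eq_square)
    \<comment> \<open>In units of the \<open>n * P\<close> expected branch vertices, conflicts cost
      at most \<open>2 * c + 1\<close> and branch vertices \<open>2 * c\<close>, while at least
      \<open>3 * (2 * c + 1)\<close> triples are expected.\<close>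
    have main: "(\<Sum>k\<in>Ob. pp (R k) * (\<Sum>Z\<in>Cf k. pp Z)) + 2 * c * (\<Sum>u\<in>Inl ` V. pr u) < (\<Sum>k\<in>Ob. pp (R k))"
    proof -
      have "(\<Sum>k\<in>Ob. pp (R k) * (\<Sum>Z\<in>Cf k. pp Z)) \<le> (\<Sum>k\<in>Ob. Q * P\<^sup>2 * cst k)"
      proof (rule sum_mono)
        fix k assume k: "k \<in> Ob"
        obtain b x y where k': "k = (b, x, y)" by (cases k)
        have "(\<Sum>Z\<in>Cf k. pp Z) \<le> cst k"
          unfolding k' using k NV by (intro cost) (auto simp: k' Ob_def T_def)
        then show "pp (R k) * (\<Sum>Z\<in>Cf k. pp Z) \<le> Q * P\<^sup>2 * cst k"
          unfolding ppR[OF k] using PQ by (intro mult_left_mono) auto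
      qed
      also have "\<dots> = Q * P\<^sup>2 * (\<Sum>k\<in>Ob. cst k)" by (simp add: sum_distrib_left)
      also have "\<dots> \<le> Q * P\<^sup>2 * (n * D\<^sup>2 * \<kappa>)"
      proof (rule mult_left_mono)
        have "(\<Sum>k\<in>Ob. cst k) \<le> (\<Sum>k\<in>T. cst k)" using PQ Dpos by (intro sum_mono2 finT ObT) (auto simp: cst_def)
        then show "(\<Sum>k\<in>Ob. cst k) \<le> n * D\<^sup>2 * \<kappa>" using total by linarith
      qed (use PQ in simp)
      also have "\<dots> = n * P * (g * \<kappa>)"
        unfolding \<alpha>(2)[symmetric] PQD[symmetric] by (simp add: power2_eq_square)
      also have "\<dots> \<le> n * P * (g * (1 / (4 * C\<^sup>2)))" using \<kappa> n PQ g by (intro mult_left_mono) auto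
      finally have 1: "(\<Sum>k\<in>Ob. pp (R k) * (\<Sum>Z\<in>Cf k. pp Z)) \<le> n * P * (g * (1 / (4 * C\<^sup>2)))" .
      have "(\<Sum>u\<in>Inl ` V. pr u) = n * P" by (subst sum.reindex) (auto simp: n_def)
      then have 2: "2 * c * (\<Sum>u\<in>Inl ` V. pr u) = n * P * (2 * c)" by simp
      have "n * P * (g * (3 / (4 * C\<^sup>2))) = Q * P\<^sup>2 * (n * D\<^sup>2 * (3 / (4 * C\<^sup>2)))"
        unfolding \<alpha>(2)[symmetric] PQD[symmetric] by (simp add: power2_eq_square)
      also have "\<dots> \<le> Q * P\<^sup>2 * card Ob" using cardOb PQ by (intro mult_left_mono) auto
      also have "\<dots> = (\<Sum>k\<in>Ob. pp (R k))" using ppR by simp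
      finally have 3: "n * P * (g * (3 / (4 * C\<^sup>2))) \<le> (\<Sum>k\<in>Ob. pp (R k))" .
      have e: "g * (1 / (4 * C\<^sup>2)) = 2 * c + 1" "g * (3 / (4 * C\<^sup>2)) = 3 * (2 * c + 1)"
        using C2 by (simp_all add: g_def)
      have 4: "n * P * (2 * c + 1) + n * P * (2 * c) < n * P * (3 * (2 * c + 1))"
      proof -
        have "n * P * (2 * c + 1 + 2 * c) < n * P * (3 * (2 * c + 1))"
          using n PQ c by (intro mult_strict_left_mono) auto
        then show ?thesis by (simp only: distrib_left)
      qed
      have aux: "s1 \<le> a \<Longrightarrow> s2 = b \<Longrightarrow> d \<le> s3 \<Longrightarrow> a + b < d \<Longrightarrow> s1 + s2 < s3" for a b d s1 s2 s3 :: real by linarith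
      show ?thesis by (rule aux[OF 1[unfolded e] 2 3[unfolded e] 4])
    qed
    have "\<exists>S\<subseteq>U. 2 * c * card (S \<inter> Inl ` V) < card {k\<in>Ob. R k \<subseteq> S \<and> (\<forall>Z\<in>Cf k. \<not> Z \<subseteq> S)}"
    proof (rule deletion_method[where p = pr and R = R and C = Cf])
      show "finite U" using V by (simp add: U_def)
      show "finite Ob" by (rule finOb)
      show "Inl ` V \<subseteq> U" by (simp add: U_def)
      show "0 \<le> pr u \<and> pr u \<le> 1" for u using PQ by (cases u) auto
      show "(\<Sum>i\<in>Ob. (\<Prod>u\<in>R i. pr u) * (\<Sum>Z\<in>Cf i. \<Prod>u\<in>Z. pr u)) + 2 * c * (\<Sum>u\<in>Inl ` V. pr u) < (\<Sum>i\<in>Ob. \<Prod>u\<in>R i. pr u)"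
        using main by (simp add: pp_def)
      fix k assume k: "k \<in> Ob"
      obtain b x y where k': "k = (b, x, y)" by (cases k)
      have bxy: "b \<in> V" "x \<in> N b" "y \<in> N b" using k by (auto simp: k' Ob_def T_def)
      show "R k \<subseteq> U" using bxy NV by (auto simp: k' R_def U_def)
      show "finite (Cf k)" using fin1 by (auto simp: k' Cf_def)
      have bN: "b \<noteq> b'" if "b' \<in> N b" for b' using that Nirr by blast
      show "Z \<subseteq> U \<and> Z \<inter> R k = {}" if "Z \<in> Cf k" for Z
        using that NV bN unfolding k' Cf_def R_def U_def C1_def C2_def C3_def C5_def K5_def by fastforce
    qed
    then obtain S where S: "S \<subseteq> U" "2 * c * card (S \<inter> Inl ` V) < card {k\<in>Ob. R k \<subseteq> S \<and> (\<forall>Z\<in>Cf k. \<not> Z \<subseteq> S)}" by blast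
    define Sv where "Sv = {k\<in>Ob. R k \<subseteq> S \<and> (\<forall>Z\<in>Cf k. \<not> Z \<subseteq> S)}"
    have Sv: "b \<in> V" "x \<in> N b" "y \<in> N b" "x \<noteq> y" "(x, y) \<notin> E" "Inr b \<in> S" "Inl x \<in> S" "Inl y \<in> S"
      if "(b, x, y) \<in> Sv" for b x y using that by (auto simp: Sv_def Ob_def T_def R_def)
    have noC: "Z \<notin> C1 b x y" "Z \<notin> C2 b x y" "Z \<notin> C3 b x y x" "Z \<notin> C3 b x y y" "Z \<notin> C5 b x y"
      if "(b, x, y) \<in> Sv" "Z \<subseteq> S" for b x y Z using that by (auto simp: Sv_def Cf_def)
    have s2: "a \<in> {x, y}" if k: "(b, x, y) \<in> Sv" and a: "a \<in> N b \<union> (N x \<union> N y)" "Inl a \<in> S" for b x y a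
    proof (rule ccontr)
      assume "a \<notin> {x, y}"
      then have "{Inl a} \<in> C1 b x y" using a unfolding C1_def by blast
      then show False using noC(1)[OF k, of "{Inl a}"] a(2) by simp
    qed
    have s3: "b' = b" if k: "(b, x, y) \<in> Sv" and b': "b' \<in> N x \<inter> N y" "Inr b' \<in> S" for b x y b'
    proof (rule ccontr)
      assume "b' \<noteq> b"
      then have "{Inr b'} \<in> C2 b x y" using b' unfolding C2_def by blast
      then show False using noC(2)[OF k, of "{Inr b'}"] b'(2) by simp
    qed
    have s4: "a \<in> {x, y}" if k: "(b, x, y) \<in> Sv" and z: "z \<in> {x, y}"
      and b': "b' \<in> N b \<inter> N z" "Inr b' \<in> S" and a: "a \<in> N b'" "Inl a \<in> S" for b x y z b' a
    proof (rule ccontr)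
      assume "a \<notin> {x, y}"
      then have "{Inr b', Inl a} \<in> C3 b x y z"
        unfolding C3_def using b' a by (intro image_eqI[of _ _ "(b', a)"]) auto
      then show False using noC(3,4)[OF k, of "{Inr b', Inl a}"] z b'(2) a(2) by auto
    qed
    have s5: "a \<in> {x, y} \<or> a' \<in> {x, y}" if k: "(b, x, y) \<in> Sv"
      and b': "b' \<in> N b" "Inr b' \<in> S" and a: "a \<in> N b'" "Inl a \<in> S" "a' \<in> N b'" "Inl a' \<in> S" "a \<noteq> a'" for b x y b' a a'
    proof (rule ccontr)
      assume "\<not> ?thesis"
      then have "{Inr b', Inl a, Inl a'} \<in> C5 b x y"
        unfolding C5_def K5_def using b' a by (intro image_eqI[of _ _ "(b', a, a')"]) auto
      then show False using noC(5)[OF k, of "{Inr b', Inl a, Inl a'}"] b'(2) a by simp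
    qed
    define F where "F = (\<lambda>(b, x, y). {x, y}) ` Sv"
    have "\<forall>f\<in>F. \<exists>b x y. f = {x, y} \<and> (b, x, y) \<in> Sv" by (auto simp: F_def)
    then obtain w where w: "\<And>f. f \<in> F \<Longrightarrow> \<exists>x y. f = {x, y} \<and> (w f, x, y) \<in> Sv" by metis
    have finSv: "finite Sv" using finOb by (simp add: Sv_def)
    \<comment> \<open>By \<open>C2\<close> the middle vertex of a surviving pair is unique, so
      \<open>{x, y}\<close> stems from at most two triples, one for each order of \<open>x\<close>
      and \<open>y\<close>.\<close>
    have Sv2: "card Sv \<le> 2 * card F"
    proof -
      define R0 where "R0 = (\<lambda>(b, x, y). (x, y)) ` Sv"
      define R1 where "R1 = R0 \<union> R0\<inverse>"
      have "inj_on (\<lambda>(b, x, y). (x, y)) Sv"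
      proof (rule inj_onI)
        fix k k' assume k: "k \<in> Sv" "k' \<in> Sv" and eq: "(\<lambda>(b, x, y). (x, y)) k = (\<lambda>(b, x, y). (x, y)) k'"
        obtain b x y where k1: "k = (b, x, y)" by (cases k)
        obtain b' where k2: "k' = (b', x, y)" using eq k1 by (cases k') auto
        have "b' \<in> N x \<inter> N y" using Sv[of b' x y] k k2 Nsym by auto
        then have "b' = b" using s3[of b x y b'] k k1 k2 Sv[of b' x y] by auto
        then show "k = k'" using k1 k2 by simp
      qed
      then have "card Sv = card R0" by (simp add: R0_def card_image)
      also have "\<dots> \<le> card R1" using finSv by (intro card_mono) (auto simp: R1_def R0_def)
      also have "\<dots> = 2 * card ((\<lambda>(x, y). {x, y}) ` R1)"
      proof (rule card_sym_arcs)
        show "finite R1" using finSv by (auto simp: R1_def R0_def)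
        show "sym R1" by (auto simp: R1_def sym_def)
        show "irrefl R1" using Sv(4) by (auto simp: R1_def R0_def irrefl_def)
      qed
      also have "(\<lambda>(x, y). {x, y}) ` R1 = F"
        unfolding R1_def R0_def F_def by (force simp: image_iff)
      finally show ?thesis .
    qed
    define A where "A = \<Union>F"
    have AS: "a \<in> V \<and> Inl a \<in> S" if aA: "a \<in> A" for a
    proof -
      obtain b x y where "(b, x, y) \<in> Sv" "a \<in> {x, y}" using aA by (auto simp: A_def F_def)
      then show ?thesis using Sv[of b x y] NV by auto
    qed
    have AV: "A \<subseteq> V" using AS by blast
    have finA: "finite A" using AV V finite_subset by blast
    have "card A \<le> card (S \<inter> Inl ` V)"
    proof -
      have "finite (S \<inter> Inl ` V)" using V by simp
      moreover have "Inl ` A \<subseteq> S \<inter> Inl ` V" using AS by blast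
      ultimately have "card (Inl ` A :: ('a + 'a) set) \<le> card (S \<inter> Inl ` V)" by (intro card_mono)
      then show ?thesis by (simp add: card_image)
    qed
    then have "2 * c * card A \<le> 2 * c * card (S \<inter> Inl ` V)" using c by (intro mult_left_mono) auto
    also have "\<dots> < card Sv" using S by (simp add: Sv_def)
    also have "\<dots> \<le> real (2 * card F)" using Sv2 by (simp only: of_nat_le_iff)
    finally have cF: "c * card A < card F" by simp
    have indA: "Restr E A = {}"
    proof (rule ccontr)
      assume "\<not> ?thesis"
      then obtain a a' where a: "a \<in> A" "a' \<in> A" "(a, a') \<in> E" by blast
      obtain b x y where k: "(b, x, y) \<in> Sv" "a \<in> {x, y}" using a by (auto simp: A_def F_def)
      have "a' \<in> N a" using a AV by (auto simp: N_def)
      then have "a' \<in> {x, y}" using s2[OF k(1), of a'] k(2) AS[OF a(2)] by auto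
      then show False using Sv(5)[OF k(1)] k(2) a(3) symD[OF E(1) a(3)] \<open>a' \<in> N a\<close> Nirr by auto
    qed
    have "induced_sub E A F (\<lambda>f. {w f})"
    proof (rule induced_sub_singletons[OF E(1,2) finA indA])
      show "card f = 2 \<and> w f \<notin> A \<and> E `` {w f} \<inter> A = f" if f: "f \<in> F" for f
      proof -
        obtain x y where xy: "f = {x, y}" "(w f, x, y) \<in> Sv" using w[OF f] by blast
        have only: "a \<in> {x, y}" if "a \<in> N (w f) \<union> (N x \<union> N y)" "a \<in> A" for a
          using s2[OF xy(2) that(1)] AS[OF that(2)] by blast
        have "w f \<notin> A"
        proof
          assume wA: "w f \<in> A"
          have "w f \<in> N x" using Sv(1,2)[OF xy(2)] Nsym by blast
          then have "w f \<in> {x, y}" using only wA by blast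
          then show False using Sv(2,3)[OF xy(2)] Nirr by auto
        qed
        moreover have "E `` {w f} \<inter> A \<subseteq> f" using only AV xy(1) by (auto simp: N_def)
        moreover have "f \<subseteq> A" "f \<subseteq> E `` {w f}" using f Sv(2,3)[OF xy(2)] xy(1) by (auto simp: A_def N_def)
        moreover have "card f = 2" using Sv(4)[OF xy(2)] by (simp add: xy(1))
        ultimately show ?thesis by blast
      qed
      show "(w f, w h) \<notin> E" if fh: "f \<in> F" "h \<in> F" "f \<noteq> h" for f h
      proof
        assume wE: "(w f, w h) \<in> E"
        obtain x y where xy: "f = {x, y}" "(w f, x, y) \<in> Sv" using w[OF fh(1)] by blast
        obtain x' y' where xy': "h = {x', y'}" "(w h, x', y') \<in> Sv" using w[OF fh(2)] by blast
        note h = Sv[OF xy'(2)]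
        have wN: "w h \<in> N (w f)" using wE h(1) by (auto simp: N_def)
        have "x' \<in> {x, y} \<or> y' \<in> {x, y}" using s5[OF xy(2) wN h(6) h(2) h(7) h(3) h(8) h(4)] .
        then obtain z where z: "z \<in> {x, y}" "z \<in> {x', y'}" by blast
        have "w h \<in> N z" using z(2) Nsym[OF h(2) h(1)] Nsym[OF h(3) h(1)] by blast
        then have wNz: "w h \<in> N (w f) \<inter> N z" using wN by blast
        have "x' \<in> {x, y}" "y' \<in> {x, y}"
          by (rule s4[OF xy(2) z(1) wNz h(6) h(2) h(7)], rule s4[OF xy(2) z(1) wNz h(6) h(3) h(8)])
        then show False using fh(3) h(4) xy(1) xy'(1) by auto
      qed
    qed
    then show ?thesis using cF AV by (intro exI conjI)
  qed
  then show ?thesis by (intro exI[of _ D0] allI impI) blast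
qed

text \<open>Passing to a densest \<open>X\<close> turns the density into an upper bound for all
  subsets: the arcs inside \<open>L\<close>, the size of \<open>R1\<close> and the degeneracy of
  \<open>R3\<close> are all controlled by it.\<close>

lemma biclique_free_dense_induced_sub:
  fixes c :: real
  assumes c: "c \<ge> 0" and t: "t \<ge> 1"
  shows "\<exists>D::real. \<forall>(E :: ('a \<times> 'a) set) V. finite V \<longrightarrow> V \<noteq> {} \<longrightarrow> sym E \<longrightarrow> irrefl E \<longrightarrow>
    biclique_free t E \<longrightarrow> D * card V \<le> card (Restr E V) \<longrightarrow>
    has_induced_sub c E V"
proof -
  define M where "M = 80 * c + 2"
  \<comment> \<open>The summand 64 keeps \<open>L\<close> below \<open>n / 32\<close>; the other one
    makes \<open>card L * K \<le> n\<close>, combined with \<open>n \<le> 64 * d * card B\<close>,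
    yield the last hypothesis of \<open>unbalanced_induced_sub\<close>.\<close>
  define K where "K = 64 + 64 * t * (8 * real t) ^ t * M ^ (t - 1)"
  have M: "M \<ge> 1" "M > 80 * c + 1" using c by (auto simp: M_def)
  have "0 \<le> 64 * t * (8 * real t) ^ t * M ^ (t - 1)" using M by simp
  then have K: "K \<ge> 32" "K > 0" unfolding K_def by linarith+
  have K4: "4 * K \<ge> 1" using K by simp
  obtain D0 where D0: "\<And>(D::real) (E :: ('a \<times> 'a) set) V. D0 \<le> D \<Longrightarrow> finite V \<Longrightarrow> V \<noteq> {} \<Longrightarrow> sym E \<Longrightarrow> irrefl E \<Longrightarrow>
    biclique_free t E \<Longrightarrow> (\<forall>v\<in>V. deg E V v \<le> D) \<Longrightarrow> D / (4 * K) * card V \<le> card (Restr E V) \<Longrightarrow>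
    has_induced_sub c E V" using almost_regular_induced_sub[OF K4 c t, where 'a='a] by blast
  define d0 where "d0 = Max {D0, 8 * real t, 1}"
  have d0: "d0 \<ge> D0" "d0 \<ge> 8 * real t" "d0 \<ge> 1" by (auto simp: d0_def)
  have "has_induced_sub c E V"
    if V: "finite V" "V \<noteq> {}" and E: "sym E" "irrefl E" "biclique_free t E" and dense: "d0 * card V \<le> card (Restr E V)"
    for E :: "('a \<times> 'a) set" and V
  proof -
    define dens where "dens X = real (card (Restr E X)) / real (card X)" for X
    define DX where "DX = {X. X \<subseteq> V \<and> X \<noteq> {}}"
    have finDX: "finite DX" using V by (simp add: DX_def)
    define d where "d = Max (dens ` DX)"
    have "d \<in> dens ` DX" unfolding d_def using finDX V by (intro Max_in) (auto simp: DX_def)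
    then obtain X where X: "X \<subseteq> V" "X \<noteq> {}" "d = dens X" by (auto simp: DX_def)
    have finX: "finite X" using X V finite_subset by blast
    define n where "n = real (card X)"
    have n: "n > 0" using X finX by (simp add: n_def card_gt_0_iff)
    have eX: "real (card (Restr E X)) = d * n" using n by (simp add: X(3) dens_def n_def)
    have dmax: "real (card (Restr E Y)) \<le> d * card Y" if "Y \<subseteq> X" for Y
    proof (cases "Y = {}")
      case False
      have "finite Y" using that finX finite_subset by blast
      then have "card Y > 0" using False by (simp add: card_gt_0_iff)
      moreover have "dens Y \<le> d" unfolding d_def using finDX that X False by (intro Max_ge) (auto simp: DX_def)
      ultimately show ?thesis by (simp add: dens_def field_simps)
    qed simp
    have "d0 \<le> dens V" using dense V by (simp add: dens_def field_simps card_gt_0_iff)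
    moreover have "dens V \<le> d" unfolding d_def using finDX V by (intro Max_ge) (auto simp: DX_def)
    ultimately have d: "d \<ge> d0" by simp
    have dpos: "d \<ge> 1" "d > 0" using d d0 by auto
    define L where "L = {v\<in>X. deg E X v > K * d}"
    define R where "R = X - L"
    have LR: "L \<subseteq> X" "R \<subseteq> X" "L \<inter> R = {}" "X = L \<union> R" by (auto simp: L_def R_def)
    have finLR: "finite L" "finite R" using LR finX finite_subset by blast+
    have deg_sum: "(\<Sum>v\<in>X. real (deg E X v)) = d * n" using card_arcs_sum_deg[OF finX finX, of E] eX by simp
    have cL: "card L * K \<le> n"
    proof -
      have "card L * (K * d) \<le> (\<Sum>v\<in>L. real (deg E X v))"
        using sum_mono[of L "\<lambda>_. K * d" "\<lambda>v. real (deg E X v)"] by (simp add: L_def less_imp_le)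
      also have "\<dots> \<le> (\<Sum>v\<in>X. real (deg E X v))" using finX LR by (intro sum_mono2) auto
      finally have "d * (card L * K) \<le> d * n" using deg_sum by (simp add: mult_ac)
      then show ?thesis using dpos by simp
    qed
    have cL': "card L \<le> n / 32"
    proof -
      have "real (card L) * 32 \<le> card L * K" using K by (intro mult_left_mono) auto
      then show ?thesis using cL by linarith
    qed
    show ?thesis
    \<comment> \<open>In the first case \<open>R\<close> has maximum degree at most
      \<open>K * d\<close> and average at least \<open>d / 4\<close>: almost regular with ratio
      \<open>4 * K\<close>.\<close>
    proof (cases "real (card (Restr E R)) \<ge> d * n / 4")
      case True
      have "0 < d * n / 4" using dpos n by simp
      then have R: "R \<noteq> {}" using True by auto
      have KD: "D0 \<le> K * d"
      proof -
        have "1 * d \<le> K * d" using K dpos by (intro mult_right_mono) auto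
        then show ?thesis using d d0 by linarith
      qed
      have degR: "deg E R v \<le> K * d" if "v \<in> R" for v
      proof -
        have "deg E R v \<le> deg E X v" using finX LR by (intro card_mono) auto
        moreover have "deg E X v \<le> K * d" using that by (auto simp: R_def L_def)
        ultimately show ?thesis by linarith
      qed
      have denR: "K * d / (4 * K) * card R \<le> card (Restr E R)"
      proof -
        have "card R \<le> card X" using finX LR by (intro card_mono)
        then have "d / 4 * card R \<le> d / 4 * n" using dpos by (intro mult_left_mono) (auto simp: n_def)
        then show ?thesis using True K by simp
      qed
      have "has_induced_sub c E R" by (rule D0[OF KD finLR(2) R E _ denR]) (simp add: degR)
      then show ?thesis using LR(2) X(1) by (meson order_trans)
    next
      case False
      \<comment> \<open>Of the \<open>d * n\<close> arcs at most \<open>d * n / 4\<close> lie inside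
        \<open>R\<close> and \<open>d * n / 32\<close> inside \<open>L\<close>. Half of the rest
        goes from \<open>R\<close> to \<open>L\<close>, a fraction of 23/64, which is more than
        5/16.\<close>
      have LRsum: "d * n * 5 / 16 \<le> (\<Sum>b\<in>R. real (deg E L b))"
      proof -
        have flip: "card (E \<inter> L \<times> R) = card (E \<inter> R \<times> L)"
        proof -
          have "E\<inverse> = E" using E(1) by (simp add: sym_conv_converse_eq)
          then have "E \<inter> L \<times> R = (E \<inter> R \<times> L)\<inverse>" by (simp add: converse_Int converse_Times)
          then show ?thesis by simp
        qed
        have "Restr E X = (Restr E R) \<union> ((Restr E L) \<union> ((E \<inter> L \<times> R) \<union> (E \<inter> R \<times> L)))" using LR by auto
        then have "card (Restr E X) \<le> card (Restr E R) + (card (Restr E L) + (card (E \<inter> L \<times> R) + card (E \<inter> R \<times> L)))"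
          by (simp only:) (rule order_trans[OF card_Un_le] add_left_mono card_Un_le)+
        then have "d * n \<le> card (Restr E R) + card (Restr E L) + 2 * card (E \<inter> R \<times> L)"
          unfolding eX[symmetric] flip by linarith
        moreover have "card (Restr E L) \<le> d * n / 32"
        proof -
          have "d * card L \<le> d * (n / 32)" using cL' dpos by (intro mult_left_mono) auto
          then show ?thesis using dmax[OF LR(1)] by simp
        qed
        ultimately have "d * n * 5 / 16 \<le> card (E \<inter> R \<times> L)" using False by simp
        then show ?thesis using card_arcs_sum_deg[OF finLR(2,1), of E] by simp
      qed
      define R1 where "R1 = {b\<in>R. d / 8 \<le> deg E L b}"
      define R2 where "R2 = {b\<in>R. 8 * d < deg E L b}"
      have finR: "finite R1" "finite R2" using finLR by (auto simp: R1_def R2_def)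
      have cR1: "n * 5 / 32 \<le> card R1"
      proof -
        have "(\<Sum>b\<in>R. real (deg E L b)) = (\<Sum>b\<in>R1. real (deg E L b)) + (\<Sum>b\<in>R-R1. real (deg E L b))"
          using finLR by (subst add.commute, intro sum.subset_diff) (auto simp: R1_def)
        moreover have "(\<Sum>b\<in>R-R1. real (deg E L b)) \<le> d * n / 8"
        proof -
          have "(\<Sum>b\<in>R-R1. real (deg E L b)) \<le> (\<Sum>b\<in>R-R1. d / 8)" by (intro sum_mono) (auto simp: R1_def)
          also have "\<dots> = card (R - R1) * (d / 8)" by simp
          also have "\<dots> \<le> n * (d / 8)"
          proof (rule mult_right_mono)
            have "card (R - R1) \<le> card X" using finX LR by (intro card_mono) auto
            then show "real (card (R - R1)) \<le> n" by (simp add: n_def)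
          qed (use dpos in simp)
          finally show ?thesis by (simp add: mult.commute)
        qed
        \<comment> \<open>\<open>R1\<close> cannot be small: \<open>R1 \<union> L\<close> has
          density at most \<open>d\<close> and \<open>L\<close> is negligible, so the arcs from
          \<open>R1\<close> to \<open>L\<close> force a linear number of vertices in
          \<open>R1\<close>.\<close>
        moreover have "2 * (\<Sum>b\<in>R1. real (deg E L b)) \<le> d * (card L + card R1)"
        proof -
          have RX: "R1 \<union> L \<subseteq> X" using LR by (auto simp: R1_def)
          have disj: "R1 \<inter> L = {}" using LR by (auto simp: R1_def)
          have "card ((E \<inter> R1 \<times> L) \<union> (E \<inter> R1 \<times> L)\<inverse>) = card (E \<inter> R1 \<times> L) + card ((E \<inter> R1 \<times> L)\<inverse>)"
            using finR finLR disj by (intro card_Un_disjoint) auto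
          moreover have "card ((E \<inter> R1 \<times> L) \<union> (E \<inter> R1 \<times> L)\<inverse>) \<le> card (Restr E (R1 \<union> L))"
          proof (rule card_mono)
            have "E\<inverse> = E" using E(1) by (simp add: sym_conv_converse_eq)
            then have "(E \<inter> R1 \<times> L)\<inverse> = E \<inter> L \<times> R1" by (simp add: converse_Int converse_Times)
            then show "(E \<inter> R1 \<times> L) \<union> (E \<inter> R1 \<times> L)\<inverse> \<subseteq> Restr E (R1 \<union> L)" by auto
          qed (use finR finLR in simp)
          ultimately have "2 * real (card (E \<inter> R1 \<times> L)) \<le> card (Restr E (R1 \<union> L))" by simp
          also have "\<dots> \<le> d * card (R1 \<union> L)" by (rule dmax[OF RX])
          also have "card (R1 \<union> L) = card L + card R1" using disj finR finLR by (simp add: card_Un_disjoint)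
          finally show ?thesis using card_arcs_sum_deg[OF finR(1) finLR(1), of E] by simp
        qed
        moreover have "d * card L \<le> d * (n / 32)" using cL' dpos by (intro mult_left_mono) auto
        ultimately have "d * n * 3 / 8 \<le> d * card R1 + d * n / 32" using LRsum by (simp add: algebra_simps)
        then have "d * (n * 3 / 8) \<le> d * (card R1 + n / 32)" by (simp add: algebra_simps)
        then have "n * 3 / 8 \<le> card R1 + n / 32" using dpos by (simp only: mult_le_cancel_left_pos)
        then show ?thesis using n by linarith
      qed
      have cR2: "card R2 \<le> n / 8"
      proof -
        have "card R2 * (8 * d) \<le> (\<Sum>b\<in>R2. real (deg E X b))"
        proof -
          have "8 * d \<le> deg E X b" if "b \<in> R2" for b
          proof -
            have "deg E L b \<le> deg E X b" using finX LR by (intro card_mono) auto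
            then show ?thesis using that by (auto simp: R2_def)
          qed
          then show ?thesis using sum_mono[of R2 "\<lambda>_. 8 * d" "\<lambda>v. real (deg E X v)"] by simp
        qed
        also have "\<dots> \<le> (\<Sum>v\<in>X. real (deg E X v))" using finX LR by (intro sum_mono2) (auto simp: R2_def)
        finally have "d * (card R2 * 8) \<le> d * n" using deg_sum by (simp add: mult_ac)
        then show ?thesis using dpos by simp
      qed
      define R3 where "R3 = R1 - R2"
      have cR3: "n / 32 \<le> card R3"
      proof -
        have "card R1 \<le> card (R3 \<union> R2)" using finR by (intro card_mono) (auto simp: R3_def)
        also have "\<dots> \<le> card R3 + card R2" by (rule card_Un_le)
        finally show ?thesis using cR1 cR2 n by linarith
      qed
      have R3X: "R3 \<subseteq> X" using LR by (auto simp: R3_def R1_def)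
      have finR3: "finite R3" using R3X finX finite_subset by blast
      have dR3: "degenerate E d R3" by (rule sparse_imp_degenerate[OF finR3]) (use dmax R3X in blast)
      have d0': "0 \<le> d" using dpos by simp
      \<comment> \<open>Independence costs a factor \<open>d + 1\<close>, which the choice of
        \<open>K\<close> can afford: \<open>card L\<close> has to be small only against
        \<open>d * card B\<close>.\<close>
      obtain B where B: "B \<subseteq> R3" "Restr E B = {}" "card R3 \<le> (d + 1) * card B"
        using degenerate_independent_set[OF finR3 dR3 E(1,2) d0'] by blast
      have finB: "finite B" using B finR3 finite_subset by blast
      have Bpos: "n \<le> 64 * d * card B"
      proof -
        have "(d + 1) * card B \<le> (2 * d) * card B" using dpos by (intro mult_right_mono) auto
        then have "n / 32 \<le> 2 * d * card B" using B cR3 by linarith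
        then show ?thesis by simp
      qed
      have "has_induced_sub c E L"
      proof (rule unbalanced_induced_sub[where B = B and d = d and M = M and t = t])
        show "finite L" "finite B" "sym E" "irrefl E" "Restr E B = {}" "biclique_free t E" "t \<ge> 1"
          by (fact finLR finB E B t)+
        show "L \<inter> B = {}" using B LR by (auto simp: R3_def R1_def)
        show "real (card (Restr E Y)) \<le> d * card Y" if "Y \<subseteq> L" for Y using that LR by (intro dmax) blast
        show "d / 8 \<le> deg E L b" "deg E L b \<le> 8 * d" if "b \<in> B" for b using that B by (auto simp: R3_def R1_def R2_def)
        show "d \<ge> 8 * real t" using d d0 by linarith
        show "M > 80 * c + 1" "c \<ge> 0" using M c by auto
        show "real t * card L * (M * d) ^ (t - 1) < card B * (d / (8 * real t)) ^ t"
        proof -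
          define q where "q = t * (8 * real t) ^ t * M ^ (t - 1)"
          have K64: "K = 64 * (1 + q)" by (simp add: K_def q_def)
          have "64 * (card L * (1 + q)) \<le> 64 * (d * card B)" using cL Bpos unfolding K64 by (simp only: mult_ac)
          then have le: "card L * (1 + q) \<le> d * card B" by simp
          have "card L * q < d * card B"
          proof (cases "card L = 0")
            case True
            have "0 < 64 * d * card B" using Bpos n by linarith
            then have "0 < d * card B" by simp
            then show ?thesis using True by simp
          next
            case False
            then have "0 < real (card L)" by simp
            then show ?thesis using le by (simp add: distrib_left)
          qed
          moreover have "0 < d ^ (t - 1) / (8 * real t) ^ t" using dpos t by simp
          ultimately have "card L * q * (d ^ (t - 1) / (8 * real t) ^ t) < d * card B * (d ^ (t - 1) / (8 * real t) ^ t)"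
            by (rule mult_strict_right_mono)
          moreover have "card L * q * (d ^ (t - 1) / (8 * real t) ^ t) = real t * card L * (M * d) ^ (t - 1)"
            using t by (simp add: q_def power_mult_distrib)
          moreover have "d * card B * (d ^ (t - 1) / (8 * real t) ^ t) = card B * (d / (8 * real t)) ^ t"
          proof -
            have "d ^ t = d * d ^ (t - 1)" using t by (cases t) auto
            then show ?thesis by (simp add: power_divide)
          qed
          ultimately show ?thesis by simp
        qed
      qed
      then show ?thesis using LR(1) X(1) by (meson order_trans)
    qed
  qed
  then show ?thesis by (intro exI[of _ d0] allI impI) simp
qed

section \<open>Subdivisions in sparse graphs\<close>

abbreviation path_interiors ::
  "nat \<Rightarrow> ('a \<times> 'a) set \<Rightarrow> 'a set \<Rightarrow> 'a set \<Rightarrow> 'a set set \<Rightarrow> ('a set \<Rightarrow> 'a set) \<Rightarrow> bool" where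
  "path_interiors k E V A F I \<equiv>
    (\<forall>f\<in>F. f \<subseteq> A \<and> card f = 2 \<and> I f \<subseteq> V - A \<and> card (I f) \<le> k) \<and>
    (\<forall>f\<in>F. \<forall>g\<in>F. f \<noteq> g \<longrightarrow> I f \<inter> I g = {}) \<and>
    (\<forall>f\<in>F. \<forall>u\<in>f. \<forall>v\<in>f. linked E (I f \<union> f) u v)"

text \<open>Single interior vertices may have large degree; only the average over all paths is
  controlled. The interiors are disjoint, so with \<open>A\<close> they form at most
  \<open>k + 1\<close> vertices per path, and sparsity bounds the average number of arcs leaving an
  interior towards this set.\<close>

lemma subdivision_induced_sub:
  fixes c D :: real and k :: nat
  assumes D: "D \<ge> 0" and c: "c \<ge> 0"
  shows "\<exists>N::real. \<forall>(E :: ('a \<times> 'a) set) V A F I. finite V \<longrightarrow> sym E \<longrightarrow> irrefl E \<longrightarrow>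
    (\<forall>X\<subseteq>V. card (Restr E X) \<le> D * card X) \<longrightarrow> A \<subseteq> V \<longrightarrow>
    path_interiors k E V A F I \<longrightarrow>
    N * card A < card F \<longrightarrow>
    (\<exists>A' F'. induced_sub E A' F' I \<and> A' \<subseteq> A \<and> F' \<subseteq> F \<and> c * card A' < card F')"
proof -
  \<comment> \<open>\<open>D * (real k + 1)\<close> bounds the average of \<open>H\<close> below;
    \<open>D'\<close> also dominates \<open>D\<close> and is at least 1, so that \<open>P\<close>
    and \<open>Q\<close> are probabilities.\<close>
  define D' where "D' = (D + 1) * (real k + 1)"
  have "1 * 1 \<le> D'" unfolding D'_def using D by (intro mult_mono) auto
  then have D': "D' \<ge> 1" by simp
  have DD': "D * (real k + 1) \<le> D'" "D \<le> D'"
  proof -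
    show "D * (real k + 1) \<le> D'" unfolding D'_def by (intro mult_right_mono) auto
    moreover have "D * 1 \<le> D * (real k + 1)" using D by (intro mult_left_mono) auto
    ultimately show "D \<le> D'" by simp
  qed
  \<comment> \<open>On average \<open>H f + 2 * D\<close> conflicts of probability \<open>P\<close>
    and \<open>H f\<close> of probability \<open>Q\<close> add up to at most
    \<open>3 * D' * P + D' * Q = 1 / 2\<close>.\<close>
  define P where "P = 1 / (12 * D')"
  define Q where "Q = 1 / (4 * D')"
  have PQ: "0 < P" "P \<le> 1" "0 < Q" "Q \<le> 1" "3 * D' * P = 1 / 4" "D' * Q = 1 / 4"
    using D' by (auto simp: P_def Q_def field_simps)
  \<comment> \<open>\<open>D\<close> pays for the pairs with adjacent ends, 1 makes
    \<open>card A\<close> at most \<open>m\<close>, and the last summand lets half of the expected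
    paths, \<open>P\<^sup>2 * Q * m / 2\<close>, exceed \<open>c * P * card A\<close>.\<close>
  define N where "N = D + 1 + 2 * c / (P * Q)"
  have "\<exists>A' F'. induced_sub E A' F' I \<and> A' \<subseteq> A \<and> F' \<subseteq> F \<and> c * card A' < card F'"
    if V: "finite V" and E: "sym E" "irrefl E" and sparse: "\<forall>X\<subseteq>V. card (Restr E X) \<le> D * card X"
      and A: "A \<subseteq> V" and I: "path_interiors k E V A F I" and dense: "N * card A < card F"
    for E :: "('a \<times> 'a) set" and V A F I
  proof -
    have F: "\<forall>f\<in>F. f \<subseteq> A \<and> card f = 2 \<and> I f \<subseteq> V - A \<and> card (I f) \<le> k" using I by (elim conjE)
    have disj: "\<forall>f\<in>F. \<forall>g\<in>F. f \<noteq> g \<longrightarrow> I f \<inter> I g = {}" using I by (elim conjE)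
    have link: "\<forall>f\<in>F. \<forall>u\<in>f. \<forall>v\<in>f. linked E (I f \<union> f) u v" using I by (elim conjE)
    have finA: "finite A" using A V finite_subset by blast
    have "F \<subseteq> Pow A" using F by blast
    then have finF: "finite F" using finA finite_subset by blast
    have spD: "card (Restr E X) \<le> D * card X" if "X \<subseteq> V" for X using sparse that by blast
    define F1 where "F1 = {f\<in>F. Restr E f = {}}"
    have F1F: "F1 \<subseteq> F" by (auto simp: F1_def)
    have finF1: "finite F1" using finF by (simp add: F1_def)
    have F1: "f \<subseteq> A" "card f = 2" "I f \<subseteq> V - A" "card (I f) \<le> k" "Restr E f = {}" if "f \<in> F1" for f
      using F that by (auto simp: F1_def)
    have finI: "finite (I f)" if "f \<in> F1" for f using F1(3)[OF that] V finite_subset by blast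
    define m where "m = real (card F1)"
    have m: "(1 + 2 * c / (P * Q)) * card A < m"
    proof -
      have "F - F1 \<subseteq> (\<lambda>(x, y). {x, y}) ` (Restr E A)"
      proof
        fix f assume f: "f \<in> F - F1"
        then obtain x y where xy: "(x, y) \<in> E" "x \<in> f" "y \<in> f" by (auto simp: F1_def)
        have fA: "f \<subseteq> A" "card f = 2" using F f by auto
        have "x \<noteq> y" using xy E by (auto simp: irrefl_def)
        then have "f = {x, y}" using fA(2) xy by (auto simp: card_2_iff)
        then show "f \<in> (\<lambda>(x, y). {x, y}) ` (Restr E A)" using xy fA by (intro image_eqI[of _ _ "(x, y)"]) auto
      qed
      then have "card (F - F1) \<le> card ((\<lambda>(x, y). {x, y}) ` (Restr E A))" using finA by (intro card_mono) auto
      also have "\<dots> \<le> card (Restr E A)" using finA by (intro card_image_le) auto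
      finally have "card (F - F1) \<le> D * card A" using spD[OF A] by linarith
      moreover have "card F = card F1 + card (F - F1)"
        using F1F finF by (metis card_Diff_subset card_mono finF1 le_add_diff_inverse)
      ultimately show ?thesis using dense by (simp add: m_def N_def algebra_simps)
    qed
    have mA: "card A \<le> m" "m > 0"
    proof -
      have "1 * real (card A) \<le> (1 + 2 * c / (P * Q)) * card A" using c PQ by (intro mult_right_mono) auto
      then show "card A \<le> m" "m > 0" using m by linarith+
    qed
    define W where "W = (\<Union>f\<in>F1. I f)"
    define Y where "Y = A \<union> W"
    have YV: "Y \<subseteq> V" using A F1(3) by (auto simp: Y_def W_def)
    have finY: "finite Y" using YV V finite_subset by blast
    have WY: "W \<subseteq> Y" "A \<subseteq> Y" by (auto simp: Y_def)
    have finW: "finite W" using WY finY finite_subset by blast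
    have disj1: "\<forall>f\<in>F1. \<forall>g\<in>F1. f \<noteq> g \<longrightarrow> I f \<inter> I g = {}" using disj F1F by blast
    have cY: "card Y \<le> (real k + 1) * m"
    proof -
      have "card W = (\<Sum>f\<in>F1. card (I f))" unfolding W_def by (rule card_UN_disjoint[OF finF1 _ disj1]) (use finI in blast)
      also have "\<dots> \<le> (\<Sum>f\<in>F1. k)" using F1(4) by (intro sum_mono)
      finally have "card W \<le> card F1 * k" by simp
      then have "real (card W) \<le> m * k" unfolding m_def by (metis of_nat_le_iff of_nat_mult)
      moreover have "card Y \<le> card A + card W" unfolding Y_def by (rule card_Un_le)
      ultimately show ?thesis using mA by (simp add: algebra_simps)
    qed
    define h where "h w = deg E Y w" for w
    define H where "H f = (\<Sum>w\<in>I f. real (h w))" for f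
    have sumh: "(\<Sum>f\<in>F1. H f) \<le> D' * m"
    proof -
      have "(\<Sum>f\<in>F1. H f) = (\<Sum>w\<in>W. real (h w))"
        unfolding W_def H_def by (rule sum.UNION_disjoint[symmetric, OF finF1 _ disj1]) (use finI in blast)
      also have "\<dots> \<le> (\<Sum>w\<in>Y. real (h w))" using finY WY by (intro sum_mono2) auto
      also have "\<dots> = card (Restr E Y)" using card_arcs_sum_deg[OF finY finY, of E] by (simp add: h_def)
      also have "\<dots> \<le> D * card Y" by (rule spD[OF YV])
      also have "\<dots> \<le> D * ((real k + 1) * m)" using cY D by (intro mult_left_mono)
      also have "\<dots> = (D * (real k + 1)) * m" by simp
      also have "\<dots> \<le> D' * m" using DD' mA by (intro mult_right_mono) auto
      finally show ?thesis .
    qed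
    have degA: "degenerate E D A" by (rule sparse_imp_degenerate[OF finA]) (use spD A in blast)
    obtain out where out0: "\<forall>v\<in>A. out v \<subseteq> E `` {v} \<inter> A \<and> card (out v) \<le> D"
      "\<forall>u\<in>A. \<forall>v\<in>A. (u,v) \<in> E \<longrightarrow> v \<in> out u \<or> u \<in> out v" using degenerate_orientation[OF finA degA E] by (elim exE conjE)
    \<comment> \<open>\<open>Bad\<close>: branch vertices next to the interior, or out-neighbours of
      an end. \<open>Bad2\<close>: paths with an adjacent interior; they are conflicts as a whole,
      and since interiors are disjoint, \<open>H f\<close> bounds their number too.\<close>
    define Bad where "Bad f = ((\<Union>w\<in>I f. E `` {w} \<inter> A) \<union> (\<Union>u\<in>f. out u)) - f" for f
    define Bad2 where "Bad2 f = {g\<in>F1. g \<noteq> f \<and> E \<inter> I f \<times> I g \<noteq> {}}" for f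
    have Bad: "Bad f \<subseteq> A" "card (Bad f) \<le> H f + 2 * D" if f: "f \<in> F1" for f
    proof -
      obtain x y where xy: "f = {x, y}" "x \<noteq> y" "x \<in> A" "y \<in> A" using F1(1,2)[OF f] by (auto simp: card_2_iff)
      show BA: "Bad f \<subseteq> A" using xy out0(1) unfolding Bad_def by blast
      have fo: "out x \<subseteq> A" "out y \<subseteq> A" using xy out0(1) by blast+
      have "card (Bad f) \<le> card ((\<Union>w\<in>I f. E `` {w} \<inter> A) \<union> (out x \<union> out y))"
        using finA fo xy finite_subset[OF fo(1) finA] finite_subset[OF fo(2) finA] finI[OF f]
        by (intro card_mono) (auto simp: Bad_def)
      also have "\<dots> \<le> card (\<Union>w\<in>I f. E `` {w} \<inter> A) + card (out x \<union> out y)" by (rule card_Un_le)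
      also have "\<dots> \<le> (\<Sum>w\<in>I f. deg E A w) + (card (out x) + card (out y))"
        by (intro add_mono card_UN_le card_Un_le finI[OF f])
      also have "(\<Sum>w\<in>I f. deg E A w) \<le> (\<Sum>w\<in>I f. h w)"
        unfolding h_def using finY WY by (intro sum_mono card_mono) auto
      finally have "real (card (Bad f)) \<le> real (\<Sum>w\<in>I f. h w) + (real (card (out x)) + real (card (out y)))" by linarith
      moreover have "real (card (out x)) \<le> D" "real (card (out y)) \<le> D" using xy out0(1) by blast+
      ultimately show "card (Bad f) \<le> H f + 2 * D" by (simp add: H_def)
    qed
    have Bad2: "card (Bad2 f) \<le> H f" if f: "f \<in> F1" for f
    proof -
      have "\<forall>g\<in>Bad2 f. \<exists>z. z \<in> I g \<and> (\<exists>w\<in>I f. (w, z) \<in> E)" by (auto simp: Bad2_def)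
      then obtain z where z: "\<And>g. g \<in> Bad2 f \<Longrightarrow> z g \<in> I g \<and> (\<exists>w\<in>I f. (w, z g) \<in> E)" by metis
      have "card (Bad2 f) \<le> card (\<Union>w\<in>I f. E `` {w} \<inter> Y)"
      proof (rule card_inj_on_le)
        show "inj_on z (Bad2 f)"
        proof (rule inj_onI)
          fix g g' assume g: "g \<in> Bad2 f" "g' \<in> Bad2 f" "z g = z g'"
          then have "z g \<in> I g \<inter> I g'" using z[OF g(1)] z[OF g(2)] by simp
          moreover have "g \<in> F1" "g' \<in> F1" using g by (auto simp: Bad2_def)
          ultimately show "g = g'" using disj1 by blast
        qed
        show "z ` Bad2 f \<subseteq> (\<Union>w\<in>I f. E `` {w} \<inter> Y)"
        proof
          fix y assume "y \<in> z ` Bad2 f"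
          then obtain g where g: "g \<in> Bad2 f" "y = z g" by blast
          then have "g \<in> F1" by (simp add: Bad2_def)
          then have "y \<in> Y" using z[OF g(1)] g(2) by (auto simp: Y_def W_def)
          then show "y \<in> (\<Union>w\<in>I f. E `` {w} \<inter> Y)" using z[OF g(1)] g(2) by blast
        qed
        show "finite (\<Union>w\<in>I f. E `` {w} \<inter> Y)" using finI[OF f] finY by blast
      qed
      also have "\<dots> \<le> (\<Sum>w\<in>I f. h w)" unfolding h_def by (rule card_UN_le[OF finI[OF f]])
      finally show ?thesis unfolding H_def by (simp flip: of_nat_sum)
    qed
    \<comment> \<open>A path is one random element, kept or dropped with its whole interior, so its
      probability does not depend on its length.\<close>
    define U where "U = Inl ` A \<union> Inr ` F1"
    define pr :: "'a + 'a set \<Rightarrow> real" where "pr = case_sum (\<lambda>_. P) (\<lambda>_. Q)"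
    have [simp]: "pr (Inl v) = P" "pr (Inr g) = Q" for v g by (auto simp: pr_def)
    define R :: "'a set \<Rightarrow> ('a + 'a set) set" where "R f = Inl ` f \<union> {Inr f}" for f
    define Cf :: "'a set \<Rightarrow> ('a + 'a set) set set" where
      "Cf f = (\<lambda>a. {Inl a}) ` Bad f \<union> (\<lambda>g. {Inr g}) ` Bad2 f" for f
    have finBad: "finite (Bad f)" "finite (Bad2 f)" if "f \<in> F1" for f
      using Bad(1)[OF that] finA finite_subset finF1 by (auto simp: Bad2_def)
    have prR: "(\<Prod>u\<in>R f. pr u) = P\<^sup>2 * Q" if f: "f \<in> F1" for f
    proof -
      obtain x y where "f = {x, y}" "x \<noteq> y" using F1(2)[OF f] by (auto simp: card_2_iff)
      then show ?thesis by (simp add: R_def power2_eq_square)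
    qed
    have "\<exists>S\<subseteq>U. c * card (S \<inter> Inl ` A) < card {f\<in>F1. R f \<subseteq> S \<and> (\<forall>Z\<in>Cf f. \<not> Z \<subseteq> S)}"
    proof (rule deletion_method[where p = pr and R = R and C = Cf])
      show "finite U" using finA finF1 by (simp add: U_def)
      show "finite F1" by (rule finF1)
      show "Inl ` A \<subseteq> U" by (simp add: U_def)
      show "0 \<le> pr u \<and> pr u \<le> 1" for u using PQ by (cases u) auto
      show "R f \<subseteq> U" if "f \<in> F1" for f using F1(1)[OF that] that by (auto simp: R_def U_def)
      show "finite (Cf f)" if "f \<in> F1" for f using finBad[OF that] by (simp add: Cf_def)
      show "Z \<subseteq> U \<and> Z \<inter> R f = {}" if "f \<in> F1" "Z \<in> Cf f" for f Z
        using Bad(1)[OF that(1)] that(2) by (auto simp: Cf_def U_def R_def Bad_def Bad2_def)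
      have "(\<Sum>f\<in>F1. (\<Prod>u\<in>R f. pr u) * (\<Sum>Z\<in>Cf f. \<Prod>u\<in>Z. pr u))
        \<le> (\<Sum>f\<in>F1. P\<^sup>2 * Q * (H f * P + 2 * D * P + H f * Q))"
      proof (rule sum_mono)
        fix f assume f: "f \<in> F1"
        have "(\<Sum>Z\<in>Cf f. \<Prod>u\<in>Z. pr u) \<le> (\<Sum>Z\<in>(\<lambda>a. {Inl a}) ` Bad f. \<Prod>u\<in>Z. pr u) + (\<Sum>Z\<in>(\<lambda>g. {Inr g}) ` Bad2 f. \<Prod>u\<in>Z. pr u)"
          unfolding Cf_def by (rule sum_Un_le) (use finBad[OF f] PQ in \<open>auto simp: pr_def intro!: prod_nonneg split: sum.splits\<close>)
        also have "\<dots> = card (Bad f) * P + card (Bad2 f) * Q" by (subst (1 2) sum.reindex) (auto simp: inj_on_def)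
        also have "\<dots> \<le> (H f + 2 * D) * P + H f * Q"
          using Bad(2)[OF f] Bad2[OF f] PQ by (intro add_mono mult_right_mono) auto
        also have "\<dots> = H f * P + 2 * D * P + H f * Q" by (simp add: distrib_right)
        finally show "(\<Prod>u\<in>R f. pr u) * (\<Sum>Z\<in>Cf f. \<Prod>u\<in>Z. pr u) \<le>
            P\<^sup>2 * Q * (H f * P + 2 * D * P + H f * Q)"
          unfolding prR[OF f] using PQ by (intro mult_left_mono) auto
      qed
      also have "\<dots> = P\<^sup>2 * Q * ((\<Sum>f\<in>F1. H f) * P + m * (2 * D) * P + (\<Sum>f\<in>F1. H f) * Q)"
        by (simp add: sum_distrib_left sum_distrib_right sum.distrib m_def mult_ac distrib_left)
      also have "\<dots> \<le> P\<^sup>2 * Q * (D' * m * P + m * (2 * D') * P + D' * m * Q)"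
        using sumh DD' mA PQ by (intro mult_left_mono add_mono mult_right_mono) auto
      also have "D' * m * P + m * (2 * D') * P + D' * m * Q = m * (3 * D' * P + D' * Q)" by (simp add: algebra_simps)
      also have "\<dots> = m / 2" using PQ by simp
      finally have 1: "(\<Sum>f\<in>F1. (\<Prod>u\<in>R f. pr u) * (\<Sum>Z\<in>Cf f. \<Prod>u\<in>Z. pr u)) \<le> P\<^sup>2 * Q * (m / 2)" .
      have 2: "(\<Sum>u\<in>Inl ` A. pr u) = card A * P" by (subst sum.reindex) auto
      have 3: "(\<Sum>f\<in>F1. \<Prod>u\<in>R f. pr u) = P\<^sup>2 * Q * m" using prR by (simp add: m_def)
      have 4: "c * (card A * P) < P\<^sup>2 * Q * (m / 2)"
      proof -
        have "(2 * c / (P * Q)) * card A \<le> (1 + 2 * c / (P * Q)) * card A" by (intro mult_right_mono) auto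
        then have "(2 * c / (P * Q)) * card A < m" using m by linarith
        then have "(P\<^sup>2 * Q / 2) * ((2 * c / (P * Q)) * card A) < (P\<^sup>2 * Q / 2) * m"
          using PQ by (intro mult_strict_left_mono) auto
        moreover have "(P\<^sup>2 * Q / 2) * ((2 * c / (P * Q)) * card A) = c * (card A * P)"
          using PQ by (simp add: power2_eq_square)
        ultimately show ?thesis by simp
      qed
      show "(\<Sum>f\<in>F1. (\<Prod>u\<in>R f. pr u) * (\<Sum>Z\<in>Cf f. \<Prod>u\<in>Z. pr u)) + c * (\<Sum>u\<in>Inl ` A. pr u) < (\<Sum>f\<in>F1. \<Prod>u\<in>R f. pr u)"
        unfolding 2 3 using 1 4 by linarith
    qed
    then obtain S where S: "S \<subseteq> U" "c * card (S \<inter> Inl ` A) < card {f\<in>F1. R f \<subseteq> S \<and> (\<forall>Z\<in>Cf f. \<not> Z \<subseteq> S)}" by blast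
    define F' where "F' = {f\<in>F1. R f \<subseteq> S \<and> (\<forall>Z\<in>Cf f. \<not> Z \<subseteq> S)}"
    have F'1: "f \<in> F1" if "f \<in> F'" for f using that by (simp add: F'_def)
    have F'S: "Inl u \<in> S" "Inr f \<in> S" if "f \<in> F'" "u \<in> f" for f u using that by (auto simp: F'_def R_def)
    have F'S': "Inr f \<in> S" if "f \<in> F'" for f using that by (auto simp: F'_def R_def)
    have noBad: "Inl a \<notin> S" if "f \<in> F'" "a \<in> Bad f" for f a using that by (auto simp: F'_def Cf_def)
    have noBad2: "Inr g \<notin> S" if "f \<in> F'" "g \<in> Bad2 f" for f g using that by (auto simp: F'_def Cf_def)
    define A' where "A' = \<Union>F'"
    have A'A: "A' \<subseteq> A" using F1(1) F'1 by (auto simp: A'_def)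
    have A'S: "Inl a \<in> S" if "a \<in> A'" for a using that F'S by (auto simp: A'_def)
    have cF: "c * card A' < card F'"
    proof -
      have "Inl ` A' \<subseteq> S \<inter> Inl ` A" using A'S A'A by auto
      then have "card (Inl ` A' :: ('a + 'a set) set) \<le> card (S \<inter> Inl ` A)" using finA by (intro card_mono) auto
      then have "card A' \<le> card (S \<inter> Inl ` A)" by (simp add: card_image)
      then have "c * card A' \<le> c * card (S \<inter> Inl ` A)" using c by (intro mult_left_mono) auto
      then show ?thesis using S(2) by (simp add: F'_def)
    qed
    have "induced_sub E A' F' I"
      unfolding induced_sub_def
    proof (intro conjI ballI impI)
      show "finite A'" using A'A finA finite_subset by blast
      show "Restr E A' = {}"
      proof (rule ccontr)
        assume "\<not> ?thesis"
        then obtain a a' where a: "a \<in> A'" "a' \<in> A'" "(a, a') \<in> E" by blast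
        have *: False if "a \<in> A'" "a' \<in> A'" "(a, a') \<in> E" "a' \<in> out a" for a a'
        proof -
          obtain f where f: "f \<in> F'" "a \<in> f" using \<open>a \<in> A'\<close> by (auto simp: A'_def)
          have "a' \<notin> f" using F1(5)[OF F'1[OF f(1)]] f that(3) by blast
          then have "a' \<in> Bad f" using f that(4) by (auto simp: Bad_def)
          then show False using noBad[OF f(1)] A'S[OF that(2)] by blast
        qed
        have "a \<in> A" "a' \<in> A" using a A'A by blast+
        then have "a' \<in> out a \<or> a \<in> out a'" using out0(2) a(3) by blast
        then show False using *[OF a] *[OF a(2,1) symD[OF E(1) a(3)]] by blast
      qed
    next
      fix f assume f: "f \<in> F'"
      note f1 = F'1[OF f]
      show "f \<subseteq> A'" using f by (auto simp: A'_def)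
      show "card f = 2" by (rule F1(2)[OF f1])
      show "finite (I f)" by (rule finI[OF f1])
      show "I f \<inter> A' = {}" using F1(3)[OF f1] A'A by blast
      show "linked E (I f \<union> f) u v" if "u \<in> f" "v \<in> f" for u v using link that F1F f1 by blast
      show "E \<inter> {a} \<times> I f = {}" if a: "a \<in> A' - f" for a
      proof (rule ccontr)
        assume "\<not> ?thesis"
        then obtain w where w: "w \<in> I f" "(a, w) \<in> E" by blast
        have "(w, a) \<in> E" using symD[OF E(1) w(2)] .
        then have "a \<in> Bad f" using w a A'A by (auto simp: Bad_def)
        then show False using noBad[OF f] A'S a by blast
      qed
    next
      fix f g assume fg: "f \<in> F'" "g \<in> F'" "f \<noteq> g"
      show "I f \<inter> I g = {}" using disj1 F'1 fg by blast
      show "E \<inter> I f \<times> I g = {}"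
      proof (rule ccontr)
        assume "\<not> ?thesis"
        then have "g \<in> Bad2 f" using fg F'1 by (auto simp: Bad2_def)
        then show False using noBad2[OF fg(1)] F'S'[OF fg(2)] by blast
      qed
    qed
    moreover have "F' \<subseteq> F" using F'1 F1F by blast
    ultimately show ?thesis using cF A'A by (intro exI[of _ A'] exI[of _ F'] conjI)
  qed
  then show ?thesis by (intro exI[of _ N] allI impI) simp
qed

section \<open>Induced subdivisions of a fixed graph\<close>

fun path_arcs :: "'a list \<Rightarrow> ('a \<times> 'a) set" where
  "path_arcs (x # y # xs) = {(x, y), (y, x)} \<union> path_arcs (y # xs)"
| "path_arcs _ = {}"

lemma linked_path_last:
  assumes "path_arcs p \<subseteq> E" "v \<in> set p"
  shows "linked E (set p) v (last p)" using assms
proof (induction p arbitrary: v rule: path_arcs.induct)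
  case (1 x y xs)
  have IH: "linked E (set (x # y # xs)) w (last (x # y # xs))" if "w \<in> set (y # xs)" for w
  proof -
    have "linked E (set (y # xs)) w (last (y # xs))" using 1(1)[OF _ that] 1(2) by simp
    then have "linked E (set (x # y # xs)) w (last (y # xs))" by (rule linked_mono) auto
    then show ?thesis by simp
  qed
  have "linked E (set (x # y # xs)) x y" using 1(2) by (intro linked_arc) auto
  then show ?case using IH[of v] linked_trans[OF _ IH[of y]] 1(3) by auto
qed (auto simp: linked_refl)

text \<open>The walk may return to \<open>a\<close>; the step after its last visit there is the
  right one.\<close>

lemma linked_first_step:
  assumes "linked E Y a b" "a \<noteq> b"
  shows "\<exists>c\<in>Y - {a}. (a, c) \<in> E \<and> linked E (Y - {a}) c b"
proof -
  have "(a, b) \<in> (Restr E Y)\<^sup>*" using assms(1) by (simp add: linked_def)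
  then show ?thesis using assms(2)
  proof (induction rule: rtrancl_induct)
    case (step y z)
    show ?case
    proof (cases "y = a")
      case True
      then show ?thesis using step by (intro bexI[of _ z]) (auto simp: linked_refl)
    next
      case False
      then obtain c where c: "c \<in> Y - {a}" "(a, c) \<in> E" "linked E (Y - {a}) c y" using step by blast
      have "linked E (Y - {a}) y z" using step False by (intro linked_arc) auto
      then show ?thesis using c linked_trans by metis
    qed
  qed simp
qed

text \<open>Chords would contradict minimality. After a step from \<open>a\<close> to
  \<open>c\<close>, the set \<open>Y - {a}\<close> is again minimal, now for \<open>c\<close> and
  \<open>b\<close>, so the induction peels off one end at a time.\<close>

lemma minimal_linked_set_path:
  assumes "finite Y" "sym E" "irrefl E" "a \<in> Y" "b \<in> Y" "a \<noteq> b" "linked E Y a b"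
    and "\<And>Z. Z \<subset> Y \<Longrightarrow> a \<in> Z \<Longrightarrow> b \<in> Z \<Longrightarrow> \<not> linked E Z a b"
  shows "\<exists>ws. distinct (a # ws @ [b]) \<and> set (a # ws @ [b]) = Y \<and> Restr E Y = path_arcs (a # ws @ [b])" using assms(1,4-)
proof (induction Y arbitrary: a rule: finite_psubset_induct)
  case (psubset Y)
  have noloop: "(v, v) \<notin> E" for v using assms(3) by (simp add: irrefl_def)
  have symE: "(v, u) \<in> E" if "(u, v) \<in> E" for u v using symD[OF assms(2) that] .
  obtain c where c: "c \<in> Y - {a}" "(a, c) \<in> E" "linked E (Y - {a}) c b"
    using linked_first_step[OF psubset.prems(4,3)] by blast
  have ac: "linked E Z a c" if "a \<in> Z" "c \<in> Z" for Z using that c by (intro linked_arc)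
  show ?case
  proof (cases "c = b")
    case True
    have "linked E {a, b} a b" using ac[of "{a, b}"] True by simp
    then have "\<not> {a, b} \<subset> Y" using psubset.prems(5) by blast
    then have Y: "Y = {a, b}" using psubset.prems by blast
    have "Restr E Y = {(a, b), (b, a)}" using c True symE noloop unfolding Y by blast
    then show ?thesis using Y psubset.prems(3) by (intro exI[of _ "[]"]) auto
  next
    case False
    have "Y - {a} \<subset> Y" using psubset.prems by blast
    moreover have "\<not> linked E Z c b" if Z: "Z \<subset> Y - {a}" "c \<in> Z" "b \<in> Z" for Z
    proof
      assume "linked E Z c b"
      then have "linked E (insert a Z) a b"
        using linked_trans[OF ac[of "insert a Z"] linked_mono[of E Z c b "insert a Z"]] Z by blast
      moreover have "insert a Z \<subset> Y" using Z psubset.prems by blast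
      ultimately show False using psubset.prems(5) Z by blast
    qed
    ultimately obtain ws where ws: "distinct (c # ws @ [b])" "set (c # ws @ [b]) = Y - {a}"
      "Restr E (Y - {a}) = path_arcs (c # ws @ [b])" using psubset.IH[of "Y - {a}" c] c False psubset.prems by auto
    have only: "v = c" if v: "v \<in> Y" "(a, v) \<in> E" for v
    proof (rule ccontr)
      assume "v \<noteq> c"
      let ?q = "ws @ [b]"
      have vq: "v \<in> set ?q" using ws(2) v \<open>v \<noteq> c\<close> noloop by auto
      have "path_arcs ?q \<subseteq> path_arcs (c # ?q)" by (cases ws) auto
      then have "path_arcs ?q \<subseteq> E" using ws(3) by blast
      then have "linked E (set ?q) v b" using linked_path_last[OF _ vq] by auto
      then have "linked E (insert a (set ?q)) v b" by (rule linked_mono) auto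
      moreover have "linked E (insert a (set ?q)) a v" using v vq by (intro linked_arc) auto
      ultimately have "linked E (insert a (set ?q)) a b" using linked_trans by metis
      moreover have "insert a (set ?q) \<subset> Y" using ws c psubset.prems by auto
      ultimately show False using psubset.prems(5) by auto
    qed
    have "Restr E Y = {(a, c), (c, a)} \<union> (Restr E (Y - {a}))"
    proof
      show "Restr E Y \<subseteq> {(a, c), (c, a)} \<union> (Restr E (Y - {a}))"
      proof
        fix e assume e: "e \<in> Restr E Y"
        obtain u v where uv: "e = (u, v)" by (cases e)
        have "v = c" if "u = a" using only[of v] e uv that by auto
        moreover have "u = c" if "v = a" using only[of u] symE[of u v] e uv that by auto
        ultimately show "e \<in> {(a, c), (c, a)} \<union> (Restr E (Y - {a}))" using e uv by auto
      qed
      show "{(a, c), (c, a)} \<union> (Restr E (Y - {a})) \<subseteq> Restr E Y" using c symE[OF c(2)] psubset.prems by auto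
    qed
    then have "Restr E Y = path_arcs (a # (c # ws) @ [b])" using ws(3) by simp
    moreover have "set (a # (c # ws) @ [b]) = Y" using ws(2) psubset.prems(1) by auto
    moreover have "distinct (a # (c # ws) @ [b])" using ws(1,2) by auto
    ultimately show ?thesis by blast
  qed
qed

lemma linked_induced_path:
  assumes "finite X" "sym E" "irrefl E" "a \<in> X" "b \<in> X" "a \<noteq> b" "linked E X a b"
  shows "\<exists>ws. distinct (a # ws @ [b]) \<and> set (a # ws @ [b]) \<subseteq> X \<and>
    Restr E (set (a # ws @ [b])) = path_arcs (a # ws @ [b])"
proof -
  define DD where "DD = {Z. Z \<subseteq> X \<and> a \<in> Z \<and> b \<in> Z \<and> linked E Z a b}"
  have "finite DD" "DD \<noteq> {}" using assms by (auto simp: DD_def)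
  then obtain Y where Y: "Y \<in> DD" and Ymin: "\<forall>Z\<in>DD. Z \<subseteq> Y \<longrightarrow> Y = Z" using finite_has_minimal[of DD] by blast
  have YX: "Y \<subseteq> X" "a \<in> Y" "b \<in> Y" "linked E Y a b" using Y by (auto simp: DD_def)
  have "\<not> linked E Z a b" if "Z \<subset> Y" "a \<in> Z" "b \<in> Z" for Z using that Ymin YX(1) unfolding DD_def by blast
  then obtain ws where "distinct (a # ws @ [b])" "set (a # ws @ [b]) = Y" "Restr E Y = path_arcs (a # ws @ [b])"
    using minimal_linked_set_path[OF finite_subset[OF YX(1) assms(1)] assms(2,3) YX(2,3) assms(6) YX(4)] by blast
  then show ?thesis using YX(1) by (intro exI[of _ ws]) simp
qed

text \<open>The last clause leaves no arcs but those of the paths in the induced subgraph.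
  Independence of the branch vertices forces a path between two of them to have an inner
  vertex.\<close>

abbreviation induced_path_system where
  "induced_path_system W T E A \<phi> p \<equiv> inj_on \<phi> W \<and> \<phi> ` W \<subseteq> A \<and> Restr E (\<phi> ` W) = {} \<and>
      (\<forall>(x, y)\<in>T. distinct (\<phi> x # p (x, y) @ [\<phi> y]) \<and> set (p (x, y)) \<inter> \<phi> ` W = {}) \<and>
      (\<forall>e\<in>T. \<forall>e'\<in>T. e \<noteq> e' \<longrightarrow> set (p e) \<inter> set (p e') = {}) \<and>
      Restr E (\<phi> ` W \<union> (\<Union>e\<in>T. set (p e))) =
        (\<Union>(x, y)\<in>T. path_arcs (\<phi> x # p (x, y) @ [\<phi> y]))"

text \<open>Mader's theorem is applied to the subdivided graph with vertex set \<open>A\<close> and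
  edge set \<open>F\<close>. Its connecting sets are filled up with the interiors of all edges they
  span, and only then thinned out to induced paths. With \<open>T \<inter> T\<inverse> = {}\<close>
  an edge of the target is determined by its two ends.\<close>

lemma induced_sub_path_system:
  fixes T :: "('b \<times> 'b) set"
  assumes "finite W" "finite T" "T \<subseteq> W \<times> W" "T \<inter> T\<inverse> = {}"
  shows "\<exists>c::nat. \<forall>(E :: ('a \<times> 'a) set) A F I. sym E \<longrightarrow> irrefl E \<longrightarrow> induced_sub E A F I \<longrightarrow> c * card A < card F \<longrightarrow>
    (\<exists>\<phi> p. induced_path_system W T E A \<phi> p)"
proof -
  have anti: "x \<noteq> y \<and> (y, x) \<notin> T" if "(x, y) \<in> T" for x y using assms(4) that by auto
  obtain c :: nat where c: "\<forall>(E :: ('a \<times> 'a) set) A. finite A \<longrightarrow> A \<noteq> {} \<longrightarrow> sym E \<longrightarrow> irrefl E \<longrightarrow>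
    c * card A \<le> card (Restr E A) \<longrightarrow> (\<exists>\<phi> J. topological_embedding W T E A \<phi> J)"
    using topological_minor[OF assms(1-3), where 'a='a] by (elim exE)
  have "\<exists>\<phi> p. induced_path_system W T E A \<phi> p"
    if E: "sym E" "irrefl E" and ind: "induced_sub E A F I" and dense: "c * card A < card F"
    for E :: "('a \<times> 'a) set" and A F I
  proof -
    note ind' = ind[unfolded induced_sub_def]
    have finA: "finite A" and indA: "Restr E A = {}" using ind' by simp_all
    have F: "f \<subseteq> A \<and> card f = 2 \<and> finite (I f) \<and> I f \<inter> A = {}" if "f \<in> F" for f using ind' that by simp
    have link: "linked E (I f \<union> f) u v" if "f \<in> F" "u \<in> f" "v \<in> f" for f u v using ind' that by simp
    have disj: "I f \<inter> I g = {} \<and> E \<inter> I f \<times> I g = {}" if "f \<in> F" "g \<in> F" "f \<noteq> g" for f g using ind' that by simp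
    have nonadj: "E \<inter> {a} \<times> I f = {}" if "f \<in> F" "a \<in> A - f" for f a using ind' that by simp
    have symE: "(v, u) \<in> E" if "(u, v) \<in> E" for u v using symD[OF E(1) that] .
    define EF where "EF = {(x, y). {x, y} \<in> F \<and> x \<noteq> y}"
    have EFA: "EF \<subseteq> A \<times> A" using F by (auto simp: EF_def)
    have finEF: "finite EF" by (rule finite_subset[OF EFA]) (use finA in simp)
    have symEF: "sym EF" by (auto simp: sym_def EF_def insert_commute)
    have irrEF: "irrefl EF" by (auto simp: irrefl_def EF_def)
    have "(\<lambda>(x, y). {x, y}) ` EF = F"
    proof
      show "F \<subseteq> (\<lambda>(x, y). {x, y}) ` EF"
      proof
        fix f assume f: "f \<in> F"
        then obtain x y where "f = {x, y}" "x \<noteq> y" using F[OF f] by (auto simp: card_2_iff)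
        then show "f \<in> (\<lambda>(x, y). {x, y}) ` EF" using f by (intro image_eqI[of _ _ "(x, y)"]) (auto simp: EF_def)
      qed
    qed (auto simp: EF_def)
    then have "card EF = 2 * card F" using card_sym_arcs[OF finEF symEF irrEF] by simp
    moreover have "Restr EF A = EF" using EFA by blast
    ultimately have "c * card A \<le> card (Restr EF A)" using dense by simp
    moreover have "A \<noteq> {}"
    proof
      assume "A = {}"
      have "f \<notin> F" for f using F[of f] \<open>A = {}\<close> by auto
      then have "F = {}" by blast
      then show False using dense by simp
    qed
    ultimately have "\<exists>\<phi> J. topological_embedding W T EF A \<phi> J" using c finA symEF irrEF by simp
    then obtain \<phi> J where R: "topological_embedding W T EF A \<phi> J" by (elim exE)
    have inj: "inj_on \<phi> W" and \<phi>A: "\<phi> ` W \<subseteq> A" using R by simp_all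
    have J: "J e \<subseteq> A - \<phi> ` W" if "e \<in> T" for e using R that by blast
    have Jd: "J e \<inter> J e' = {}" if "e \<in> T" "e' \<in> T" "e \<noteq> e'" for e e' using R that by blast
    have Jl: "\<forall>(x, y)\<in>T. linked EF (J (x, y) \<union> {\<phi> x, \<phi> y}) (\<phi> x) (\<phi> y)" using R by blast
    \<comment> \<open>\<open>B e\<close> includes the ends of the edge, whereas \<open>X e\<close>
      leaves them out: ends are shared, but the sets \<open>X e\<close> have to be disjoint and
      pairwise nonadjacent.\<close>
    define B where "B e = J e \<union> {\<phi> (fst e), \<phi> (snd e)}" for e
    define X where "X e = J e \<union> \<Union>(I ` {f\<in>F. f \<subseteq> B e})" for e
    have TW: "fst e \<in> W" "snd e \<in> W" "fst e \<noteq> snd e" if "e \<in> T" for e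
      using that assms(3) anti[of "fst e" "snd e"] by auto
    have BA: "B e \<subseteq> A" if "e \<in> T" for e using J[OF that] \<phi>A TW[OF that] by (auto simp: B_def)
    have finF: "finite F" using F finA by (meson Pow_iff finite_Pow_iff rev_finite_subset subsetI)
    have finX: "finite (X e)" if "e \<in> T" for e using finite_subset[OF J[OF that]] finA finF F by (auto simp: X_def)
    have lX: "linked E (X e \<union> B e) u v" if "linked EF (B e) u v" for e u v
    proof -
      have "(u, v) \<in> (EF \<inter> B e \<times> B e)\<^sup>*" using that by (simp add: linked_def)
      then show ?thesis
      proof (induction rule: rtrancl_induct)
        case (step y z)
        have f: "{y, z} \<in> F" "{y, z} \<subseteq> B e" using step(2) by (auto simp: EF_def)
        then have "I {y, z} \<union> {y, z} \<subseteq> X e \<union> B e" by (auto simp: X_def)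
        then have "linked E (X e \<union> B e) y z" using linked_mono[OF link[OF f(1), of y z]] by blast
        then show ?case using step(3) linked_trans by metis
      qed (rule linked_refl)
    qed
    let ?W = "\<lambda>e ws. \<phi> (fst e) # ws @ [\<phi> (snd e)]"
    have "\<exists>ws. distinct (?W e ws) \<and> set (?W e ws) \<subseteq> X e \<union> B e \<and>
        Restr E (set (?W e ws)) = path_arcs (?W e ws)"
      if e: "e \<in> T" for e
    proof (rule linked_induced_path[OF _ E])
      show "finite (X e \<union> B e)" using finX[OF e] finite_subset[OF BA[OF e] finA] by simp
      show "\<phi> (fst e) \<in> X e \<union> B e" "\<phi> (snd e) \<in> X e \<union> B e" by (auto simp: B_def)
      show "\<phi> (fst e) \<noteq> \<phi> (snd e)" using inj_onD[OF inj _ TW(1,2)[OF e]] TW(3)[OF e] by blast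
      have "linked EF (B e) (\<phi> (fst e)) (\<phi> (snd e))" using Jl e by (auto simp: B_def case_prod_beta)
      then show "linked E (X e \<union> B e) (\<phi> (fst e)) (\<phi> (snd e))" by (rule lX)
    qed
    then obtain p where p: "\<And>e. e \<in> T \<Longrightarrow> distinct (?W e (p e))"
      "\<And>e. e \<in> T \<Longrightarrow> set (?W e (p e)) \<subseteq> X e \<union> B e"
      "\<And>e. e \<in> T \<Longrightarrow> Restr E (set (?W e (p e))) = path_arcs (?W e (p e))" by metis
    have XW: "X e \<inter> \<phi> ` W = {}" if "e \<in> T" for e
    proof -
      have "I f \<inter> \<phi> ` W = {}" if "f \<in> F" for f using F[OF that] \<phi>A by blast
      then show ?thesis using J[OF that] unfolding X_def by blast
    qed
    have pX: "set (p e) \<subseteq> X e" if "e \<in> T" for e using p(1)[OF that] p(2)[OF that] by (auto simp: B_def X_def)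
    \<comment> \<open>The sets \<open>J\<close> are disjoint and avoid the images of
      \<open>W\<close>, so a pair inside both \<open>B e\<close> and \<open>B e'\<close> consists of
      the ends of either; then \<open>e'\<close> is \<open>e\<close> or its reverse.\<close>
    have sub_eq: "e = e'" if e: "e \<in> T" "e' \<in> T" and f: "f \<in> F" "f \<subseteq> B e" "f \<subseteq> B e'" for e e' f
    proof (rule ccontr)
      assume ne: "e \<noteq> e'"
      let ?D = "\<lambda>e. {\<phi> (fst e), \<phi> (snd e)}"
      have DW: "?D e \<subseteq> \<phi> ` W" "?D e' \<subseteq> \<phi> ` W" using TW e by auto
      have fd: "f \<subseteq> ?D e \<inter> ?D e'"
      proof
        fix z assume "z \<in> f"
        then have "z \<in> J e \<union> ?D e" "z \<in> J e' \<union> ?D e'" using f(2,3) by (auto simp: B_def)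
        moreover have "z \<notin> J e \<or> z \<notin> J e'" "z \<in> J e \<Longrightarrow> z \<notin> \<phi> ` W" "z \<in> J e' \<Longrightarrow> z \<notin> \<phi> ` W"
          using Jd[OF e ne] J[OF e(1)] J[OF e(2)] by blast+
        ultimately show "z \<in> ?D e \<inter> ?D e'" using DW by blast
      qed
      have cf: "card f = 2" using F[OF f(1)] by blast
      have "card (?D e) \<le> 2" "card (?D e') \<le> 2" by (auto simp: card_insert_if)
      moreover have "f \<subseteq> ?D e" "f \<subseteq> ?D e'" using fd by blast+
      ultimately have "f = ?D e" "f = ?D e'" using cf by (simp_all add: card_seteq)
      then have "\<phi> ` {fst e, snd e} = \<phi> ` {fst e', snd e'}" by simp
      then have "{fst e, snd e} = {fst e', snd e'}"
        using inj_on_image_eq_iff[OF inj, of "{fst e, snd e}" "{fst e', snd e'}"] TW e by auto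
      then have "e' = (snd e, fst e)" using ne by (auto simp: doubleton_eq_iff prod_eq_iff)
      then show False using anti[of "fst e" "snd e"] e by auto
    qed
    \<comment> \<open>Interiors of distinct pairs are nonadjacent, \<open>A\<close> is independent,
      and a vertex of \<open>J e\<close> is adjacent only to interiors of pairs containing it, which
      do not fit into \<open>B e'\<close>.\<close>
    have XX: "X e \<inter> X e' = {}" "E \<inter> X e \<times> X e' = {}" if e: "e \<in> T" "e' \<in> T" "e \<noteq> e'" for e e'
    proof -
      note d = Jd[OF e] and n = sub_eq[OF e(1,2)]
      have JI: "J e1 \<inter> I f = {}" if "e1 \<in> T" "f \<in> F" for e1 f using J[OF that(1)] F[OF that(2)] by blast
      have II: "I f \<inter> I g = {} \<and> E \<inter> I f \<times> I g = {}" if "f \<in> F" "f \<subseteq> B e" "g \<in> F" "g \<subseteq> B e'" for f g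
      proof -
        have "f \<noteq> g" using n[OF that(1,2)] that(4) e(3) by blast
        then show ?thesis by (rule disj[OF that(1,3)])
      qed
      have XE: "z \<in> J e1 \<or> (\<exists>f\<in>F. f \<subseteq> B e1 \<and> z \<in> I f)" if "z \<in> X e1" for z e1 using that unfolding X_def by blast
      show "X e \<inter> X e' = {}"
      proof (rule ccontr)
        assume "\<not> ?thesis"
        then obtain z where z: "z \<in> X e" "z \<in> X e'" by blast
        show False
        proof (cases "z \<in> J e")
          case True
          then show False using XE[OF z(2)] d JI[OF e(1)] by blast
        next
          case False
          then obtain f where f: "f \<in> F" "f \<subseteq> B e" "z \<in> I f" using XE[OF z(1)] by blast
          then have "z \<notin> J e'" using JI[OF e(2) f(1)] by blast
          then obtain g where g: "g \<in> F" "g \<subseteq> B e'" "z \<in> I g" using XE[OF z(2)] by blast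
          then show False using II[OF f(1,2) g(1,2)] f(3) by blast
        qed
      qed
      have JB: "a \<notin> B e2" if "a \<in> J e1" "e1 \<in> T" "e2 \<in> T" "e1 \<noteq> e2" for a e1 e2
        using that Jd[OF that(2-4)] J[OF that(2)] TW[OF that(3)] by (auto simp: B_def)
      have JI': False if "e1 \<in> T" "e2 \<in> T" "e1 \<noteq> e2" "f \<in> F" "f \<subseteq> B e2" "a \<in> J e1" "z \<in> I f" "(a, z) \<in> E" for e1 e2 f a z
      proof -
        have "a \<in> A - f" using JB[OF that(6,1-3)] that(5,6) J[OF that(1)] by blast
        then show False using nonadj[OF that(4)] that(7,8) by blast
      qed
      show "E \<inter> X e \<times> X e' = {}"
      proof (rule ccontr)
        assume "\<not> ?thesis"
        then obtain y z where yz: "y \<in> X e" "z \<in> X e'" "(y, z) \<in> E" by blast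
        show False
        proof (cases "y \<in> J e")
          case True
          show False
          proof (cases "z \<in> J e'")
            case True
            then show False using \<open>y \<in> J e\<close> J[OF e(1)] J[OF e(2)] indA yz(3) by blast
          next
            case False
            then obtain g where g: "g \<in> F" "g \<subseteq> B e'" "z \<in> I g" using XE[OF yz(2)] by blast
            show False by (rule JI'[OF e g(1,2) \<open>y \<in> J e\<close> g(3) yz(3)])
          qed
        next
          case False
          then obtain f where f: "f \<in> F" "f \<subseteq> B e" "y \<in> I f" using XE[OF yz(1)] by blast
          show False
          proof (cases "z \<in> J e'")
            case True
            show False by (rule JI'[OF e(2,1) e(3)[symmetric] f(1,2) True f(3) symE[OF yz(3)]])
          next
            case False
            then obtain g where g: "g \<in> F" "g \<subseteq> B e'" "z \<in> I g" using XE[OF yz(2)] by blast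
            then show False using II[OF f(1,2) g(1,2)] f(3) yz(3) by blast
          qed
        qed
      qed
    qed
    have XB: "E \<inter> {\<phi> w} \<times> X e = {}" if e: "e \<in> T" and w: "w \<in> W" "\<phi> w \<notin> B e" for e w
    proof -
      have wA: "\<phi> w \<in> A" using \<phi>A w by blast
      have "E \<inter> {\<phi> w} \<times> I f = {}" if "f \<in> F" "f \<subseteq> B e" for f using nonadj[OF that(1), of "\<phi> w"] wA that(2) w(2) by blast
      moreover have "E \<inter> {\<phi> w} \<times> J e = {}" using J[OF e] indA wA by blast
      ultimately show ?thesis unfolding X_def by blast
    qed
    let ?P = "\<lambda>e. \<phi> (fst e) # p e @ [\<phi> (snd e)]"
    let ?V = "\<phi> ` W \<union> (\<Union>e\<in>T. set (p e))"
    have VP: "set (?P e) \<subseteq> ?V" if "e \<in> T" for e using TW[OF that] that by auto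
    have BP: "v \<in> set (?P e)" if "v \<in> B e" "v \<in> \<phi> ` W" "e \<in> T" for v e using that J[OF that(3)] by (auto simp: B_def)
    have arcs: "Restr E ?V = (\<Union>e\<in>T. path_arcs (?P e))"
    proof
      have pE: "z \<in> Restr E (set (?P e))" if "e \<in> T" "z \<in> path_arcs (?P e)" for z e
        using that(2) unfolding p(3)[OF that(1)] .
      have Ep: "(u, v) \<in> path_arcs (?P e)" if "e \<in> T" "(u, v) \<in> E" "u \<in> set (?P e)" "v \<in> set (?P e)" for u v e
        unfolding p(3)[OF that(1), symmetric] using that(2-4) by blast
      show "(\<Union>e\<in>T. path_arcs (?P e)) \<subseteq> Restr E ?V"
      proof
        fix z assume "z \<in> (\<Union>e\<in>T. path_arcs (?P e))"
        then obtain e where e: "e \<in> T" "z \<in> path_arcs (?P e)" by blast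
        show "z \<in> Restr E ?V" using pE[OF e] VP[OF e(1)] by blast
      qed
      have *: "(u, v) \<in> (\<Union>e\<in>T. path_arcs (?P e))" if uv: "(u, v) \<in> E" "u \<in> ?V" "e \<in> T" "v \<in> set (p e)" for u v e
      proof -
        have vX: "v \<in> X e" using pX uv by blast
        have "u \<in> set (?P e)"
        proof (cases "u \<in> \<phi> ` W")
          case True
          then have "u \<in> B e" using XB[OF uv(3)] uv(1) vX by blast
          then show ?thesis using BP True uv(3) by blast
        next
          case False
          then obtain e' where e': "e' \<in> T" "u \<in> set (p e')" using uv by blast
          then have "u \<in> X e'" using pX by blast
          then have "e' = e" using XX(2)[OF e'(1) uv(3)] uv(1) vX by blast
          then show ?thesis using e' by simp
        qed
        then have "(u, v) \<in> path_arcs (?P e)" by (rule Ep[OF uv(3,1)]) (use uv(4) in simp)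
        then show ?thesis using uv(3) by blast
      qed
      have psym: "(v, u) \<in> (\<Union>e\<in>T. path_arcs (?P e))" if uvP: "(u, v) \<in> (\<Union>e\<in>T. path_arcs (?P e))" for u v
      proof -
        obtain e where e: "e \<in> T" "(u, v) \<in> path_arcs (?P e)" using uvP by blast
        have "(u, v) \<in> E" "u \<in> set (?P e)" "v \<in> set (?P e)" using pE[OF e] by blast+
        then have "(v, u) \<in> path_arcs (?P e)" using Ep[OF e(1) symE] by blast
        then show ?thesis using e(1) by blast
      qed
      show "Restr E ?V \<subseteq> (\<Union>e\<in>T. path_arcs (?P e))"
      proof
        fix z assume z: "z \<in> Restr E ?V"
        obtain u v where uv: "z = (u, v)" by (cases z)
        have uv': "(u, v) \<in> E" "u \<in> ?V" "v \<in> ?V" using z uv by auto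
        have "\<not> (u \<in> \<phi> ` W \<and> v \<in> \<phi> ` W)" using indA \<phi>A uv'(1) by blast
        then consider e where "e \<in> T" "v \<in> set (p e)" | e where "e \<in> T" "u \<in> set (p e)" using uv' by blast
        then show "z \<in> (\<Union>e\<in>T. path_arcs (?P e))"
        proof cases
          case 1
          then show ?thesis using *[OF uv'(1,2)] uv by blast
        next
          case 2
          then show ?thesis using psym[OF *[OF symE[OF uv'(1)] uv'(3)]] uv by blast
        qed
      qed
    qed
    have "induced_path_system W T E A \<phi> p"
    proof (intro conjI)
      show "inj_on \<phi> W" "\<phi> ` W \<subseteq> A" by (fact inj \<phi>A)+
      show "Restr E (\<phi> ` W) = {}" using indA \<phi>A by blast
      show "\<forall>(x, y)\<in>T. distinct (\<phi> x # p (x, y) @ [\<phi> y]) \<and> set (p (x, y)) \<inter> \<phi> ` W = {}"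
      proof (rule ballI)
        fix e assume e: "e \<in> T"
        have "set (p e) \<inter> \<phi> ` W = {}" using pX[OF e] XW[OF e] by blast
        then show "case e of (x, y) \<Rightarrow> distinct (\<phi> x # p (x, y) @ [\<phi> y]) \<and> set (p (x, y)) \<inter> \<phi> ` W = {}"
          using p(1)[OF e] by (cases e) simp
      qed
      show "\<forall>e\<in>T. \<forall>e'\<in>T. e \<noteq> e' \<longrightarrow> set (p e) \<inter> set (p e') = {}" using pX XX(1) by blast
      show "Restr E ?V = (\<Union>(x, y)\<in>T. path_arcs (\<phi> x # p (x, y) @ [\<phi> y]))"
        unfolding arcs by (simp add: case_prod_beta)
    qed
    then show ?thesis by (intro exI)
  qed
  then show ?thesis by (intro exI[of _ c] allI impI)
qed

section \<open>Library subdivisions as path systems\<close>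

text \<open>In a subdivision \<open>S\<close> of \<open>F\<close>, an owner map sends every subdividing vertex to the edge of \<open>F\<close> that it subdivides.\<close>

definition edge_owner :: "'a pair_pre_digraph \<Rightarrow> 'a pair_pre_digraph \<Rightarrow> ('a \<Rightarrow> 'a set) \<Rightarrow> bool" where
  "edge_owner F S ow \<longleftrightarrow> (\<forall>z. z \<in> pverts S - pverts F \<longrightarrow> (\<exists>a b. ow z = {a, b})) \<and>
    (\<forall>x y. (x, y) \<in> parcs S \<longrightarrow> x \<notin> pverts F \<longrightarrow> y \<notin> pverts F \<longrightarrow> ow x = ow y) \<and>
    (\<forall>x y. (x, y) \<in> parcs S \<longrightarrow> x \<in> pverts F \<longrightarrow> y \<notin> pverts F \<longrightarrow> x \<in> ow y) \<and>
    (\<forall>x y. (x, y) \<in> parcs S \<longrightarrow> x \<notin> pverts F \<longrightarrow> y \<in> pverts F \<longrightarrow> y \<in> ow x)"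

lemma edge_ownerD:
  assumes "edge_owner F S ow"
  shows "z \<in> pverts S - pverts F \<Longrightarrow> \<exists>a b. ow z = {a, b}"
    and "(x, y) \<in> parcs S \<Longrightarrow> x \<notin> pverts F \<Longrightarrow> y \<notin> pverts F \<Longrightarrow> ow x = ow y"
    and "(x, y) \<in> parcs S \<Longrightarrow> x \<in> pverts F \<Longrightarrow> y \<notin> pverts F \<Longrightarrow> x \<in> ow y"
    and "(x, y) \<in> parcs S \<Longrightarrow> x \<notin> pverts F \<Longrightarrow> y \<in> pverts F \<Longrightarrow> y \<in> ow x" using assms unfolding edge_owner_def by simp_all

lemma subdivision_owner:
  assumes "pair_graph F" "subdivision_pair F S"
  shows "\<exists>ow. edge_owner F S ow" using assms(2)
proof (induction rule: subdivision_pair_induct)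
  case base
  interpret pair_graph F by fact
  show ?case using in_arcsD1 in_arcsD2 by (auto simp: edge_owner_def)
next
  case (divide e w S)
  interpret S: pair_bidirected_digraph S by (rule bidirected_digraphI_subdivision[OF divide(3)])
  obtain a b where e: "e = (a, b)" by (cases e)
  have ab: "a \<in> pverts S" "b \<in> pverts S" "(a, b) \<in> parcs S" using divide(1) S.in_arcsD1 S.in_arcsD2 by (auto simp: e)
  have wF: "w \<notin> pverts F" using subdivision_verts_subset[OF divide(3), of w] divide(2) by auto
  obtain ow where ow: "edge_owner F S ow" using divide.IH by blast
  note ow1 = edge_ownerD(1)[OF ow] and ow2 = edge_ownerD(2)[OF ow]
    and ow3 = edge_ownerD(3)[OF ow] and ow4 = edge_ownerD(4)[OF ow]
  \<comment> \<open>A new vertex inherits the owner of a subdividing end of the arc, on which two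
    such ends agree; between two branch vertices the arc itself becomes the owner.\<close>
  define own where "own = (if a \<notin> pverts F then ow a else if b \<notin> pverts F then ow b else {a, b})"
  have oa: "a \<notin> pverts F \<Longrightarrow> ow a = own" and oa': "a \<in> pverts F \<Longrightarrow> a \<in> own" using ow3[OF ab(3)] by (auto simp: own_def)
  have ob: "ow b = own" if b: "b \<notin> pverts F" using ow2[OF ab(3) _ b] b by (cases "a \<in> pverts F") (simp_all add: own_def)
  have ob': "b \<in> own" if b: "b \<in> pverts F" using ow4[OF ab(3) _ b] b by (cases "a \<in> pverts F") (simp_all add: own_def)
  have o2: "\<exists>a b. own = {a, b}"
  proof (cases "a \<in> pverts F \<and> b \<in> pverts F")
    case True
    then show ?thesis unfolding own_def by auto
  next
    case False
    then show ?thesis using ow1[of a] ow1[of b] ab(1,2) unfolding own_def by (cases "a \<in> pverts F") simp_all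
  qed
  have neq: "x \<noteq> w \<and> y \<noteq> w" if "(x, y) \<in> parcs S" for x y
    using divide(2) S.in_arcsD1[OF that] S.in_arcsD2[OF that] by blast
  have anw: "a \<noteq> w" "b \<noteq> w" using neq[OF ab(3)] by auto
  let ?ow = "ow(w := own)"
  have A: "\<exists>a b. ?ow z = {a, b}" if "z \<in> pverts (subdivide S e w) - pverts F" for z
    using that o2 ow1[of z] by (cases "z = w") auto
  have B: "(x \<notin> pverts F \<longrightarrow> y \<notin> pverts F \<longrightarrow> ?ow x = ?ow y) \<and>
      (x \<in> pverts F \<longrightarrow> y \<notin> pverts F \<longrightarrow> x \<in> ?ow y) \<and> (x \<notin> pverts F \<longrightarrow> y \<in> pverts F \<longrightarrow> y \<in> ?ow x)"
    if xy: "(x, y) \<in> parcs (subdivide S e w)" for x y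
  proof -
    consider "(x, y) \<in> parcs S" | "x = a" "y = w" | "x = w" "y = a" | "x = w" "y = b" | "x = b" "y = w"
      using xy unfolding e arcs_subdivide by blast
    then show ?thesis
    proof cases
      case 1
      then show ?thesis using ow2[OF 1] ow3[OF 1] ow4[OF 1] neq[OF 1] by simp
    next
      case 2
      then show ?thesis using oa oa' anw wF by (cases "a \<in> pverts F") simp_all
    next
      case 3
      then show ?thesis using oa oa' anw wF by (cases "a \<in> pverts F") simp_all
    next
      case 4
      then show ?thesis using ob ob' anw wF by (cases "b \<in> pverts F") simp_all
    next
      case 5
      then show ?thesis using ob ob' anw wF by (cases "b \<in> pverts F") simp_all
    qed
  qed
  have "edge_owner F (subdivide S e w) ?ow"
    unfolding edge_owner_def
  proof (intro conjI allI impI)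
    fix z assume "z \<in> pverts (subdivide S e w) - pverts F"
    then show "\<exists>a b. ?ow z = {a, b}" by (rule A)
  next
    fix x y assume "(x, y) \<in> parcs (subdivide S e w)" "x \<notin> pverts F" "y \<notin> pverts F"
    then show "?ow x = ?ow y" using B[of x y] by blast
  next
    fix x y assume "(x, y) \<in> parcs (subdivide S e w)" "x \<in> pverts F" "y \<notin> pverts F"
    then show "x \<in> ?ow y" using B[of x y] by blast
  next
    fix x y assume "(x, y) \<in> parcs (subdivide S e w)" "x \<notin> pverts F" "y \<in> pverts F"
    then show "y \<in> ?ow x" using B[of x y] by blast
  qed
  then show ?case by (intro exI[of _ ?ow])
qed

lemma path_inner_owner:
  assumes "path_arcs (ws @ [v]) \<subseteq> E" "ws \<noteq> []" "set ws \<inter> V = {}" "v \<in> V"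
    and "\<And>x y. (x, y) \<in> E \<Longrightarrow> x \<notin> V \<Longrightarrow> y \<notin> V \<Longrightarrow> ow x = ow y"
    and "\<And>x y. (x, y) \<in> E \<Longrightarrow> x \<notin> V \<Longrightarrow> y \<in> V \<Longrightarrow> y \<in> ow x"
  shows "\<forall>z\<in>set ws. ow z = ow (hd ws) \<and> v \<in> ow z" using assms(1-3)
proof (induction ws)
  case (Cons z ws)
  show ?case
  proof (cases ws)
    case Nil
    then have "(z, v) \<in> E" "z \<notin> V" using Cons.prems by auto
    then have "v \<in> ow z" by (rule assms(6)[OF _ _ assms(4)])
    then show ?thesis using Nil by simp
  next
    case ws: (Cons z' ws')
    have arc: "(z, z') \<in> E" "path_arcs (ws @ [v]) \<subseteq> E" using Cons.prems(1) by (auto simp: ws)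
    have nV: "z \<notin> V" "z' \<notin> V" "set ws \<inter> V = {}" using Cons.prems(3) by (auto simp: ws)
    have eq: "ow z = ow z'" by (rule assms(5)[OF arc(1) nV(1,2)])
    have IH: "\<forall>y\<in>set ws. ow y = ow z' \<and> v \<in> ow y"
      using Cons.IH[OF arc(2) _ nV(3)] by (simp only: ws list.simps list.sel) blast
    then have "v \<in> ow z'" by (simp add: ws)
    then show ?thesis using IH eq by simp
  qed
qed simp

lemma awalk_linked:
  assumes "pair_wf_digraph S" "pre_digraph.awalk (with_proj S) u p v"
  shows "linked (parcs S) (set (pre_digraph.awalk_verts (with_proj S) u p)) u v"
proof -
  interpret pair_wf_digraph S by fact
  show ?thesis using assms(2)
  proof (induction p arbitrary: u)
    case Nil
    then show ?case by (auto simp: awalk_simps linked_refl)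
  next
    case (Cons e p)
    obtain x y where e: "e = (x, y)" by (cases e)
    have p: "(u, y) \<in> parcs S" "x = u" "awalk y p v" using Cons.prems by (auto simp: awalk_simps e)
    have "y \<in> set (awalk_verts y p)" by (rule hd_in_awalk_verts(1)[OF p(3)])
    then have "linked (parcs S) (insert u (set (awalk_verts y p))) u y" using p(1) by (intro linked_arc) auto
    moreover have "linked (parcs S) (insert u (set (awalk_verts y p))) y v"
      by (rule linked_mono[OF Cons.IH[OF p(3)]]) auto
    ultimately have "linked (parcs S) (insert u (set (awalk_verts y p))) u v" by (rule linked_trans)
    then show ?case using p(2) by (simp add: e)
  qed
qed

text \<open>\<open>le_subdivision\<close> describes the path of each edge separately. Disjointness
  of the interiors is recovered from owners: an inner vertex of a path from \<open>u\<close> to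
  \<open>v\<close> can only be owned by \<open>{u, v}\<close>.\<close>

lemma le_subdivision_interiors:
  assumes F: "simple_graph F" and S: "le_subdivision k F S" and G: "subgraph (with_proj S) (with_proj G)"
  defines "Fs \<equiv> (\<lambda>(u, v). {u, v}) ` parcs F"
  shows "\<exists>I. path_interiors k (parcs G) (pverts G) (pverts F) Fs I"
proof -
  interpret F: pair_graph F using F by (simp add: simple_graph_def)
  have sd: "subdivision_pair F S" using S by (simp add: le_subdivision_def)
  interpret S: pair_graph S by (rule F.pair_graph_subdivision[OF sd])
  obtain ow where ow: "edge_owner F S ow" using subdivision_owner[OF F.pair_graph_axioms sd] by blast
  note ow1 = edge_ownerD(1)[OF ow] and ow2 = edge_ownerD(2)[OF ow]
    and ow3 = edge_ownerD(3)[OF ow] and ow4 = edge_ownerD(4)[OF ow]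
  have symS: "sym (parcs S)" using S.pair_sym_arcs by (simp add: symmetric_def)
  have irrS: "irrefl (parcs S)" using S.no_loops' by (auto simp: irrefl_def)
  have SG: "pverts S \<subseteq> pverts G" "parcs S \<subseteq> parcs G" using G by (auto simp: subgraph_def)
  have "\<exists>I. f \<subseteq> pverts F \<and> card f = 2 \<and> I \<subseteq> pverts S - pverts F \<and> card I \<le> k \<and> (\<forall>z\<in>I. ow z = f) \<and>
      (\<forall>u\<in>f. \<forall>v\<in>f. linked (parcs S) (I \<union> f) u v)" if f: "f \<in> Fs" for f
  proof -
    obtain u v where uv: "(u, v) \<in> parcs F" "f = {u, v}" using f by (auto simp: Fs_def)
    have uvV: "u \<in> pverts F" "v \<in> pverts F" "u \<noteq> v"
      using F.in_arcsD1[OF uv(1)] F.in_arcsD2[OF uv(1)] F.no_loops'[of u] uv(1) by auto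
    obtain p where "S.gen_iapath (pverts F) u p v" and len: "length (S.inner_verts p) \<le> k"
      using S uv(1) by (auto simp: le_subdivision_def)
    then have p: "S.apath u p v" "set (S.inner_verts p) \<inter> pverts F = {}" by (auto simp: S.gen_iapath_def)
    have aw: "S.awalk u p v" using p(1) by (simp add: S.apath_def)
    let ?X = "set (S.awalk_verts u p)"
    have inn: "set (S.inner_verts p) = ?X - {u, v}" by (rule S.set_inner_verts[OF p(1)])
    have XS: "?X \<subseteq> pverts S" using aw by (elim S.awalkE)
    have l: "linked (parcs S) ?X u v" using awalk_linked[OF S.pair_wf_digraph_axioms, of u p v] aw by simp
    have uX: "u \<in> ?X" "v \<in> ?X" 
    proof -
      show "u \<in> ?X" by (rule S.hd_in_awalk_verts(1)[OF aw])
      have "S.awlast u p = v" using aw by (auto elim!: S.awalkE)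
      then show "v \<in> ?X" using last_in_set[OF S.awalk_verts_non_Nil, of u p] by simp
    qed
    \<comment> \<open>The library walk is traded for a path in list form, along which owners can be
      traced; its inner vertices are among those of the walk.\<close>
    obtain ws where ws: "distinct (u # ws @ [v])" "set (u # ws @ [v]) \<subseteq> ?X"
      "Restr (parcs S) (set (u # ws @ [v])) = path_arcs (u # ws @ [v])"
      using linked_induced_path[OF _ symS irrS uX uvV(3) l] by auto
    have wsI: "set ws \<subseteq> set (S.inner_verts p)" using ws(1,2) by (auto simp: inn)
    have wsF: "set ws \<inter> pverts F = {}" using wsI p(2) by blast
    have pS: "path_arcs (u # ws @ [v]) \<subseteq> parcs S" using ws(3) by blast
    have "ow z = f" if z: "z \<in> set ws" for z
    proof -
      have ne: "ws \<noteq> []" using z by auto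
      have "path_arcs (ws @ [v]) \<subseteq> path_arcs (u # ws @ [v])" using ne by (cases ws) auto
      then have "\<forall>z\<in>set ws. ow z = ow (hd ws) \<and> v \<in> ow z"
        using pS by (intro path_inner_owner[where V = "pverts F" and E = "parcs S"] ne wsF uvV ow2 ow4) auto
      moreover have "u \<in> ow (hd ws)"
      proof -
        have "(u, hd ws) \<in> parcs S" using pS ne by (cases ws) auto
        moreover have "hd ws \<notin> pverts F" using wsF ne by (cases ws) auto
        ultimately show ?thesis using ow3 uvV by blast
      qed
      ultimately have "u \<in> ow z" "v \<in> ow z" using z by auto
      moreover have "z \<in> pverts S - pverts F" using z wsF ws(2) XS by auto
      ultimately show "ow z = f" using ow1[of z] uvV(3) uv(2) by auto
    qed
    moreover have "card (set ws) \<le> k"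
    proof -
      have "card (set ws) \<le> card (set (S.inner_verts p))" using wsI by (intro card_mono) auto
      then show ?thesis using len card_length[of "S.inner_verts p"] by linarith
    qed
    moreover have "linked (parcs S) (set ws \<union> f) u v"
      using linked_path_last[OF pS, of u] uv(2) by (simp add: insert_commute Un_commute)
    then have "\<forall>a\<in>f. \<forall>b\<in>f. linked (parcs S) (set ws \<union> f) a b" using uv(2) linked_sym[OF symS] linked_refl by auto
    moreover have "set ws \<subseteq> pverts S - pverts F" using wsF ws(2) XS by auto
    moreover have "f \<subseteq> pverts F" "card f = 2" using uvV uv(2) by auto
    ultimately show ?thesis by (intro exI[of _ "set ws"]) blast
  qed
  then obtain I where I: "\<And>f. f \<in> Fs \<Longrightarrow> f \<subseteq> pverts F \<and> card f = 2 \<and> I f \<subseteq> pverts S - pverts F \<and> card (I f) \<le> k \<and>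
      (\<forall>z\<in>I f. ow z = f) \<and> (\<forall>u\<in>f. \<forall>v\<in>f. linked (parcs S) (I f \<union> f) u v)" by metis
  have "linked (parcs G) X u v" if "linked (parcs S) X u v" for X u v
    using that rtrancl_mono[of "Restr (parcs S) X" "Restr (parcs G) X"] SG(2) unfolding linked_def by blast
  note lG = this
  show ?thesis
  proof (intro exI[of _ I] conjI ballI impI)
    fix f g assume fg: "f \<in> Fs" "g \<in> Fs" "f \<noteq> g"
    have "ow z = f" if "z \<in> I f" for z using I[OF fg(1)] that by blast
    moreover have "ow z = g" if "z \<in> I g" for z using I[OF fg(2)] that by blast
    ultimately show "I f \<inter> I g = {}" using fg(3) by blast
  next
    fix f u v assume f: "f \<in> Fs" "u \<in> f" "v \<in> f"
    have "linked (parcs S) (I f \<union> f) u v" using I[OF f(1)] f(2,3) by blast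
    then show "linked (parcs G) (I f \<union> f) u v" by (rule lG)
  next
    fix f assume f: "f \<in> Fs"
    show "f \<subseteq> pverts F" "card f = 2" "card (I f) \<le> k" using I[OF f] by simp_all
    show "I f \<subseteq> pverts G - pverts F" using I[OF f] SG(1) by blast
  qed
qed

section \<open>Building subdivisions from path systems\<close>

lemma path_arcs_inner:
  "ws \<noteq> [] \<Longrightarrow> (x, y) \<in> path_arcs (a # ws @ [b]) \<Longrightarrow> x \<in> set ws \<or> y \<in> set ws"
proof (induction ws arbitrary: a)
  case (Cons w ws)
  show ?case
  proof (cases "(x, y) \<in> {(a, w), (w, a)}")
    case True
    then show ?thesis by auto
  next
    case False
    then have xy: "(x, y) \<in> path_arcs (w # ws @ [b])" using Cons.prems(2) by auto
    show ?thesis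
    proof (cases "ws = []")
      case True
      then show ?thesis using xy by auto
    next
      case False
      then show ?thesis using Cons.IH[OF False xy] by auto
    qed
  qed
qed simp

text \<open>The arc is subdivided by the first vertex \<open>w\<close>, and the remaining list goes
  onto the arc from \<open>w\<close> to \<open>b\<close>; hence \<open>a\<close> varies in the
  induction while \<open>b\<close> stays.\<close>

lemma subdivide_arc_by_path:
  assumes "subdivision_pair H S" "(a, b) \<in> parcs S" "distinct ws" "set ws \<inter> pverts S = {}"
  shows "subdivision_pair H \<lparr>pverts = pverts S \<union> set ws, parcs = (parcs S - {(a, b), (b, a)}) \<union> path_arcs (a # ws @ [b])\<rparr>"
  using assms
proof (induction ws arbitrary: S a)
  case Nil
  interpret S: pair_bidirected_digraph S by (rule bidirected_digraphI_subdivision[OF Nil(1)])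
  have "(b, a) \<in> parcs S" using Nil(2) S.arcs_symmetric by blast
  then have "S = \<lparr>pverts = pverts S \<union> set [], parcs = (parcs S - {(a, b), (b, a)}) \<union> path_arcs (a # [] @ [b])\<rparr>"
    using Nil(2) by (intro pair_pre_digraph.equality) auto
  then show ?case using Nil(1) by simp
next
  case (Cons w ws)
  interpret S: pair_bidirected_digraph S by (rule bidirected_digraphI_subdivision[OF Cons.prems(1)])
  have w: "w \<notin> pverts S" "a \<in> pverts S" "b \<in> pverts S" "a \<noteq> b"
    using Cons.prems S.in_arcsD1 S.in_arcsD2 S.no_loops' by auto
  have wS: "(w, x) \<notin> parcs S" "(x, w) \<notin> parcs S" for x using w(1) S.in_arcsD1 S.in_arcsD2 by blast+
  let ?S = "subdivide S (a, b) w"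
  have "subdivision_pair H ?S" by (rule subdivision_pair_divide[OF Cons.prems(2) w(1) Cons.prems(1)])
  then have "subdivision_pair H \<lparr>pverts = pverts ?S \<union> set ws, parcs = (parcs ?S - {(w, b), (b, w)}) \<union> path_arcs (w # ws @ [b])\<rparr>"
    using Cons.prems by (intro Cons.IH) auto
  moreover have "parcs ?S - {(w, b), (b, w)} = (parcs S - {(a, b), (b, a)}) \<union> {(a, w), (w, a)}"
    using w wS by (auto simp: arcs_subdivide)
  ultimately show ?case by (simp add: Un_assoc insert_commute)
qed

lemma subdivide_by_paths:
  assumes H: "pair_graph H" and \<phi>: "inj_on \<phi> W"
    and T: "finite T" "T \<subseteq> W \<times> W" "T \<inter> T\<inverse> = {}" "map_prod \<phi> \<phi> ` T \<subseteq> parcs H"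
    and p: "\<And>e. e \<in> T \<Longrightarrow> distinct (p e) \<and> p e \<noteq> [] \<and> set (p e) \<inter> pverts H = {}"
    and disj: "\<And>e e'. e \<in> T \<Longrightarrow> e' \<in> T \<Longrightarrow> e \<noteq> e' \<Longrightarrow> set (p e) \<inter> set (p e') = {}"
  shows "subdivision_pair H \<lparr>pverts = pverts H \<union> (\<Union>e\<in>T. set (p e)),
    parcs = (parcs H - map_prod \<phi> \<phi> ` (T \<union> T\<inverse>)) \<union> (\<Union>(x, y)\<in>T. path_arcs (\<phi> x # p (x, y) @ [\<phi> y]))\<rparr>" using T p disj
proof (induction T rule: finite_induct)
  case empty
  interpret pair_graph H by fact
  have "subdivision_pair H H" by (rule subdivision_pair_base) unfold_locales
  moreover have eq: "\<lparr>pverts = pverts H \<union> (\<Union>e\<in>{}. set (p e)), parcs = (parcs H - map_prod \<phi> \<phi> ` ({} \<union> {}\<inverse>)) \<union>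
      (\<Union>(x, y)\<in>{}. path_arcs (\<phi> x # p (x, y) @ [\<phi> y]))\<rparr> = H" by (intro pair_pre_digraph.equality) auto
  ultimately show ?case unfolding eq by simp
next
  case (insert e T)
  interpret H: pair_graph H by fact
  obtain x y where e: "e = (x, y)" by (cases e)
  let ?M = "map_prod \<phi> \<phi> ` (T \<union> T\<inverse>)" and ?P = "\<Union>(x, y)\<in>T. path_arcs (\<phi> x # p (x, y) @ [\<phi> y])"
  let ?S = "\<lparr>pverts = pverts H \<union> (\<Union>e\<in>T. set (p e)), parcs = (parcs H - ?M) \<union> ?P\<rparr>"
  have S: "subdivision_pair H ?S" using insert.prems by (intro insert.IH) auto
  have xy: "(\<phi> x, \<phi> y) \<in> parcs H" using insert.prems(3) by (auto simp: e)
  have xyH: "\<phi> x \<in> pverts H" "\<phi> y \<in> pverts H" using H.in_arcsD1[OF xy] H.in_arcsD2[OF xy] by simp_all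
  have nT: "(x, y) \<notin> T \<union> T\<inverse>" using insert.prems(2) insert.hyps by (auto simp: e)
  have TW: "T \<union> T\<inverse> \<subseteq> W \<times> W" "(x, y) \<in> W \<times> W" using insert.prems(1) by (auto simp: e)
  \<comment> \<open>By injectivity of \<open>\<phi>\<close> this edge has not been replaced yet, in
    either orientation.\<close>
  have "map_prod \<phi> \<phi> (x, y) \<notin> ?M"
    unfolding inj_on_image_mem_iff[OF map_prod_inj_on[OF \<phi> \<phi>] TW(2,1)] by (rule nT)
  then have xyS: "(\<phi> x, \<phi> y) \<in> parcs ?S" using xy by simp
  have pe: "distinct (p e)" "set (p e) \<inter> pverts ?S = {}"
    using insert.prems(4)[of e] insert.prems(5)[of e] insert.hyps by auto
  have "subdivision_pair H \<lparr>pverts = pverts ?S \<union> set (p e),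
      parcs = (parcs ?S - {(\<phi> x, \<phi> y), (\<phi> y, \<phi> x)}) \<union> path_arcs (\<phi> x # p e @ [\<phi> y])\<rparr>"
    by (rule subdivide_arc_by_path[OF S xyS pe])
  moreover have "parcs ?S - {(\<phi> x, \<phi> y), (\<phi> y, \<phi> x)} = (parcs H - map_prod \<phi> \<phi> ` (insert e T \<union> (insert e T)\<inverse>)) \<union> ?P"
  proof -
    \<comment> \<open>Every arc of an earlier path has an inner vertex as an end, so removing the
      arcs of the current edge leaves those paths intact.\<close>
    have "(a, b) \<notin> ?P" if ab: "a \<in> pverts H" "b \<in> pverts H" for a b
    proof
      assume "(a, b) \<in> ?P"
      then obtain x' y' where T': "(x', y') \<in> T" "(a, b) \<in> path_arcs (\<phi> x' # p (x', y') @ [\<phi> y'])" by blast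
      have pT: "p (x', y') \<noteq> []" "set (p (x', y')) \<inter> pverts H = {}" using insert.prems(4)[of "(x', y')"] T'(1) by auto
      then show False using path_arcs_inner[OF pT(1) T'(2)] ab by blast
    qed
    moreover have "map_prod \<phi> \<phi> ` (insert e T \<union> (insert e T)\<inverse>) = {(\<phi> x, \<phi> y), (\<phi> y, \<phi> x)} \<union> ?M"
    proof -
      have "insert e T \<union> (insert e T)\<inverse> = {(x, y), (y, x)} \<union> (T \<union> T\<inverse>)" by (auto simp: e)
      then show ?thesis by (simp add: image_Un)
    qed
    ultimately show ?thesis using xyH by auto
  qed
  ultimately show ?case by (simp add: e Un_assoc Un_commute Un_left_commute)
qed

lemma induced_subgraph_Restr:
  assumes "pair_wf_digraph G" "W \<subseteq> pverts G"
  shows "induced_subgraph (with_proj \<lparr>pverts = W, parcs = Restr (parcs G) W\<rparr>) (with_proj G)"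
proof -
  have "pair_wf_digraph \<lparr>pverts = W, parcs = Restr (parcs G) W\<rparr>" by unfold_locales auto
  then have "subgraph (with_proj \<lparr>pverts = W, parcs = Restr (parcs G) W\<rparr>) (with_proj G)"
    unfolding subgraph_def using assms by (simp add: compatible_def wf_digraph_wp_iff)
  then show ?thesis unfolding induced_subgraph_def by auto
qed

lemma induced_sub_contains_subdivision:
  fixes H :: "'b pair_pre_digraph"
  assumes H: "simple_graph H"
  shows "\<exists>c::nat. \<forall>G :: 'a pair_pre_digraph. simple_graph G \<longrightarrow> has_induced_sub c (parcs G) (pverts G) \<longrightarrow>
    contains_induced G (\<lambda>S. is_subdivision_of S H)"
proof -
  interpret H: pair_graph H using H by (simp add: simple_graph_def)
  \<comment> \<open>An arbitrary numbering of the vertices, to select one orientation of every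
    edge.\<close>
  obtain g :: "'b \<Rightarrow> nat" where g: "inj_on g (pverts H)"
    using finite_imp_inj_to_nat_seg[OF H.pair_finite_verts] by (elim exE conjE)
  define T where "T = {(x, y) \<in> parcs H. g x < g y}"
  have finT: "finite T" by (rule finite_subset[OF _ H.pair_finite_arcs]) (auto simp: T_def)
  have TW: "T \<subseteq> pverts H \<times> pverts H" using H.in_arcsD1 H.in_arcsD2 by (auto simp: T_def)
  have Tanti: "T \<inter> T\<inverse> = {}" by (auto simp: T_def)
  have Hsym: "(y, x) \<in> parcs H" if "(x, y) \<in> parcs H" for x y using H.arcs_symmetric[OF that] .
  have TT: "parcs H = T \<union> T\<inverse>"
  proof
    show "parcs H \<subseteq> T \<union> T\<inverse>"
    proof
      fix e assume e: "e \<in> parcs H"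
      obtain x y where xy: "e = (x, y)" by (cases e)
      have "x \<noteq> y" "x \<in> pverts H" "y \<in> pverts H" using e H.no_loops'[of x] H.in_arcsD1 H.in_arcsD2 by (auto simp: xy)
      then have "g x \<noteq> g y" using inj_onD[OF g] by blast
      then show "e \<in> T \<union> T\<inverse>" using e Hsym[of x y] by (auto simp: T_def xy)
    qed
    show "T \<union> T\<inverse> \<subseteq> parcs H" using Hsym by (auto simp: T_def)
  qed
  obtain c :: nat where c: "\<forall>(E :: ('a \<times> 'a) set) A F I. sym E \<longrightarrow> irrefl E \<longrightarrow> induced_sub E A F I \<longrightarrow>
    c * card A < card F \<longrightarrow> (\<exists>\<phi> p. induced_path_system (pverts H) T E A \<phi> p)"
    using induced_sub_path_system[OF H.pair_finite_verts finT TW Tanti, where 'a='a] by (elim exE)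
  have "contains_induced G (\<lambda>S. is_subdivision_of S H)"
    if G: "simple_graph G" and has: "has_induced_sub c (parcs G) (pverts G)" for G :: "'a pair_pre_digraph"
  proof -
    obtain A F I where ind: "induced_sub (parcs G) A F I" and A: "A \<subseteq> pverts G" and "real c * card A < card F"
      using has by (elim exE conjE)
    then have dense: "c * card A < card F" by (simp flip: of_nat_mult)
    interpret G: pair_graph G using G by (simp add: simple_graph_def)
    have symG: "sym (parcs G)" using G.pair_sym_arcs by (simp add: symmetric_def)
    have irrG: "irrefl (parcs G)" using G.no_loops' by (auto simp: irrefl_def)
    obtain \<phi> p where R: "induced_path_system (pverts H) T (parcs G) A \<phi> p"
      using c[rule_format, OF symG irrG ind dense] by (elim exE)
    have inj: "inj_on \<phi> (pverts H)" using R by (elim conjE)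
    have \<phi>A: "\<phi> ` pverts H \<subseteq> A" using R by (elim conjE)
    have indep: "Restr (parcs G) (\<phi> ` pverts H) = {}" using R by (elim conjE)
    have pd: "\<forall>e\<in>T. \<forall>e'\<in>T. e \<noteq> e' \<longrightarrow> set (p e) \<inter> set (p e') = {}" using R by (elim conjE)
    have arcs: "Restr (parcs G) (\<phi> ` pverts H \<union> (\<Union>e\<in>T. set (p e))) =
        (\<Union>(x, y)\<in>T. path_arcs (\<phi> x # p (x, y) @ [\<phi> y]))" using R by (elim conjE)
    have pp0: "\<forall>(x, y)\<in>T. distinct (\<phi> x # p (x, y) @ [\<phi> y]) \<and> set (p (x, y)) \<inter> \<phi> ` pverts H = {}"
      using R by (elim conjE)
    have pp: "distinct (\<phi> x # p (x, y) @ [\<phi> y])" "set (p (x, y)) \<inter> \<phi> ` pverts H = {}"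
      if "(x, y) \<in> T" for x y using bspec[OF pp0 that] by simp_all
    let ?V = "\<phi> ` pverts H \<union> (\<Union>e\<in>T. set (p e))"
    \<comment> \<open>A library subdivision keeps the vertices of the graph it subdivides, so
      \<open>H\<close> is first copied onto the branch vertices.\<close>
    define H' where "H' = \<lparr>pverts = \<phi> ` pverts H, parcs = map_prod \<phi> \<phi> ` parcs H\<rparr>"
    define hom :: "('b, 'b \<times> 'b, 'a, 'a \<times> 'a) digraph_isomorphism" where
      "hom = \<lparr>iso_verts = \<phi>, iso_arcs = map_prod \<phi> \<phi>, iso_head = snd, iso_tail = fst\<rparr>"
    have injE: "inj_on (map_prod \<phi> \<phi>) (parcs H)"
    proof (rule inj_on_subset[OF map_prod_inj_on[OF inj inj]])
      show "parcs H \<subseteq> pverts H \<times> pverts H" using H.in_arcsD1 H.in_arcsD2 by auto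
    qed
    have "H.digraph_isomorphism hom"
      unfolding H.digraph_isomorphism_def by (simp add: hom_def inj injE H.wf_digraph)
    moreover have "with_proj H' = app_iso hom (with_proj H)" by (simp add: app_iso_def hom_def H'_def with_proj_def)
    ultimately have iso: "digraph_iso (with_proj H) (with_proj H')"
      unfolding digraph_iso_def by blast
    have H'g: "pair_graph H'"
    proof
      show "fst e \<in> pverts H'" "snd e \<in> pverts H'" if "e \<in> parcs H'" for e
        using that H.in_arcsD1 H.in_arcsD2 by (auto simp: H'_def)
      show "finite (pverts H')" "finite (parcs H')" using H.pair_finite_verts H.pair_finite_arcs by (auto simp: H'_def)
      show "fst e \<noteq> snd e" if e: "e \<in> parcs H'" for e
      proof -
        obtain x y where xy: "(x, y) \<in> parcs H" "e = (\<phi> x, \<phi> y)" using e by (auto simp: H'_def)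
        then have "x \<noteq> y" "x \<in> pverts H" "y \<in> pverts H" using H.no_loops' H.in_arcsD1 H.in_arcsD2 by blast+
        then show ?thesis using inj_onD[OF inj] xy(2) by auto
      qed
      show "symmetric (with_proj H')" using Hsym by (auto simp: symmetric_def sym_def H'_def)
    qed
    have arcs_H': "parcs H' = map_prod \<phi> \<phi> ` (T \<union> T\<inverse>)" by (simp add: H'_def TT)
    let ?S = "\<lparr>pverts = ?V, parcs = Restr (parcs G) ?V\<rparr>"
    have pne: "p (x, y) \<noteq> []" if xy: "(x, y) \<in> T" for x y
    proof
      assume "p (x, y) = []"
      then have "(\<phi> x, \<phi> y) \<in> path_arcs (\<phi> x # p (x, y) @ [\<phi> y])" by simp
      then have "(\<phi> x, \<phi> y) \<in> parcs G" using arcs xy by blast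
      then show False using indep xy TW by blast
    qed
    have "subdivision_pair H' \<lparr>pverts = pverts H' \<union> (\<Union>e\<in>T. set (p e)), parcs = (parcs H' - map_prod \<phi> \<phi> ` (T \<union> T\<inverse>)) \<union>
      (\<Union>(x, y)\<in>T. path_arcs (\<phi> x # p (x, y) @ [\<phi> y]))\<rparr>"
    proof (rule subdivide_by_paths[OF H'g inj finT TW Tanti])
      show "map_prod \<phi> \<phi> ` T \<subseteq> parcs H'" unfolding arcs_H' by blast
      show "distinct (p e) \<and> p e \<noteq> [] \<and> set (p e) \<inter> pverts H' = {}" if "e \<in> T" for e
        using that pp pne by (cases e) (simp add: H'_def)
      show "set (p e) \<inter> set (p e') = {}" if "e \<in> T" "e' \<in> T" "e \<noteq> e'" for e e' using pd that by blast
    qed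
    moreover have "pverts H' \<union> (\<Union>e\<in>T. set (p e)) = ?V" by (simp add: H'_def)
    ultimately have "subdivision_pair H' ?S" unfolding arcs_H' arcs by simp
    then have sub: "is_subdivision_of ?S H" unfolding is_subdivision_of_def using iso by blast
    \<comment> \<open>\<open>induced_path_system\<close> places only branch vertices in
      \<open>A\<close>; inner vertices belong to \<open>G\<close> because each lies on an
      arc.\<close>
    have "set (p e) \<subseteq> pverts G" if e: "e \<in> T" for e
    proof
      fix z assume z: "z \<in> set (p e)"
      obtain x y where xy: "e = (x, y)" by (cases e)
      have VG: "path_arcs (\<phi> x # p (x, y) @ [\<phi> y]) \<subseteq> parcs G" using arcs e xy by blast
      have "\<exists>w. (z, w) \<in> path_arcs (a # ws @ [b])" if "z \<in> set ws" for a b :: 'a and ws using that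
      proof (induction ws arbitrary: a)
        case (Cons w ws)
        then show ?case by (cases "z = w") auto
      qed simp
      then obtain w where "(z, w) \<in> parcs G" using z VG xy by blast
      then show "z \<in> pverts G" by (rule G.in_arcsD1)
    qed
    then have VG: "?V \<subseteq> pverts G" using \<phi>A A by blast
    have "induced_subgraph (with_proj ?S) (with_proj G)" by (rule induced_subgraph_Restr[OF G.pair_wf_digraph_axioms VG])
    then show ?thesis unfolding contains_induced_def using sub by blast
  qed
  then show ?thesis by (intro exI[of _ c] allI impI) simp
qed

section \<open>Excluding large bicliques by Ramsey's theorem\<close>

lemma biclique_free_if_no_induced:
  assumes "s > 0"
  shows "\<exists>t\<ge>1. \<forall>G :: 'a pair_pre_digraph. simple_graph G \<longrightarrow> \<not> contains_induced G (\<lambda>S. K\<^bsub>s\<^esub> (with_proj S)) \<longrightarrow>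
    \<not> contains_induced G (\<lambda>S. K\<^bsub>s,s\<^esub> (with_proj S)) \<longrightarrow> biclique_free t (parcs G)"
proof -
  \<comment> \<open>With \<open>t\<close> a Ramsey number for \<open>s\<close>, either side of a
    K_{t,t} contains an independent \<open>s\<close>-set, cliques being excluded, and the two sets
    together induce a K_{s,s}.\<close>
  obtain t where t: "t \<ge> 1" "\<And>(V::'a set) (E::'a set set). finite V \<Longrightarrow> card V \<ge> t \<Longrightarrow>
    \<exists>R\<subseteq>V. card R = s \<and> clique R E \<or> card R = s \<and> indep R E" using ramsey2[of s s] by blast
  have "biclique_free t (parcs G)"
    if G: "simple_graph G" and no: "\<not> contains_induced G (\<lambda>S. K\<^bsub>s\<^esub> (with_proj S))"
      "\<not> contains_induced G (\<lambda>S. K\<^bsub>s,s\<^esub> (with_proj S))" for G :: "'a pair_pre_digraph"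
    unfolding biclique_free_def
  proof
    interpret G: pair_graph G using G by (simp add: simple_graph_def)
    have Gsym: "(y, x) \<in> parcs G" if "(x, y) \<in> parcs G" for x y using G.arcs_symmetric[OF that] .
    have Girr: "(x, x) \<notin> parcs G" for x using G.no_loops' by blast
    note ind = induced_subgraph_Restr[OF G.pair_wf_digraph_axioms]
    define E where "E = {{x, y} | x y. (x, y) \<in> parcs G}"
    have E: "{x, y} \<in> E \<longleftrightarrow> (x, y) \<in> parcs G" for x y using Gsym by (auto simp: E_def doubleton_eq_iff)
    have noclique: False if R: "R \<subseteq> pverts G" "finite R" "card R = s" "clique R E" for R
    proof -
      have "Restr (parcs G) R = {(u, v). (u, v) \<in> R \<times> R \<and> u \<noteq> v}" using R(4) Girr E by (auto simp: clique_def)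
      then have "K\<^bsub>s\<^esub> (with_proj \<lparr>pverts = R, parcs = Restr (parcs G) R\<rparr>)"
        unfolding complete_digraph_pair_def using R by simp
      then show False using no(1) ind[OF R(1)] unfolding contains_induced_def by blast
    qed
    assume "\<exists>X Y. finite X \<and> finite Y \<and> card X = t \<and> card Y = t \<and> X \<times> Y \<subseteq> parcs G"
    then obtain X Y where XY: "finite X" "finite Y" "card X = t" "card Y = t" "X \<times> Y \<subseteq> parcs G" by blast
    have ne: "X \<noteq> {}" "Y \<noteq> {}" using XY t(1) by auto
    have sub: "X \<subseteq> pverts G" "Y \<subseteq> pverts G" using XY(5) ne G.in_arcsD1 G.in_arcsD2 by blast+
    obtain R1 where R1: "R1 \<subseteq> X" "card R1 = s" "clique R1 E \<or> indep R1 E" using t(2)[of X E] XY by auto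
    obtain R2 where R2: "R2 \<subseteq> Y" "card R2 = s" "clique R2 E \<or> indep R2 E" using t(2)[of Y E] XY by auto
    have fin: "finite R1" "finite R2" using R1 R2 XY finite_subset by blast+
    have i1: "indep R1 E" using R1 noclique[of R1] fin sub by blast
    have i2: "indep R2 E" using R2 noclique[of R2] fin sub by blast
    have no1: "(x, y) \<notin> parcs G" if "x \<in> R1" "y \<in> R1" for x y
      using i1 that E Girr[of x] by (cases "x = y") (auto simp: indep_def)
    have no2: "(x, y) \<notin> parcs G" if "x \<in> R2" "y \<in> R2" for x y
      using i2 that E Girr[of x] by (cases "x = y") (auto simp: indep_def)
    have R12: "R1 \<times> R2 \<subseteq> parcs G" using R1 R2 XY(5) by blast
    have disj: "R1 \<inter> R2 = {}" using R12 Girr by blast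
    let ?S = "\<lparr>pverts = R1 \<union> R2, parcs = Restr (parcs G) (R1 \<union> R2)\<rparr>"
    have "Restr (parcs G) (R1 \<union> R2) = R1 \<times> R2 \<union> R2 \<times> R1" using R12 no1 no2 Gsym by blast
    then have "K\<^bsub>s,s\<^esub> (with_proj ?S)"
      unfolding complete_bipartite_digraph_pair_def using fin disj R1 R2
      by (intro conjI exI[of _ R1] exI[of _ R2]) simp_all
    moreover have "induced_subgraph (with_proj ?S) (with_proj G)" using R1 R2 sub by (intro ind) blast
    ultimately show False using no(2) unfolding contains_induced_def by blast
  qed
  then show ?thesis using t(1) by (intro exI[of _ t]) simp
qed

section \<open>Bounds that are uniform over the class\<close>

theorem theorem3:
  fixes H :: "'b pair_pre_digraph"
    and s :: nat
    and \<G> :: "'a pair_pre_digraph set"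
  assumes "simple_graph H"
    and "s > 0"
    and "\<And>G. G \<in> \<G> \<Longrightarrow> simple_graph G"
    and "\<And>G. G \<in> \<G> \<Longrightarrow> \<not> contains_induced G (\<lambda>S. K\<^bsub>s\<^esub> (with_proj S))"
    and "\<And>G. G \<in> \<G> \<Longrightarrow> \<not> contains_induced G (\<lambda>S. K\<^bsub>s,s\<^esub> (with_proj S))"
    and "\<And>G. G \<in> \<G> \<Longrightarrow> \<not> contains_induced G (\<lambda>S. is_subdivision_of S H)"
  shows "bounded_expansion \<G>"
proof -
  obtain t where t: "t \<ge> 1" "\<And>G. G \<in> \<G> \<Longrightarrow> biclique_free t (parcs G)"
    using biclique_free_if_no_induced[OF assms(2), where 'a='a] assms(3-5) by blast
  obtain c :: nat where c: "\<forall>G :: 'a pair_pre_digraph. simple_graph G \<longrightarrow> has_induced_sub c (parcs G) (pverts G) \<longrightarrow>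
    contains_induced G (\<lambda>S. is_subdivision_of S H)"
    using induced_sub_contains_subdivision[OF assms(1), where 'a='a] by (elim exE)
  have noind: "\<not> has_induced_sub c (parcs G) (pverts G)" if G: "G \<in> \<G>" for G
    using c assms(3)[OF G] assms(6)[OF G] by blast
  obtain D0 :: real where D0: "\<forall>(E :: ('a \<times> 'a) set) V. finite V \<longrightarrow> V \<noteq> {} \<longrightarrow> sym E \<longrightarrow> irrefl E \<longrightarrow>
    biclique_free t E \<longrightarrow> D0 * card V \<le> card (Restr E V) \<longrightarrow>
    has_induced_sub c E V"
    using biclique_free_dense_induced_sub[OF _ t(1), of "real c", where 'a='a] by auto
  define D where "D = max D0 0"
  have D: "D \<ge> 0" "D \<ge> D0" by (auto simp: D_def)
  have graph: "finite (pverts G)" "sym (parcs G)" "irrefl (parcs G)" if "G \<in> \<G>" for G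
  proof -
    interpret G: pair_graph G using assms(3)[OF that] by (simp add: simple_graph_def)
    show "finite (pverts G)" "sym (parcs G)" "irrefl (parcs G)"
      using G.pair_finite_verts G.pair_sym_arcs G.no_loops' by (auto simp: symmetric_def irrefl_def)
  qed
  have sparse: "card (Restr (parcs G) X) \<le> D * card X" if G: "G \<in> \<G>" and X: "X \<subseteq> pverts G" for G X
  proof (rule ccontr)
    assume gt: "\<not> ?thesis"
    then have "X \<noteq> {}" by auto
    have "D0 * card X \<le> D * card X" using D by (intro mult_right_mono) auto
    then have le: "D0 * card X \<le> card (Restr (parcs G) X)" using gt by linarith
    obtain A F I where "induced_sub (parcs G) A F I" "A \<subseteq> X" "real c * card A < card F"
      using D0[rule_format, OF finite_subset[OF X graph(1)[OF G]] \<open>X \<noteq> {}\<close> graph(2,3)[OF G] t(2)[OF G] le] by (elim exE conjE)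
    then have "has_induced_sub c (parcs G) (pverts G)"
      using X by (meson order_trans)
    then show False using noind[OF G] by (rule notE[rotated])
  qed
  \<comment> \<open>The bound may depend on \<open>k\<close> but not on \<open>G\<close>: it is
    obtained from \<open>D\<close>, \<open>c\<close> and \<open>k\<close> alone.\<close>
  have "\<exists>N. \<forall>G\<in>\<G>. \<forall>F. simple_graph F \<longrightarrow> (\<exists>S. subgraph (with_proj S) (with_proj G) \<and> le_subdivision k F S) \<longrightarrow>
    avg_degree F \<le> N" for k
  proof -
    obtain N :: real where N: "\<forall>(E :: ('a \<times> 'a) set) V A F I. finite V \<longrightarrow> sym E \<longrightarrow> irrefl E \<longrightarrow>
      (\<forall>X\<subseteq>V. card (Restr E X) \<le> D * card X) \<longrightarrow> A \<subseteq> V \<longrightarrow>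
      path_interiors k E V A F I \<longrightarrow>
      N * card A < card F \<longrightarrow>
      (\<exists>A' F'. induced_sub E A' F' I \<and> A' \<subseteq> A \<and> F' \<subseteq> F \<and> real c * card A' < card F')"
      using subdivision_induced_sub[OF D(1), of "real c" k, where 'a='a] by auto
    \<comment> \<open>\<open>avg_degree\<close> counts arcs while \<open>N\<close> refers to
      edges.\<close>
    have "avg_degree F \<le> 2 * N" if G: "G \<in> \<G>" and F: "simple_graph F"
      and S: "subgraph (with_proj S) (with_proj G)" "le_subdivision k F S" for G F S
    proof (rule ccontr)
      assume gt: "\<not> ?thesis"
      interpret F: pair_graph F using F by (simp add: simple_graph_def)
      have "card (pverts F) > 0" using F F.pair_finite_verts by (simp add: simple_graph_def card_gt_0_iff)
      then have big: "2 * N * card (pverts F) < card (parcs F)" using gt by (simp add: avg_degree_def field_simps)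
      have symF: "sym (parcs F)" and irrF: "irrefl (parcs F)"
        using F.pair_sym_arcs F.no_loops' by (auto simp: symmetric_def irrefl_def)
      let ?Fs = "(\<lambda>(u, v). {u, v}) ` parcs F"
      have "card (parcs F) = 2 * card ?Fs" by (rule card_sym_arcs[OF F.pair_finite_arcs symF irrF])
      then have dense: "N * card (pverts F) < card ?Fs" using big by simp
      obtain I where I: "path_interiors k (parcs G) (pverts G) (pverts F) ?Fs I"
        using le_subdivision_interiors[OF F S(2,1)] by (elim exE)
      have FG: "pverts F \<subseteq> pverts G"
        using subdivision_verts_subset[of "with_proj F" _ "with_proj S"] S by (auto simp: le_subdivision_def subgraph_def)
      have sp: "\<forall>X\<subseteq>pverts G. card (Restr (parcs G) X) \<le> D * card X" using sparse[OF G] by blast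
      have "\<exists>A' F'. induced_sub (parcs G) A' F' I \<and> A' \<subseteq> pverts F \<and> F' \<subseteq> ?Fs \<and> real c * card A' < card F'"
        by (rule mp[OF mp[OF mp[OF mp[OF N[THEN spec, THEN spec, THEN spec, THEN spec, THEN spec,
          THEN mp, THEN mp, THEN mp, OF graph(1-3)[OF G]] sp] FG] I] dense])
      then have "has_induced_sub c (parcs G) (pverts G)"
        using FG by (meson order_trans)
      then show False using noind[OF G] by (rule notE[rotated])
    qed
    then show ?thesis by (intro exI[of _ "2 * N"]) blast
  qed
  then obtain N where N: "\<And>k G F S. G \<in> \<G> \<Longrightarrow> simple_graph F \<Longrightarrow> subgraph (with_proj S) (with_proj G) \<Longrightarrow>
    le_subdivision k F S \<Longrightarrow> avg_degree F \<le> N k" by metis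
  have "top_grad k G \<le> real (nat \<lceil>N k\<rceil>)" if G: "G \<in> \<G>" for k G
  proof -
    let ?A = "{F. simple_graph F \<and> (\<exists>S. subgraph (with_proj S) (with_proj G) \<and> le_subdivision k F S)}"
    have "top_grad k G = Max (avg_degree ` ?A)"
      unfolding top_grad_def by (rule arg_cong[of _ _ Max]) blast
    also have "\<dots> \<le> N k"
      by (rule Max.boundedI) (use top_grad_finite_nonempty[OF assms(3)[OF G], of k] N[OF G] in auto)
    also have "\<dots> \<le> real (nat \<lceil>N k\<rceil>)" by (rule real_nat_ceiling_ge)
    finally show ?thesis .
  qed
  then show ?thesis unfolding bounded_expansion_def by (intro exI[of _ "\<lambda>k. nat \<lceil>N k\<rceil>"]) blast
qed

end
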